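(* Let $\gamma\in(0,\infty)$ and let $H^{(\gamma)}_x = |x|\,\bigl(\log(|x|\vee 1)\bigr)^\gamma$ for $x\in\mathbb{Z}$. Then: (1) if $\gamma\le 2$, the graph $\mathrm{Comb}(\mathbb{Z},H^{(\gamma)})$ has the infinite collision property; (2) if $\gamma>2$, the graph $\mathrm{Comb}(\mathbb{Z},H^{(\gamma)})$ has the finite collision property.
   Context: For a profile $H=(H_x)_{x\in\mathbb{Z}}\in[0,\infty)^{\mathbb{Z}}$, the comb graph $\mathrm{Comb}(\mathbb{Z},H)$ has vertex set $V=\{(x,\ell)\in\mathbb{Z}\times\mathbb{N}_0: 0\le \ell\le H_x\}$; its edges are $\{(x,0),(y,0)\}$ for $|x-y|=1$, and $\{(x,\ell),(x,k)\}$ for $x\in\mathbb{Z}$, $|\ell-k|=1$ (both endpoints in $V$). A connected, locally finite graph $G=(V,E)$ has the infinite (resp. finite) collision property if, for some $x\in V$, two independent discrete-time simple random walks $(X^1_n)_{n\ge 0},(X^2_n)_{n\ge0}$ on $G$, both started at $x$, satisfy that the set $\{n: X^1_n=X^2_n\}$ is almost surely infinite (resp. finite). *)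

theory Defs
  imports "HOL-Probability.Probability" "Graph_Theory.Digraph_Component"
begin

text \<open>
  Graphs are symmetric loop-free pair digraphs: an undirected edge is the pair of its two
  orientations, so the arcs leaving a vertex are exactly its incident edges.
\<close>

definition connected_locally_finite_graph :: "'v pair_pre_digraph \<Rightarrow> bool" where
  "connected_locally_finite_graph G \<longleftrightarrow>
     pair_bidirected_digraph G \<and> Digraph_Component.connected (with_proj G) \<and>
     (\<forall>v\<in>pverts G. finite (out_arcs (with_proj G) v))"


section \<open>Simple random walk\<close>

definition neighbours :: "'v pair_pre_digraph \<Rightarrow> 'v \<Rightarrow> 'v set" where
  "neighbours G v = {u. (v, u) \<in> parcs G}"

text \<open>
  The step distribution is meaningful when the set of neighbours is finite and nonempty, i.e. at
  every vertex of a connected locally finite graph with more than one vertex; it is an unspecified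
  distribution otherwise.
\<close>

definition srw_step :: "'v pair_pre_digraph \<Rightarrow> 'v \<Rightarrow> 'v pmf" where
  "srw_step G v = pmf_of_set (neighbours G v)"

text \<open>Conditional law of the position at time \<open>n\<close> given the positions at times \<open>0, \<dots>, n - 1\<close>.\<close>

definition srw_kernel :: "'v pair_pre_digraph \<Rightarrow> 'v \<Rightarrow> nat \<Rightarrow> (nat \<Rightarrow> 'v) \<Rightarrow> 'v measure" where
  "srw_kernel G x n \<omega> =
     measure_pmf (case n of 0 \<Rightarrow> return_pmf x | Suc m \<Rightarrow> srw_step G (\<omega> m))"

lemma srw_Ionescu_Tulcea:
  fixes G :: "'v pair_pre_digraph"
  shows "Ionescu_Tulcea (srw_kernel G x) (\<lambda>_. count_space UNIV)"
proof (rule Ionescu_Tulcea.intro)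
  fix i
  show "srw_kernel G x i \<in> Pi\<^sub>M {0..<i} (\<lambda>_. count_space UNIV) \<rightarrow>\<^sub>M
          subprob_algebra (count_space UNIV)"
  proof (cases i)
    case 0
    then show ?thesis
      by (simp add: srw_kernel_def [abs_def] measure_pmf_in_subprob_algebra)
  next
    case (Suc m)
    have "(\<lambda>\<omega>. \<omega> m) \<in> Pi\<^sub>M {0..<i} (\<lambda>_. count_space UNIV) \<rightarrow>\<^sub>M
            (count_space UNIV :: 'v measure)"
      using Suc by (intro measurable_component_singleton) auto
    moreover have "(\<lambda>v. measure_pmf (srw_step G v)) \<in> count_space UNIV \<rightarrow>\<^sub>M
            subprob_algebra (count_space UNIV)"
      by (simp add: measure_pmf_in_subprob_algebra)
    ultimately show ?thesis
      unfolding Suc srw_kernel_def [abs_def] nat.case by (rule measurable_compose)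
  qed
next
  fix i and \<omega> :: "nat \<Rightarrow> 'v"
  show "prob_space (srw_kernel G x i \<omega>)"
    unfolding srw_kernel_def by (rule prob_space_measure_pmf)
qed

text \<open>
  The law on path space of the walk started at \<open>x\<close>, as given by the Ionescu-Tulcea theorem. By
  \<open>measure_srw_cylinder\<close> below it has the finite-dimensional distributions of simple random walk.
\<close>

definition srw_law :: "'v pair_pre_digraph \<Rightarrow> 'v \<Rightarrow> (nat \<Rightarrow> 'v) measure" where
  "srw_law G x =
     projective_family.lim (UNIV :: nat set)
       (Ionescu_Tulcea.CI (srw_kernel G x) (\<lambda>_. count_space UNIV)) (\<lambda>_. count_space UNIV)"

lemma sets_srw_law: "sets (srw_law G x) = sets (Pi\<^sub>M UNIV (\<lambda>_. count_space UNIV))"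
proof -
  interpret Ionescu_Tulcea "srw_kernel G x" "\<lambda>_. count_space UNIV" by (rule srw_Ionescu_Tulcea)
  show ?thesis unfolding srw_law_def by (rule PF.sets_lim)
qed

lemma prob_space_srw_law:
  fixes G :: "'v pair_pre_digraph"
  shows "prob_space (srw_law G x)"
proof -
  interpret Ionescu_Tulcea "srw_kernel G x" "\<lambda>_. count_space UNIV" by (rule srw_Ionescu_Tulcea)
  let ?S = "space (Pi\<^sub>M {} (\<lambda>_. count_space UNIV)) :: (nat \<Rightarrow> 'v) set"
  interpret C: prob_space "CI {}" by (rule PF.prob_space_P) simp_all
  have "space (CI {}) = ?S" by (simp add: CI_def)
  then have 1: "emeasure (CI {}) ?S = 1"
    using C.emeasure_space_1 by simp
  have 2: "PF.emb UNIV {} ?S = space PF.lim"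
    by (auto simp: prod_emb_def space_PiM)
  have "emeasure PF.lim (space PF.lim) = 1"
    using lim [of "{}" ?S] unfolding 1 2 by simp
  then show ?thesis
    unfolding srw_law_def by (rule prob_spaceI)
qed

lemma measure_srw_cylinder:
  fixes G :: "'v pair_pre_digraph"
  shows "measure (srw_law G x) {\<omega>. \<forall>i\<le>n. \<omega> i = p i} =
     (if p 0 = x then \<Prod>i<n. pmf (srw_step G (p i)) (p (Suc i)) else 0)"
proof -
  let ?K = "\<lambda>_::nat. count_space (UNIV :: 'v set)"
  interpret Ionescu_Tulcea "srw_kernel G x" ?K by (rule srw_Ionescu_Tulcea)
  define A where "A m = {restrict p {0..<m}}" for m
  define q where "q = (\<lambda>m. case m of 0 \<Rightarrow> return_pmf x | Suc k \<Rightarrow> srw_step G (p k))"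
  have A_sets [measurable]: "A m \<in> sets (Pi\<^sub>M {0..<m} ?K)" for m
  proof -
    have "A m = (\<Pi>\<^sub>E i\<in>{0..<m}. {p i})"
      by (auto simp: A_def PiE_iff extensional_def restrict_def fun_eq_iff)
    then show ?thesis by (simp add: sets_PiM_I_finite)
  qed
  have spA: "space (Pi\<^sub>M {0..<m} ?K) = extensional {0..<m}" for m
    by (simp add: space_PiM PiE_def)
  have step: "emeasure (eP m \<omega>) (A (Suc m)) =
      ennreal (pmf (q m) (p m)) * indicator (A m) \<omega>"
    if \<omega>: "\<omega> \<in> space (Pi\<^sub>M {0..<m} ?K)" for m \<omega>
  proof -
    have ext: "\<omega> i = undefined" if "\<not> i < m" for i
      using \<omega> that by (auto simp: spA extensional_def)
    have 1: "emeasure (eP m \<omega>) (A (Suc m)) =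
        emeasure (srw_kernel G x m \<omega>) (fun_upd \<omega> m -` A (Suc m))"
      using emeasure_eP [OF \<omega> A_sets] by simp
    show ?thesis
    proof (cases "\<omega> \<in> A m")
      case True
      then have w: "\<omega> = restrict p {0..<m}" by (simp add: A_def)
      have "fun_upd \<omega> m -` A (Suc m) = {p m}"
        by (auto simp: A_def w fun_eq_iff split: if_splits dest!: spec [of _ m])
      moreover have "srw_kernel G x m \<omega> = measure_pmf (q m)"
        by (auto simp: srw_kernel_def q_def w split: nat.split)
      ultimately show ?thesis
        using True by (simp add: 1 emeasure_pmf_single)
    next
      case False
      then obtain i where i: "\<omega> i \<noteq> restrict p {0..<m} i"
        by (auto simp: A_def fun_eq_iff)
      then have "i < m" using ext by (cases "i < m") auto
      then have "fun_upd \<omega> m -` A (Suc m) = {}"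
        using i by (auto simp: A_def fun_eq_iff dest!: spec [of _ i])
      then show ?thesis using False by (simp add: 1)
    qed
  qed
  have C: "emeasure (C 0 m (\<lambda>_. undefined)) (A m) = ennreal (\<Prod>i<m. pmf (q i) (p i))" for m
  proof (induction m)
    case 0
    have "(\<lambda>_. undefined) \<in> A 0" by (simp add: A_def restrict_def)
    then show ?case using A_sets [of 0] by simp
  next
    case (Suc m)
    have u: "(\<lambda>_. undefined) \<in> space (Pi\<^sub>M {0..<0} ?K)" by simp
    have sp: "space (C 0 m (\<lambda>_. undefined)) = space (Pi\<^sub>M {0..<m} ?K)"
      using space_C [OF u, of m] by simp
    have st: "sets (C 0 m (\<lambda>_. undefined)) = sets (Pi\<^sub>M {0..<m} ?K)"
      using sets_C [OF u, of m] by simp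
    have "emeasure (C 0 (Suc m) (\<lambda>_. undefined)) (A (Suc m)) =
        (\<integral>\<^sup>+\<omega>. emeasure (eP m \<omega>) (A (Suc m)) \<partial>C 0 m (\<lambda>_. undefined))"
      unfolding C.simps add_0
    proof (rule emeasure_bind [OF _ _ A_sets])
      show "space (C 0 m (\<lambda>_. undefined)) \<noteq> {}"
        unfolding sp by (auto simp: space_PiM PiE_eq_empty_iff)
      show "eP m \<in> C 0 m (\<lambda>_. undefined) \<rightarrow>\<^sub>M subprob_algebra (Pi\<^sub>M {0..<Suc m} ?K)"
        using measurable_eP [of m] by (simp cong: measurable_cong_sets add: st)
    qed
    also have "\<dots> = (\<integral>\<^sup>+\<omega>. ennreal (pmf (q m) (p m)) * indicator (A m) \<omega>
        \<partial>C 0 m (\<lambda>_. undefined))"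
      by (intro nn_integral_cong step) (simp add: sp)
    also have "\<dots> = ennreal (pmf (q m) (p m)) * emeasure (C 0 m (\<lambda>_. undefined)) (A m)"
      by (rule nn_integral_cmult_indicator) (simp add: st A_sets)
    finally show ?case
      by (simp add: Suc ennreal_mult prod_nonneg mult.commute)
  qed
  have cyl: "{\<omega>. \<forall>i\<le>n. \<omega> i = p i} = PF.emb UNIV {0..<Suc n} (A (Suc n))"
    by (auto simp: prod_emb_def A_def space_PiM fun_eq_iff restrict_def less_Suc_eq_le) metis
  have "emeasure (srw_law G x) {\<omega>. \<forall>i\<le>n. \<omega> i = p i} = emeasure (CI {0..<Suc n}) (A (Suc n))"
    unfolding cyl srw_law_def by (rule lim) simp_all
  also have "\<dots> = emeasure (C 0 (Suc n) (\<lambda>_. undefined)) (A (Suc n))"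
  proof -
    have "PF.emb {0..<Suc n} {0..<Suc n} (A (Suc n)) = A (Suc n)"
      by (rule prod_emb_id) (auto simp: A_def PiE_def extensional_def)
    then show ?thesis
      by (subst emeasure_CI [of _ "Suc n"]) simp_all
  qed
  also have "\<dots> = ennreal (\<Prod>i<Suc n. pmf (q i) (p i))" by (rule C)
  finally have "measure (srw_law G x) {\<omega>. \<forall>i\<le>n. \<omega> i = p i} = (\<Prod>i<Suc n. pmf (q i) (p i))"
    by (simp add: measure_def prod_nonneg)
  also have "\<dots> = pmf (q 0) (p 0) * (\<Prod>i<n. pmf (q (Suc i)) (p (Suc i)))"
    by (rule prod.lessThan_Suc_shift)
  finally show ?thesis by (simp add: q_def indicator_def)
qed


section \<open>Collision properties\<close>

text \<open>
  The product measure is the joint law of two independent walks, and collisions depend on the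
  walks only through their joint law.
\<close>

definition infinite_collision_property :: "'v pair_pre_digraph \<Rightarrow> bool" where
  "infinite_collision_property G \<longleftrightarrow>
     connected_locally_finite_graph G \<and>
     (\<exists>x\<in>pverts G. AE (X1, X2) in srw_law G x \<Otimes>\<^sub>M srw_law G x. infinite {n. X1 n = X2 n})"

definition finite_collision_property :: "'v pair_pre_digraph \<Rightarrow> bool" where
  "finite_collision_property G \<longleftrightarrow>
     connected_locally_finite_graph G \<and>
     (\<exists>x\<in>pverts G. AE (X1, X2) in srw_law G x \<Otimes>\<^sub>M srw_law G x. finite {n. X1 n = X2 n})"


section \<open>Comb graphs\<close>

text \<open>Profiles \<open>H\<close> are meant to be nonnegative.\<close>

definition comb_verts :: "(int \<Rightarrow> real) \<Rightarrow> (int \<times> nat) set" where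
  "comb_verts H = {(x, l). real l \<le> H x}"

definition comb :: "(int \<Rightarrow> real) \<Rightarrow> (int \<times> nat) pair_pre_digraph" where
  "comb H =
     \<lparr>pverts = comb_verts H,
      parcs = {(u, v). u \<in> comb_verts H \<and> v \<in> comb_verts H \<and>
        ((\<exists>x y. u = (x, 0) \<and> v = (y, 0) \<and> \<bar>x - y\<bar> = 1) \<or>
         (\<exists>x l k. u = (x, l) \<and> v = (x, k) \<and> \<bar>int l - int k\<bar> = 1))}\<rparr>"

definition log_profile :: "real \<Rightarrow> int \<Rightarrow> real" where
  "log_profile \<gamma> x = \<bar>real_of_int x\<bar> * ln (max \<bar>real_of_int x\<bar> 1) powr \<gamma>"

lemma log_profile_nonneg: "0 \<le> log_profile \<gamma> x"
  by (simp add: log_profile_def)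

lemma connected_locally_finite_comb:
  assumes H: "\<And>x. 0 \<le> H x"
  shows "connected_locally_finite_graph (comb H)"
proof -
  let ?G = "with_proj (comb H)"
  have V0: "(x, 0) \<in> comb_verts H" for x
    using H by (simp add: comb_verts_def)
  have comb_verts [simp]: "pverts (comb H) = comb_verts H"
    by (simp add: comb_def)
  have sym: "sym (parcs (comb H))"
    by (rule symI) (auto simp: comb_def abs_minus_commute)
  interpret pair_bidirected_digraph "comb H"
  proof
    show "symmetric ?G" using sym by (simp add: symmetric_def)
  qed (auto simp: comb_def)
  have tooth: "(x, l) \<rightarrow>\<^sup>*\<^bsub>?G\<^esub> (x, 0)" if "(x, l) \<in> comb_verts H" for x l
    using that
  proof (induction l)
    case 0
    then show ?case by simp
  next
    case (Suc l)
    then have l: "(x, l) \<in> comb_verts H" by (auto simp: comb_verts_def)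
    with Suc have "((x, Suc l), (x, l)) \<in> parcs (comb H)" by (auto simp: comb_def)
    with Suc.IH [OF l] show ?case
      by (meson adj_reachable_trans with_proj_simps(3))
  qed
  have spine_nat: "(x, 0) \<rightarrow>\<^sup>*\<^bsub>?G\<^esub> (x + int n, 0)" for x n
  proof (induction n)
    case 0
    show ?case using V0 [of x] by (simp add: reachable_refl)
  next
    case (Suc n)
    have "((x + int n, 0), (x + int (Suc n), 0)) \<in> parcs (comb H)"
      using V0 by (auto simp: comb_def)
    with Suc.IH show ?case
      by (meson reachable_adj_trans with_proj_simps(3))
  qed
  have swap: "v \<rightarrow>\<^sup>*\<^bsub>?G\<^esub> u" if "u \<rightarrow>\<^sup>*\<^bsub>?G\<^esub> v" for u v
    using that sym by (simp add: symmetric_reachable symmetric_def)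
  have spine: "(x, 0) \<rightarrow>\<^sup>*\<^bsub>?G\<^esub> (y, 0)" for x y
  proof (cases "x \<le> y")
    case True
    then show ?thesis using spine_nat [of x "nat (y - x)"] by simp
  next
    case False
    then show ?thesis using swap [OF spine_nat [of y "nat (x - y)"]] by simp
  qed
  have "u \<rightarrow>\<^sup>*\<^bsub>?G\<^esub> v" if "u \<in> comb_verts H" "v \<in> comb_verts H" for u v
    using that tooth [of "fst u" "snd u"] swap [OF tooth [of "fst v" "snd v"]]
      spine [of "fst u" "fst v"]
    by (metis prod.collapse reachable_trans)
  moreover have "symmetric ?G" using sym by (simp add: symmetric_def)
  ultimately have "Digraph_Component.connected ?G"
    using V0 by (intro connectedI) (auto simp: reachable_mk_symmetric_eq)
  moreover have "finite (out_arcs ?G (x, l))" for x l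
  proof (rule finite_subset)
    show "out_arcs ?G (x, l) \<subseteq> {(x, l)} \<times> ({x - 1..x + 1} \<times> {..Suc l})"
      by (auto simp: out_arcs_def comb_def)
  qed simp
  ultimately show ?thesis
    unfolding connected_locally_finite_graph_def
    by (auto intro: pair_bidirected_digraph_axioms)
qed

end

theory Submission
  imports Defs "HOL-Real_Asymp.Real_Asymp"
begin

text \<open>
  Let \<open>p n\<close> be the \<open>n\<close>-step transition probabilities of one walk, and weight a collision at the
  vertex \<open>(x, l)\<close> by \<open>\<epsilon> x / (1 + l)\<close>. On the dyadic scale \<open>\<bar>x\<bar> \<approx> 2 ^ j\<close> the walks need a time of order
  \<open>4 ^ j * H (2 ^ j)\<close>, they meet about \<open>1 / H x\<close> times at each vertex \<open>(x, l)\<close> with \<open>l \<le> \<bar>x\<bar>\<close>, and the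
  harmonic sum over \<open>l\<close> contributes a factor \<open>j\<close>. With \<open>\<epsilon> = 1\<close> the expected weighted number of
  collisions is therefore comparable to \<open>\<Sum>j. j powr (1 - \<gamma>)\<close>, which is finite iff \<open>\<gamma> > 2\<close>.

  The upper bound comes from Plancherel: \<open>\<Sum>n. s ^ (2 * n) * (p n a z)\<^sup>2\<close> is the mean square over the
  circle of the generating function of \<open>p n a z\<close>, which solves a resolvent equation with a complex
  parameter. Its real and imaginary parts bound the Dirichlet energy plus \<open>\<lambda>\<close> times the squared norm
  of the solution by its value at \<open>a\<close>, exactly as for a walk with real killing rate
  \<open>\<lambda> = max \<bar>sin \<theta>\<bar> (1 - s)\<close>, and the geometry of the comb converts this into pointwise bounds.

  If \<open>\<gamma> > 2\<close>, every collision is followed by a weighted number of collisions whose mean is bounded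
  below, so finite expectation gives finitely many collisions. If \<open>\<gamma> \<le> 2\<close>, take
  \<open>\<epsilon> x = (1 + ln \<bar>x\<bar>) powr (\<gamma> - 2)\<close>: the expected weighted number diverges, the second moment method
  gives infinitely many collisions with positive probability, and a zero-one law concludes.
\<close>

subsection \<open>Simple random walk on a comb\<close>

text \<open>The weight \<open>1 / (1 + l)\<close> serves uniformity in the starting point. Two walks
  that meet at height \<open>l\<close> of a longer tooth stay near that height for about
  \<open>l\<^sup>2\<close> steps and meet about \<open>l\<close> times, so the unweighted mean
  number of further collisions is unbounded over the comb. With the weight it is at least a
  constant, and at most a constant plus twice any bound valid on the spine. The first fact feeds the
  transience argument, the second the second moment method.

  The energy method gives such a bound only from spine vertices: there the resistance to the killing
  at scale \<open>2 ^ j\<close> is at most of order \<open>2 ^ j\<close>, while high up a tooth it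
  can be larger. Starting points on teeth are therefore reduced to the spine, by a Lyapunov function
  for two walks on one tooth and by polarization.

  Complex parameters do little harm because only quadratic forms of the solution are used. The
  resolvent estimate needs \<open>cos \<theta> \<ge> 0\<close>; as the comb is bipartite, the
  squared modulus of a generating function has period \<open>pi\<close> in \<theta>, and half of the
  circle suffices.\<close>

locale comb_walk =
  fixes h :: "int \<Rightarrow> nat"
begin

definition verts :: "(int \<times> nat) set" where
  "verts = {(x, l). l \<le> h x}"

text \<open>Total on all pairs: above the tip of a tooth the vertex below still counts as a
  neighbour. Hence \<open>deg\<close> is positive and \<open>av\<close> fixes constants everywhere;
  it is symmetry that requires membership in \<open>verts\<close>.\<close>

definition nb :: "int \<times> nat \<Rightarrow> (int \<times> nat) set" where
  "nb v = (case v of (x, l) \<Rightarrow>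
     (if l = 0 then {(x - 1, 0), (x + 1, 0)} else {(x, l - 1)}) \<union>
     (if l < h x then {(x, Suc l)} else {}))"

abbreviation deg :: "int \<times> nat \<Rightarrow> real" where
  "deg v \<equiv> real (card (nb v))"

definition av :: "(int \<times> nat \<Rightarrow> real) \<Rightarrow> int \<times> nat \<Rightarrow> real" where
  "av \<phi> v = (\<Sum>w\<in>nb v. \<phi> w) / deg v"

primrec p :: "nat \<Rightarrow> int \<times> nat \<Rightarrow> int \<times> nat \<Rightarrow> real" where
  "p 0 v w = of_bool (v = w)"
| "p (Suc n) v w = av (\<lambda>y. p n y w) v"

definition box :: "int \<times> nat \<Rightarrow> nat \<Rightarrow> (int \<times> nat) set" where
  "box v n = Sigma {fst v - int n..fst v + int n} (\<lambda>x. {..h x})"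

lemma finite_box [simp]: "finite (box v n)"
  by (simp add: box_def)

lemma finite_nb [simp]: "finite (nb v)"
  by (simp add: nb_def split: prod.split)

lemma nb_nonempty [simp]: "nb v \<noteq> {}"
  by (auto simp: nb_def split: prod.split)

lemma deg_pos [simp]: "0 < deg v"
  by (simp add: card_gt_0_iff)

lemma deg_ge_1: "1 \<le> deg v"
  by (simp add: Suc_le_eq card_gt_0_iff)

lemma deg_le_3: "deg v \<le> 3"
proof -
  obtain x l where v: "v = (x, l)" by force
  have "card (nb v) \<le> card {(x - 1, 0), (x + 1, 0), (x, Suc l)} \<or>
        card (nb v) \<le> card {(x, l - 1), (x, Suc l)}"
    by (cases "l = 0"; intro disjI1 card_mono disjI2 card_mono)
      (auto simp: nb_def v)
  moreover have "card {(x - 1, 0::nat), (x + 1, 0), (x, Suc l)} \<le> 3"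
    by (intro order.trans [OF card_insert_le_m1]) (auto simp: card_insert_if)
  moreover have "card {(x, l - 1), (x, Suc l)} \<le> 3"
    by (auto simp: card_insert_if)
  ultimately have "card (nb v) \<le> 3" by linarith
  then show ?thesis by simp
qed

lemma nb_verts: "v \<in> verts \<Longrightarrow> w \<in> nb v \<Longrightarrow> w \<in> verts"
  by (auto simp: nb_def verts_def split: prod.splits if_splits)

lemma nb_sym: "v \<in> verts \<Longrightarrow> w \<in> nb v \<Longrightarrow> v \<in> nb w"
  by (auto simp: nb_def verts_def split: prod.splits if_splits)

lemma nb_iff: "v \<in> verts \<Longrightarrow> w \<in> verts \<Longrightarrow> w \<in> nb v \<longleftrightarrow> v \<in> nb w"
  using nb_sym by blast

lemma av_mono: "(\<And>w. w \<in> nb v \<Longrightarrow> \<phi> w \<le> \<psi> w) \<Longrightarrow> av \<phi> v \<le> av \<psi> v"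
  unfolding av_def by (intro divide_right_mono sum_mono) auto

lemma av_cong: "(\<And>w. w \<in> nb v \<Longrightarrow> \<phi> w = \<psi> w) \<Longrightarrow> av \<phi> v = av \<psi> v"
  unfolding av_def by (metis sum.cong)

lemma av_const [simp]: "av (\<lambda>_. c) v = c"
  using deg_pos [of v] by (simp add: av_def del: deg_pos)

lemma av_nonneg: "(\<And>w. w \<in> nb v \<Longrightarrow> 0 \<le> \<phi> w) \<Longrightarrow> 0 \<le> av \<phi> v"
  unfolding av_def by (intro divide_nonneg_nonneg sum_nonneg) auto

lemma av_le_const: "(\<And>w. w \<in> nb v \<Longrightarrow> \<phi> w \<le> c) \<Longrightarrow> av \<phi> v \<le> c"
  using av_mono [of v \<phi> "\<lambda>_. c"] by simp

lemma av_add: "av (\<lambda>w. \<phi> w + \<psi> w) v = av \<phi> v + av \<psi> v"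
  by (simp add: av_def sum.distrib add_divide_distrib)

lemma av_diff: "av (\<lambda>w. \<phi> w - \<psi> w) v = av \<phi> v - av \<psi> v"
  by (simp add: av_def sum_subtractf diff_divide_distrib)

lemma av_cmult: "av (\<lambda>w. c * \<phi> w) v = c * av \<phi> v"
  by (simp add: av_def sum_distrib_left)

lemma av_sum: "av (\<lambda>w. \<Sum>i\<in>I. \<phi> i w) v = (\<Sum>i\<in>I. av (\<phi> i) v)"
  unfolding av_def by (subst sum.swap) (simp add: sum_divide_distrib)

lemma av_swap: "av (\<lambda>a. av (\<lambda>b. F a b) w) v = av (\<lambda>b. av (\<lambda>a. F a b) v) w"
  unfolding av_def
  by (simp add: sum_divide_distrib [symmetric]) (subst sum.swap, simp add: mult.commute)

lemma av_tooth:
  assumes "0 < l" "l \<le> h x"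
  shows "av \<phi> (x, l) = (if l < h x then (\<phi> (x, l - 1) + \<phi> (x, Suc l)) / 2 else \<phi> (x, l - 1))"
proof -
  have "l - Suc 0 \<noteq> Suc l" by linarith
  then show ?thesis using assms by (simp add: av_def nb_def)
qed

lemma av_spine:
  "av \<phi> (x, 0) = (if 0 < h x then (\<phi> (x - 1, 0) + \<phi> (x + 1, 0) + \<phi> (x, 1)) / 3
     else (\<phi> (x - 1, 0) + \<phi> (x + 1, 0)) / 2)"
  by (simp add: av_def nb_def)

lemma p_nonneg [simp]: "0 \<le> p n v w"
  by (induction n arbitrary: v) (auto intro: av_nonneg)

lemma p_le_1: "p n v w \<le> 1"
  by (induction n arbitrary: v) (auto intro: av_le_const)

lemma box_nb: "y \<in> nb v \<Longrightarrow> box y n \<subseteq> box v (Suc n)"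
  by (auto simp: box_def nb_def split: prod.splits if_splits)

lemma p_support: "v \<in> verts \<Longrightarrow> p n v w \<noteq> 0 \<Longrightarrow> w \<in> box v n"
proof (induction n arbitrary: v)
  case 0
  then show ?case by (auto simp: box_def verts_def)
next
  case (Suc n)
  have "\<exists>y\<in>nb v. p n y w \<noteq> 0"
  proof (rule ccontr)
    assume "\<not> ?thesis"
    then have "av (\<lambda>y. p n y w) v = av (\<lambda>_. 0) v" by (intro av_cong) auto
    then show False using Suc.prems by simp
  qed
  then obtain y where "y \<in> nb v" "p n y w \<noteq> 0" by blast
  with Suc.IH [of y] Suc.prems nb_verts box_nb show ?case by blast
qed

lemma box_subset_verts: "box v n \<subseteq> verts"
  by (auto simp: box_def verts_def)

lemma av_pow_eq_sum:
  assumes "finite S" "box v n \<subseteq> S" "v \<in> verts"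
  shows "(av ^^ n) \<phi> v = (\<Sum>w\<in>S. p n v w * \<phi> w)"
  using assms
proof (induction n arbitrary: v)
  case 0
  have "v \<in> S" using 0 by (auto simp: box_def verts_def)
  have "(\<Sum>w\<in>S. p 0 v w * \<phi> w) = (\<Sum>w\<in>S. if v = w then \<phi> w else 0)"
    by (intro sum.cong) auto
  with \<open>v \<in> S\<close> 0 show ?case by simp
next
  case (Suc n)
  have "(av ^^ Suc n) \<phi> v = av (\<lambda>y. \<Sum>w\<in>S. p n y w * \<phi> w) v"
    unfolding funpow.simps o_def
    using Suc.prems box_nb nb_verts by (intro av_cong Suc.IH) blast+
  also have "\<dots> = (\<Sum>w\<in>S. p (Suc n) v w * \<phi> w)"
    by (subst av_sum) (simp add: mult.commute av_cmult)
  finally show ?case .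
qed

lemma sum_p_eq_1:
  assumes "finite S" "box v n \<subseteq> S" "v \<in> verts"
  shows "(\<Sum>w\<in>S. p n v w) = 1"
proof -
  have "(av ^^ n) (\<lambda>_. 1) = (\<lambda>_. 1)"
  proof (induction n)
    case (Suc n)
    then show ?case by (auto intro: ext simp del: split_paired_All)
  qed auto
  then show ?thesis using av_pow_eq_sum [OF assms, of "\<lambda>_. 1"] by simp
qed

text \<open>\<open>p\<close> is built from the first step. The last-step form rests on the symmetry
  of adjacency, and it is the one that makes generating functions, as functions of the end point,
  solve a resolvent equation.\<close>

lemma p_last_step:
  assumes "v \<in> verts" "w \<in> verts"
  shows "p (Suc n) v w = (\<Sum>z\<in>nb w. p n v z / deg z)"
  using assms(1)
proof (induction n arbitrary: v)
  case 0
  have "(\<Sum>z\<in>nb w. p 0 v z / deg z) = (\<Sum>z\<in>nb w. if v = z then 1 / deg z else 0)"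
    by (intro sum.cong) auto
  moreover have "(\<Sum>y\<in>nb v. of_bool (y = w)) = (\<Sum>y\<in>nb v. if y = w then 1 else (0::real))"
    by (intro sum.cong) auto
  ultimately show ?case using nb_iff [OF 0 assms(2)] by (auto simp: av_def)
next
  case (Suc n)
  have "p (Suc (Suc n)) v w = av (\<lambda>y. \<Sum>z\<in>nb w. p n y z / deg z) v"
    unfolding p.simps(2) [of "Suc n"] using Suc nb_verts by (intro av_cong) auto
  also have "\<dots> = (\<Sum>z\<in>nb w. av (\<lambda>y. (1 / deg z) * p n y z) v)"
    by (subst av_sum) simp
  also have "\<dots> = (\<Sum>z\<in>nb w. p (Suc n) v z / deg z)"
    by (subst av_cmult) simp
  finally show ?case .
qed

lemma p_reversible:
  assumes "v \<in> verts" "w \<in> verts"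
  shows "deg v * p n v w = deg w * p n w v"
  using assms(1)
proof (induction n arbitrary: v)
  case 0
  then show ?case by auto
next
  case (Suc n)
  have "deg v * p (Suc n) v w = (\<Sum>y\<in>nb v. p n y w)"
    by (simp add: av_def)
  also have "\<dots> = (\<Sum>y\<in>nb v. deg w * (p n w y / deg y))"
  proof (intro sum.cong refl)
    fix y assume "y \<in> nb v"
    then have "deg y * p n y w = deg w * p n w y"
      using Suc nb_verts by blast
    then show "p n y w = deg w * (p n w y / deg y)"
      using deg_pos [of y] by (simp add: field_simps del: deg_pos)
  qed
  also have "\<dots> = deg w * p (Suc n) w v"
    using p_last_step [OF assms(2) Suc.prems] by (simp add: sum_distrib_left)
  finally show ?case .
qed

definition par :: "int \<times> nat \<Rightarrow> bool" where
  "par v \<longleftrightarrow> even (fst v + int (snd v))"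

lemma par_nb: "w \<in> nb v \<Longrightarrow> par w \<longleftrightarrow> \<not> par v"
  by (auto simp: par_def nb_def split: prod.splits if_splits)

text \<open>The comb is bipartite with colouring \<open>par\<close>, so for fixed end points the
  times with nonzero transition probability all have the same parity. This is what allows Plancherel
  on half of the circle.\<close>

lemma p_parity: "p n v w \<noteq> 0 \<Longrightarrow> par w = (par v = even n)"
proof (induction n arbitrary: v)
  case 0
  then show ?case by auto
next
  case (Suc n)
  have "\<exists>y\<in>nb v. p n y w \<noteq> 0"
  proof (rule ccontr)
    assume "\<not> ?thesis"
    then have "av (\<lambda>y. p n y w) v = av (\<lambda>_. 0) v" by (intro av_cong) auto
    then show False using Suc.prems by simp
  qed
  then show ?case using Suc.IH par_nb by (metis even_Suc)
qed

end

subsection \<open>Dirichlet energy and the resolvent equation\<close>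

lemma norm_add3_square_le:
  fixes a b c :: "'a::real_normed_vector"
  shows "(norm (a + b + c))\<^sup>2 \<le> 3 * ((norm a)\<^sup>2 + (norm b)\<^sup>2 + (norm c)\<^sup>2)"
proof -
  have "(norm (a + b + c))\<^sup>2 \<le> (norm a + norm b + norm c)\<^sup>2"
    by (intro power_mono norm_triangle_mono norm_triangle_ineq order.refl) auto
  also have "\<dots> \<le> 3 * ((norm a)\<^sup>2 + (norm b)\<^sup>2 + (norm c)\<^sup>2)"
    using sum_squares_ge_zero [of "norm a - norm b" "norm b - norm c"]
      zero_le_power2 [of "norm a - norm c"] by (simp add: power2_eq_square algebra_simps)
  finally show ?thesis .
qed

lemma norm_add2_square_le:
  fixes a b :: "'a::real_normed_vector"
  shows "(norm (a + b))\<^sup>2 \<le> 2 * (norm a)\<^sup>2 + 2 * (norm b)\<^sup>2"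
proof -
  have "(norm (a + b))\<^sup>2 \<le> (norm a + norm b)\<^sup>2"
    by (intro power_mono norm_triangle_ineq) auto
  also have "\<dots> \<le> 2 * (norm a)\<^sup>2 + 2 * (norm b)\<^sup>2"
    using zero_le_power2 [of "norm a - norm b"] by (simp add: power2_eq_square algebra_simps)
  finally show ?thesis .
qed

lemma norm_telescope_square_le:
  fixes g :: "nat \<Rightarrow> 'a::real_normed_vector"
  shows "(norm (g n - g 0))\<^sup>2 \<le> real n * (\<Sum>i<n. (norm (g (Suc i) - g i))\<^sup>2)"
proof -
  have "norm (g n - g 0) \<le> (\<Sum>i<n. norm (g (Suc i) - g i))"
    unfolding sum_lessThan_telescope [symmetric] by (rule norm_sum)
  then have "(norm (g n - g 0))\<^sup>2 \<le> (\<Sum>i<n. norm (g (Suc i) - g i))\<^sup>2"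
    by (intro power_mono) auto
  also have "\<dots> \<le> (\<Sum>i<n. (norm (g (Suc i) - g i))\<^sup>2) * card {..<n}"
    by (rule sum_squared_le_sum_of_squares)
  finally show ?thesis by (simp add: mult.commute)
qed

text \<open>Multiplying the equation by \<open>cnj z\<close> separates the unknowns. The imaginary
  part contains only \<open>s * sin \<theta> * N\<close> and bounds
  \<open>\<bar>sin \<theta>\<bar> * N\<close> by \<beta>. Since \<open>cos \<theta> \<ge> 0\<close>
  gives \<open>1 - cos \<theta> \<le> \<bar>sin \<theta>\<bar>\<close>, the same bound holds for
  \<open>(1 - cos \<theta>) * N\<close>, the error in the real part; what remains there bounds
  \<open>(1 - s) * N\<close> by \<open>2 * \<beta>\<close> and \<open>E\<close> by
  \<open>3 * \<beta>\<close>.\<close>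

lemma resolvent_energy_bound:
  fixes z \<zeta> :: complex
  assumes eq: "(1 - z) * of_real N + z * of_real E = \<zeta>"
    and z: "z = of_real s * cis \<theta>" and s: "1 / 2 \<le> s" "s < 1" and c: "0 \<le> cos \<theta>"
    and N: "0 \<le> N" and E: "0 \<le> E" and lam: "lam \<le> max \<bar>sin \<theta>\<bar> (1 - s)"
    and \<beta>: "norm \<zeta> \<le> \<beta>"
  shows "E + lam * N \<le> 5 * \<beta>"
proof -
  have s0: "s \<noteq> 0" "0 < s" using s by auto
  have cz: "cnj z * z = of_real (s\<^sup>2)"
    unfolding z by (simp add: cis_cnj cis_mult power2_eq_square field_simps)
  then have m: "of_real (s\<^sup>2) * of_real E + (cnj z - of_real (s\<^sup>2)) * of_real N = cnj z * \<zeta>"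
    unfolding eq [symmetric] cz [symmetric] by (simp add: algebra_simps)
  have nz: "norm (cnj z * \<zeta>) \<le> s * \<beta>"
    using \<beta> s0 by (simp add: z norm_mult)
  have re: "s\<^sup>2 * E + (s * cos \<theta> - s\<^sup>2) * N = Re (cnj z * \<zeta>)"
    unfolding m [symmetric] by (simp add: z)
  have im: "- (s * sin \<theta> * N) = Im (cnj z * \<zeta>)"
    unfolding m [symmetric] by (simp add: z)
  have "s * (s * E + (cos \<theta> - s) * N) \<le> s * \<beta>"
    using re abs_Re_le_cmod [of "cnj z * \<zeta>"] nz by (simp add: power2_eq_square algebra_simps)
  then have re': "s * E + (cos \<theta> - s) * N \<le> \<beta>" using s0 by simp
  have "\<bar>s * sin \<theta> * N\<bar> \<le> s * \<beta>"
    using im abs_Im_le_cmod [of "cnj z * \<zeta>"] nz by linarith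
  then have im': "\<bar>sin \<theta>\<bar> * N \<le> \<beta>" using s0 N by (simp add: abs_mult mult.assoc)
  have "(1 - cos \<theta>)\<^sup>2 \<le> (sin \<theta>)\<^sup>2"
  proof -
    have "cos \<theta> * cos \<theta> \<le> cos \<theta> * 1" using c by (intro mult_left_mono) auto
    moreover have "(sin \<theta>)\<^sup>2 = 1 - cos \<theta> * cos \<theta>"
      by (metis power2_eq_square sin_squared_eq)
    moreover have "(1 - cos \<theta>)\<^sup>2 = 1 - 2 * cos \<theta> + cos \<theta> * cos \<theta>"
      by (simp add: power2_eq_square algebra_simps)
    ultimately show ?thesis by linarith
  qed
  then have "1 - cos \<theta> \<le> \<bar>sin \<theta>\<bar>" using abs_le_square_iff [of "1 - cos \<theta>" "sin \<theta>"] by simp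
  then have 1: "(1 - cos \<theta>) * N \<le> \<beta>"
    using mult_right_mono [OF _ N] im' by (meson order.trans)
  have sN: "(1 - s) * N \<ge> 0" using s N by simp
  have "s * E \<ge> 0" using s0 E by simp
  then have 2: "(1 - s) * N \<le> 2 * \<beta>" using re' 1 by (simp add: algebra_simps)
  have "s * E \<le> 2 * \<beta> - (1 - s) * N" using re' 1 by (simp add: algebra_simps)
  then have 3: "s * E \<le> 2 * \<beta>" using sN by linarith
  have "lam * N \<le> max \<bar>sin \<theta>\<bar> (1 - s) * N" using lam N by (intro mult_right_mono) auto
  also have "\<dots> \<le> 2 * \<beta> - (if max \<bar>sin \<theta>\<bar> (1 - s) = 1 - s then 0 else \<beta>)"
    using im' 2 by (auto simp: max_def)
  moreover have "0 \<le> \<beta>" using \<beta> norm_ge_zero order.trans by blast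
  ultimately have 4: "lam * N \<le> 2 * \<beta>" by (auto split: if_splits)
  have E3: "E \<le> 3 * \<beta>"
  proof -
    have "cos \<theta> / s \<ge> cos \<theta>" 
      using mult_right_mono [of s 1 "cos \<theta>"] c s by (simp add: field_simps)
    have "E \<le> \<beta> / s + (1 - cos \<theta> / s) * N"
      using re' s0 by (simp add: field_simps)
    also have "\<dots> \<le> 2 * \<beta> + (1 - cos \<theta>) * N"
    proof (intro add_mono mult_right_mono N)
      have "\<beta> \<ge> 0" using \<beta> norm_ge_zero order.trans by blast
      then show "\<beta> / s \<le> 2 * \<beta>"
        using mult_right_mono [of 1 "2 * s" \<beta>] s s0 by (simp add: field_simps)
    qed (use \<open>cos \<theta> / s \<ge> cos \<theta>\<close> in simp)
    finally show ?thesis using 1 by linarith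
  qed
  show ?thesis using E3 4 by linarith
qed

context comb_walk
begin

definition strip :: "int \<Rightarrow> (int \<times> nat) set" where
  "strip X = Sigma {-X..X} (\<lambda>x. {..h x})"

lemma finite_strip [simp]: "finite (strip X)"
  by (simp add: strip_def)

lemma strip_verts: "v \<in> strip X \<Longrightarrow> v \<in> verts"
  by (auto simp: strip_def verts_def)

lemma sum_nb_eq_sum_strip:
  fixes g :: "int \<times> nat \<Rightarrow> 'a::comm_semiring_1"
  assumes "v \<in> strip X" "\<And>w. w \<in> nb v \<Longrightarrow> w \<notin> strip X \<Longrightarrow> g w = 0"
  shows "(\<Sum>w\<in>nb v. g w) = (\<Sum>w\<in>strip X. of_bool (w \<in> nb v) * g w)"
proof -
  have "(\<Sum>w\<in>strip X. of_bool (w \<in> nb v) * g w) = (\<Sum>w\<in>strip X. if w \<in> nb v then g w else 0)"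
    by (intro sum.cong) auto
  also have "\<dots> = (\<Sum>w\<in>strip X \<inter> nb v. g w)" by (simp add: sum.inter_restrict)
  also have "\<dots> = (\<Sum>w\<in>nb v. g w)" using assms(2) by (intro sum.mono_neutral_left) auto
  finally show ?thesis ..
qed

lemma sum_strip_swap:
  fixes g :: "int \<times> nat \<Rightarrow> int \<times> nat \<Rightarrow> 'a::comm_semiring_1"
  shows "(\<Sum>v\<in>strip X. \<Sum>w\<in>strip X. of_bool (w \<in> nb v) * g v w) =
    (\<Sum>v\<in>strip X. \<Sum>w\<in>strip X. of_bool (w \<in> nb v) * g w v)"
proof (subst sum.swap, intro sum.cong refl)
  fix v w assume "v \<in> strip X" "w \<in> strip X"
  then have "v \<in> nb w \<longleftrightarrow> w \<in> nb v" using nb_iff strip_verts by blast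
  then show "of_bool (v \<in> nb w) * g w v = of_bool (w \<in> nb v) * g w v" by simp
qed

lemma strip_nb_outside:
  assumes "v \<in> strip X" "w \<in> nb v" "w \<notin> strip X"
  shows "\<bar>fst v\<bar> \<ge> X" "\<bar>fst w\<bar> \<ge> X"
  using assms by (auto simp: strip_def nb_def split: prod.splits if_splits)

text \<open>Summation by parts over ordered pairs of adjacent vertices. The function vanishes
  already for \<open>\<bar>fst v\<bar> \<ge> X\<close>, not only outside the strip: an edge that
  leaves the strip then has value 0 at both ends, so no boundary term survives.\<close>

lemma green_identity:
  fixes u :: "int \<times> nat \<Rightarrow> complex"
  assumes supp: "\<And>v. \<bar>fst v\<bar> \<ge> X \<Longrightarrow> u v = 0"
  shows "(\<Sum>v\<in>strip X. cnj (u v) * (\<Sum>w\<in>nb v. u w)) =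
    of_real (\<Sum>v\<in>strip X. deg v * (norm (u v))\<^sup>2) -
    of_real ((\<Sum>v\<in>strip X. \<Sum>w\<in>nb v. (norm (u v - u w))\<^sup>2) / 2)" (is "?A = of_real ?N - of_real (?E / 2)")
proof -
  define a :: "int \<times> nat \<Rightarrow> int \<times> nat \<Rightarrow> complex" where "a v w = of_bool (w \<in> nb v)" for v w
  let ?S = "strip X"
  have A: "?A = (\<Sum>v\<in>?S. \<Sum>w\<in>?S. a v w * (cnj (u v) * u w))"
    unfolding sum_distrib_left a_def
    by (intro sum.cong refl sum_nb_eq_sum_strip) (use supp strip_nb_outside in auto)
  have A': "?A = (\<Sum>v\<in>?S. \<Sum>w\<in>?S. a v w * (cnj (u w) * u v))"
    unfolding A a_def by (rule sum_strip_swap)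
  have N: "of_real ?N = (\<Sum>v\<in>?S. \<Sum>w\<in>?S. a v w * (u v * cnj (u v)))"
  proof -
    have "of_real ?N = (\<Sum>v\<in>?S. \<Sum>w\<in>nb v. u v * cnj (u v))"
      by (simp add: complex_norm_square del: of_real_power)
    also have "\<dots> = (\<Sum>v\<in>?S. \<Sum>w\<in>?S. a v w * (u v * cnj (u v)))"
      unfolding a_def
      by (intro sum.cong refl sum_nb_eq_sum_strip) (use supp strip_nb_outside in auto)
    finally show ?thesis .
  qed
  have N': "of_real ?N = (\<Sum>v\<in>?S. \<Sum>w\<in>?S. a v w * (u w * cnj (u w)))"
    unfolding N a_def by (rule sum_strip_swap)
  have "of_real ?E = (\<Sum>v\<in>?S. \<Sum>w\<in>nb v. (u v - u w) * cnj (u v - u w))"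
    by (simp add: complex_norm_square del: of_real_power)
  also have "\<dots> = (\<Sum>v\<in>?S. \<Sum>w\<in>?S. a v w * ((u v - u w) * cnj (u v - u w)))"
    unfolding a_def
    by (intro sum.cong refl sum_nb_eq_sum_strip) (use supp strip_nb_outside in auto)
  also have "\<dots> = (\<Sum>v\<in>?S. \<Sum>w\<in>?S. a v w * (u v * cnj (u v))) +
      (\<Sum>v\<in>?S. \<Sum>w\<in>?S. a v w * (u w * cnj (u w))) -
      (\<Sum>v\<in>?S. \<Sum>w\<in>?S. a v w * (cnj (u v) * u w)) -
      (\<Sum>v\<in>?S. \<Sum>w\<in>?S. a v w * (cnj (u w) * u v))"
    by (simp add: algebra_simps sum.distrib sum_subtractf)
  also have "\<dots> = of_real ?N + of_real ?N - ?A - ?A"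
    by (simp only: N [symmetric] N' [symmetric] A [symmetric] A' [symmetric])
  finally have f: "of_real ?E = of_real ?N + of_real ?N - ?A - ?A" .
  have "A = N - E / 2" if "E = N + N - A - A" for A N E :: complex
    using that by (simp add: field_simps)
  from this [OF f] show ?thesis by (simp only: of_real_divide of_real_numeral)
qed


section \<open>Dirichlet energy and mass, split into spine and teeth\<close>

definition spine_energy :: "int \<Rightarrow> (int \<times> nat \<Rightarrow> complex) \<Rightarrow> real" where
  "spine_energy X u = (\<Sum>x\<in>{-X..<X}. (norm (u (x + 1, 0) - u (x, 0)))\<^sup>2)"

definition tooth_energy :: "(int \<times> nat \<Rightarrow> complex) \<Rightarrow> int \<Rightarrow> real" where
  "tooth_energy u x = (\<Sum>l<h x. (norm (u (x, Suc l) - u (x, l)))\<^sup>2)"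

definition tooth_mass :: "(int \<times> nat \<Rightarrow> complex) \<Rightarrow> int \<Rightarrow> real" where
  "tooth_mass u x = (\<Sum>l\<le>h x. (norm (u (x, l)))\<^sup>2)"

lemma spine_energy_nonneg: "0 \<le> spine_energy X u"
  by (simp add: spine_energy_def sum_nonneg)

lemma tooth_energy_nonneg [simp]: "0 \<le> tooth_energy u x"
  by (simp add: tooth_energy_def sum_nonneg)

lemma tooth_mass_nonneg [simp]: "0 \<le> tooth_mass u x"
  by (simp add: tooth_mass_def sum_nonneg)

definition dirichlet :: "int \<Rightarrow> real \<Rightarrow> (int \<times> nat \<Rightarrow> complex) \<Rightarrow> real" where
  "dirichlet X lam u = spine_energy X u +
     (\<Sum>x\<in>{-X..X}. tooth_energy u x + lam * tooth_mass u x)"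

lemma sum_strip: "(\<Sum>v\<in>strip X. g v) = (\<Sum>x\<in>{-X..X}. \<Sum>l\<le>h x. g (x, l))"
  unfolding strip_def by (simp add: sum.Sigma)

lemma sum_nb_tooth:
  "(\<Sum>l\<le>h x. \<Sum>w\<in>nb (x, l). (norm (u (x, l) - u w))\<^sup>2) =
     (norm (u (x, 0) - u (x - 1, 0)))\<^sup>2 + (norm (u (x + 1, 0) - u (x, 0)))\<^sup>2 +
     2 * tooth_energy u x"
  for u :: "int \<times> nat \<Rightarrow> complex"
proof -
  define up where "up l = (if l < h x then (norm (u (x, Suc l) - u (x, l)))\<^sup>2 else 0)" for l
  define dn where "dn l = (norm (u (x, l) - u (x, l - 1)))\<^sup>2" for l
  have up: "(\<Sum>l\<le>h x. up l) = tooth_energy u x"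
    unfolding tooth_energy_def up_def
    by (subst lessThan_Suc_atMost [symmetric]) simp
  have dn: "(\<Sum>l<h x. dn (Suc l)) = tooth_energy u x"
    unfolding tooth_energy_def dn_def by simp
  have nb0: "(\<Sum>w\<in>nb (x, 0). (norm (u (x, 0) - u w))\<^sup>2) =
     (norm (u (x, 0) - u (x - 1, 0)))\<^sup>2 + (norm (u (x + 1, 0) - u (x, 0)))\<^sup>2 + up 0"
    by (simp add: nb_def up_def norm_minus_commute)
  have nbS: "(\<Sum>w\<in>nb (x, Suc l). (norm (u (x, Suc l) - u w))\<^sup>2) = dn (Suc l) + up (Suc l)" for l
  proof -
    have "l \<noteq> Suc (Suc l)" by linarith
    then show ?thesis by (simp add: nb_def up_def dn_def norm_minus_commute)
  qed
  have "(\<Sum>l\<le>h x. \<Sum>w\<in>nb (x, l). (norm (u (x, l) - u w))\<^sup>2) =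
     (norm (u (x, 0) - u (x - 1, 0)))\<^sup>2 + (norm (u (x + 1, 0) - u (x, 0)))\<^sup>2 + up 0 +
     (\<Sum>l<h x. dn (Suc l) + up (Suc l))"
    by (subst sum.atMost_shift) (simp only: nb0 nbS)
  also have "\<dots> = (norm (u (x, 0) - u (x - 1, 0)))\<^sup>2 + (norm (u (x + 1, 0) - u (x, 0)))\<^sup>2 +
     (\<Sum>l\<le>h x. up l) + (\<Sum>l<h x. dn (Suc l))"
    by (simp add: sum.distrib sum.atMost_shift [of up])
  finally show ?thesis by (simp add: up dn)
qed

text \<open>A spine edge inside the strip is seen from both of its ends, and so is every tooth edge;
  this accounts for the division by 2.\<close>

lemma energy_ge_dirichlet:
  assumes X: "0 < X"
  shows "spine_energy X u + (\<Sum>x\<in>{-X..X}. tooth_energy u x) \<le>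
    (\<Sum>v\<in>strip X. \<Sum>w\<in>nb v. (norm (u v - u w))\<^sup>2) / 2"
proof -
  let ?d = "\<lambda>x. (norm (u (x + 1, 0) - u (x, 0)))\<^sup>2"
  have 1: "spine_energy X u \<le> (\<Sum>x\<in>{-X..X}. ?d x)"
    unfolding spine_energy_def by (intro sum_mono2) auto
  have "spine_energy X u = (\<Sum>x\<in>{-X+1..X}. (norm (u (x, 0) - u (x - 1, 0)))\<^sup>2)"
    unfolding spine_energy_def
    by (rule sum.reindex_bij_witness [of _ "\<lambda>x. x - 1" "\<lambda>x. x + 1"]) auto
  also have "\<dots> \<le> (\<Sum>x\<in>{-X..X}. (norm (u (x, 0) - u (x - 1, 0)))\<^sup>2)"
    by (intro sum_mono2) auto
  finally have 2: "spine_energy X u \<le> (\<Sum>x\<in>{-X..X}. (norm (u (x, 0) - u (x - 1, 0)))\<^sup>2)" .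
  have "(\<Sum>v\<in>strip X. \<Sum>w\<in>nb v. (norm (u v - u w))\<^sup>2) =
    (\<Sum>x\<in>{-X..X}. (norm (u (x, 0) - u (x - 1, 0)))\<^sup>2) + (\<Sum>x\<in>{-X..X}. ?d x) +
    2 * (\<Sum>x\<in>{-X..X}. tooth_energy u x)"
    unfolding sum_strip sum_nb_tooth by (simp add: sum.distrib sum_distrib_left)
  with 1 2 show ?thesis by simp
qed

lemma mass_ge_tooth_mass:
  "(\<Sum>x\<in>{-X..X}. tooth_mass u x) \<le> (\<Sum>v\<in>strip X. deg v * (norm (u v))\<^sup>2)"
  unfolding sum_strip tooth_mass_def
  by (intro sum_mono) (metis deg_ge_1 mult_right_mono mult_1 zero_le_power2)

lemma spine_increment:
  assumes "-X \<le> r" "r + int n \<le> X"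
  shows "(norm (u (r + int n, 0) - u (r, 0)))\<^sup>2 \<le> real n * spine_energy X u"
proof -
  have "(norm (u (r + int n, 0) - u (r, 0)))\<^sup>2 \<le>
      real n * (\<Sum>i<n. (norm (u (r + int i + 1, 0) - u (r + int i, 0)))\<^sup>2)"
    using norm_telescope_square_le [of "\<lambda>i. u (r + int i, 0)" n] by (simp add: add.assoc add.commute [of 1])
  also have "(\<Sum>i<n. (norm (u (r + int i + 1, 0) - u (r + int i, 0)))\<^sup>2) =
      (\<Sum>x\<in>{r..<r + int n}. (norm (u (x + 1, 0) - u (x, 0)))\<^sup>2)"
    by (rule sum.reindex_bij_witness [of _ "\<lambda>x. nat (x - r)" "\<lambda>i. r + int i"]) auto
  also have "\<dots> \<le> spine_energy X u"
    unfolding spine_energy_def using assms by (intro sum_mono2) auto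
  finally show ?thesis by (simp add: mult_left_mono)
qed

lemma spine_increment_abs:
  assumes "\<bar>r\<bar> \<le> X" "\<bar>x\<bar> \<le> X" "\<bar>x - r\<bar> \<le> int n"
  shows "(norm (u (r, 0) - u (x, 0)))\<^sup>2 \<le> real n * spine_energy X u"
proof -
  define m where "m = nat \<bar>x - r\<bar>"
  have "(norm (u (r, 0) - u (x, 0)))\<^sup>2 \<le> real m * spine_energy X u"
  proof (cases "r \<le> x")
    case True
    then show ?thesis using spine_increment [of X r m u] assms by (simp add: m_def norm_minus_commute)
  next
    case False
    then show ?thesis using spine_increment [of X x m u] assms by (simp add: m_def)
  qed
  also have "\<dots> \<le> real n * spine_energy X u"
    using assms by (intro mult_right_mono spine_energy_nonneg) (simp add: m_def)
  finally show ?thesis .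
qed

lemma tooth_increment:
  assumes "l \<le> h x"
  shows "(norm (u (x, l) - u (x, 0)))\<^sup>2 \<le> real l * tooth_energy u x"
proof -
  have "(norm (u (x, l) - u (x, 0)))\<^sup>2 \<le> real l * (\<Sum>i<l. (norm (u (x, Suc i) - u (x, i)))\<^sup>2)"
    using norm_telescope_square_le [of "\<lambda>i. u (x, i)" l] .
  also have "\<dots> \<le> real l * tooth_energy u x"
    unfolding tooth_energy_def using assms by (intro mult_left_mono sum_mono2) auto
  finally show ?thesis .
qed

lemma dirichlet_nonneg: "0 \<le> lam \<Longrightarrow> 0 \<le> dirichlet X lam u"
  unfolding dirichlet_def by (intro add_nonneg_nonneg sum_nonneg spine_energy_nonneg) auto

text \<open>A Poincare-type estimate. The value at \<open>(r, 0)\<close> is compared with the values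
  on a block of \<open>R\<close> teeth cut at height \<open>k\<close>, and averaged over these
  \<open>R * (k + 1)\<close> vertices. The way along the spine costs at most \<open>2 * R\<close>
  times the spine energy; the climb costs \<open>k\<close> times the tooth energy, spread over
  \<open>R\<close> teeth, which \<open>kR\<close> keeps of order \<open>R\<close>; the average of
  the squares there is paid by the mass, since by \<open>lamR\<close> killing at rate
  \<open>lam\<close> is strong enough at this scale.\<close>

lemma spine_value_bound:
  assumes lam: "0 \<le> lam" and R: "1 \<le> R"
    and k: "\<And>x. int R \<le> \<bar>x\<bar> \<Longrightarrow> k \<le> h x"
    and lamR: "1 \<le> lam * (real R)\<^sup>2 * (real k + 1)" and kR: "real k + 1 \<le> A * (real R)\<^sup>2"
    and r: "\<bar>r\<bar> + 2 * int R \<le> X"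
  shows "(norm (u (r, 0)))\<^sup>2 \<le> 3 * (2 + A) * real R * dirichlet X lam u"
proof -
  \<comment> \<open>The block lies beyond \<open>r\<close> as seen from the origin, and at distance
    at least \<open>R\<close> from the origin even if \<open>r\<close> is close to it. So all its
    teeth reach height \<open>k\<close>.\<close>
  define J where "J = (if 0 \<le> r then {r + int R..<r + 2 * int R} else {r - 2 * int R<..r - int R})"
  define Es Et M where "Es = spine_energy X u" and "Et = (\<Sum>x\<in>{-X..X}. tooth_energy u x)"
    and "M = (\<Sum>x\<in>{-X..X}. tooth_mass u x)"
  have D: "dirichlet X lam u = Es + Et + lam * M"
    by (simp add: dirichlet_def Es_def Et_def M_def sum.distrib sum_distrib_left)
  have nn: "0 \<le> Es" "0 \<le> Et" "0 \<le> M"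
    by (auto simp: Es_def Et_def M_def spine_energy_nonneg sum_nonneg)
  have J: "finite J" "card J = R" "J \<subseteq> {-X..X}"
    using r by (auto simp: J_def)
  have Jx: "k \<le> h x" "\<bar>x - r\<bar> \<le> int (2 * R)" if "x \<in> J" for x
    using that r by (auto simp: J_def split: if_splits intro!: k)
  let ?a = "(norm (u (r, 0)))\<^sup>2"
  have pt: "?a \<le> 3 * (2 * real R * Es + real k * tooth_energy u x + (norm (u (x, l)))\<^sup>2)"
    if x: "x \<in> J" and l: "l \<le> k" for x l
  proof -
    have "u (r, 0) = (u (r, 0) - u (x, 0)) + (u (x, 0) - u (x, l)) + u (x, l)" by simp
    then have "?a \<le> 3 * ((norm (u (r, 0) - u (x, 0)))\<^sup>2 + (norm (u (x, 0) - u (x, l)))\<^sup>2 +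
        (norm (u (x, l)))\<^sup>2)"
      using norm_add3_square_le by metis
    moreover have "(norm (u (r, 0) - u (x, 0)))\<^sup>2 \<le> 2 * real R * Es"
      using spine_increment_abs [of r X x "2 * R" u] Jx [OF x] J(3) x r by (auto simp: Es_def)
    moreover have "(norm (u (x, 0) - u (x, l)))\<^sup>2 \<le> real k * tooth_energy u x"
    proof -
      have "(norm (u (x, 0) - u (x, l)))\<^sup>2 \<le> real l * tooth_energy u x"
        using tooth_increment [of l x u] Jx(1) [OF x] l by (simp add: norm_minus_commute)
      also have "\<dots> \<le> real k * tooth_energy u x" using l by (intro mult_right_mono) auto
      finally show ?thesis .
    qed
    ultimately show ?thesis by argo
  qed
  have "real R * (real k + 1) * ?a = (\<Sum>x\<in>J. \<Sum>l\<le>k. ?a)"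
    using J by (simp add: algebra_simps)
  also have "\<dots> \<le> (\<Sum>x\<in>J. \<Sum>l\<le>k. 3 * (2 * real R * Es + real k * tooth_energy u x + (norm (u (x, l)))\<^sup>2))"
    by (intro sum_mono pt) auto
  also have "\<dots> = 3 * (real R * (real k + 1) * (2 * real R * Es) +
      (real k + 1) * real k * (\<Sum>x\<in>J. tooth_energy u x) + (\<Sum>x\<in>J. \<Sum>l\<le>k. (norm (u (x, l)))\<^sup>2))"
    using J by (simp add: sum.distrib sum_distrib_left [symmetric] algebra_simps)
  also have "\<dots> \<le> 3 * (real R * (real k + 1) * (2 * real R * Es) + (real k + 1) * real k * Et + M)"
  proof -
    have "(\<Sum>x\<in>J. tooth_energy u x) \<le> Et"
      unfolding Et_def using J by (intro sum_mono2) auto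
    then have 1: "(real k + 1) * real k * (\<Sum>x\<in>J. tooth_energy u x) \<le> (real k + 1) * real k * Et"
      by (intro mult_left_mono) auto
    have "(\<Sum>x\<in>J. \<Sum>l\<le>k. (norm (u (x, l)))\<^sup>2) \<le> (\<Sum>x\<in>J. tooth_mass u x)"
      unfolding tooth_mass_def using Jx by (intro sum_mono sum_mono2) auto
    also have "\<dots> \<le> M"
      unfolding M_def using J by (intro sum_mono2) auto
    finally show ?thesis
      by (rule mult_left_mono [OF add_mono [OF add_mono [OF order.refl 1]]]) simp
  qed
  also have "\<dots> \<le> 3 * (real R * (real k + 1) * (2 * real R * Es) +
      (real k + 1) * (A * (real R)\<^sup>2) * Et + lam * (real R)\<^sup>2 * (real k + 1) * M)"
    using kR lamR nn mult_right_mono [OF lamR nn(3)]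
    by (intro mult_left_mono add_mono mult_right_mono mult_left_mono) auto
  also have "\<dots> = real R * (real k + 1) * (3 * real R * (2 * Es + A * Et + lam * M))"
    by (simp add: algebra_simps power2_eq_square)
  finally have "?a \<le> 3 * real R * (2 * Es + A * Et + lam * M)"
    using R by (subst (asm) mult_le_cancel_left_pos) auto
  also have "\<dots> \<le> 3 * real R * ((2 + A) * dirichlet X lam u)"
  proof -
    have "0 < real k + 1" by simp
    with kR R have "0 < A * (real R)\<^sup>2" by linarith
    then have "0 \<le> A" using R by (simp add: zero_less_mult_iff)
    then show ?thesis unfolding D using nn lam
      by (intro mult_left_mono) (auto simp: algebra_simps)
  qed
  finally show ?thesis by (simp add: algebra_simps)
qed

section \<open>Harmonic weights along a tooth\<close>

definition hsum :: "nat \<Rightarrow> real" where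
  "hsum n = (\<Sum>l\<le>n. 1 / (1 + real l))"

lemma hsum_nonneg [simp]: "0 \<le> hsum n"
  by (simp add: hsum_def sum_nonneg)

lemma hsum_ge_1: "1 \<le> hsum n"
proof -
  have "(\<Sum>l\<in>{0::nat}. 1 / (1 + real l)) \<le> hsum n"
    unfolding hsum_def by (intro sum_mono2) auto
  then show ?thesis by simp
qed

text \<open>The squared deviation from the spine value grows at most linearly in the height, which
  the weight cancels. Only the spine value itself meets the harmonic sum.\<close>

lemma weighted_tooth_le_spine:
  assumes "k \<le> h x"
  shows "(\<Sum>l\<le>k. (norm (u (x, l)))\<^sup>2 / (1 + real l)) \<le>
    2 * hsum k * (norm (u (x, 0)))\<^sup>2 + 2 * (real k + 1) * tooth_energy u x"
proof -
  have "(\<Sum>l\<le>k. (norm (u (x, l)))\<^sup>2 / (1 + real l)) \<le>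
      (\<Sum>l\<le>k. 2 * (norm (u (x, 0)))\<^sup>2 * (1 / (1 + real l)) + 2 * tooth_energy u x)"
  proof (rule sum_mono)
    fix l assume "l \<in> {..k}"
    then have l: "l \<le> h x" using assms by simp
    have "u (x, l) = u (x, 0) + (u (x, l) - u (x, 0))" by simp
    then have "(norm (u (x, l)))\<^sup>2 \<le> 2 * (norm (u (x, 0)))\<^sup>2 + 2 * (norm (u (x, l) - u (x, 0)))\<^sup>2"
      using norm_add2_square_le by metis
    also have "\<dots> \<le> 2 * (norm (u (x, 0)))\<^sup>2 + 2 * ((1 + real l) * tooth_energy u x)"
      using tooth_increment [OF l, of u] tooth_energy_nonneg [of u x]
      by (simp add: algebra_simps del: tooth_energy_nonneg)
    finally have "(norm (u (x, l)))\<^sup>2 / (1 + real l) \<le>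
        (2 * (norm (u (x, 0)))\<^sup>2 + 2 * ((1 + real l) * tooth_energy u x)) / (1 + real l)"
      by (intro divide_right_mono) auto
    also have "\<dots> = 2 * (norm (u (x, 0)))\<^sup>2 * (1 / (1 + real l)) + 2 * tooth_energy u x"
      by (simp add: field_simps)
    finally show "(norm (u (x, l)))\<^sup>2 / (1 + real l) \<le>
      2 * (norm (u (x, 0)))\<^sup>2 * (1 / (1 + real l)) + 2 * tooth_energy u x" .
  qed
  also have "\<dots> = 2 * hsum k * (norm (u (x, 0)))\<^sup>2 + 2 * (real k + 1) * tooth_energy u x"
    unfolding hsum_def
    by (simp only: sum.distrib sum_distrib_left [symmetric]) (simp add: algebra_simps)
  finally show ?thesis .
qed

text \<open>The right-hand side can be summed over all columns of the strip, unlike a pointwise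
  bound on the spine value. That value is replaced by a mean over the lowest \<open>k + 1\<close>
  vertices, paid by mass and energy; above height \<open>k\<close> the weight is at most
  \<open>1 / (k + 1)\<close> and the mass alone suffices. Thus \<open>hsum k\<close> appears for a
  common \<open>k\<close>, not \<open>hsum (h x)\<close>.\<close>

lemma weighted_tooth_le_mass:
  assumes "k \<le> h x"
  shows "(\<Sum>l\<le>h x. (norm (u (x, l)))\<^sup>2 / (1 + real l)) \<le>
    7 * hsum k * (tooth_mass u x / (real k + 1) + (real k + 1) * tooth_energy u x)"
proof -
  let ?a = "(norm (u (x, 0)))\<^sup>2" and ?E = "tooth_energy u x" and ?M = "tooth_mass u x"
  have "(real k + 1) * ?a = (\<Sum>l\<le>k. ?a)" by simp
  also have "\<dots> \<le> (\<Sum>l\<le>k. 2 * (norm (u (x, l)))\<^sup>2 + 2 * ((real k + 1) * ?E))"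
  proof (rule sum_mono)
    fix l assume "l \<in> {..k}"
    then have l: "l \<le> h x" "l \<le> k" using assms by auto
    have "u (x, 0) = u (x, l) + (u (x, 0) - u (x, l))" by simp
    then have "?a \<le> 2 * (norm (u (x, l)))\<^sup>2 + 2 * (norm (u (x, 0) - u (x, l)))\<^sup>2"
      using norm_add2_square_le by metis
    moreover have "(norm (u (x, 0) - u (x, l)))\<^sup>2 \<le> (real k + 1) * ?E"
      using tooth_increment [OF l(1), of u] mult_right_mono [of "real l" "real k + 1" ?E] l
      by (simp add: norm_minus_commute)
    ultimately show "?a \<le> 2 * (norm (u (x, l)))\<^sup>2 + 2 * ((real k + 1) * ?E)" by linarith
  qed
  also have "\<dots> = 2 * (\<Sum>l\<le>k. (norm (u (x, l)))\<^sup>2) + (real k + 1) * (2 * (real k + 1) * ?E)"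
    by (simp add: sum.distrib sum_distrib_left)
  also have "\<dots> \<le> 2 * ?M + (real k + 1) * (2 * (real k + 1) * ?E)"
    unfolding tooth_mass_def using assms by (intro add_mono mult_left_mono sum_mono2) auto
  finally have a: "?a \<le> 2 * (?M / (real k + 1)) + 2 * (real k + 1) * ?E"
    by (simp add: field_simps)
  have "(\<Sum>l\<le>h x. (norm (u (x, l)))\<^sup>2 / (1 + real l)) =
      (\<Sum>l\<le>k. (norm (u (x, l)))\<^sup>2 / (1 + real l)) + (\<Sum>l\<in>{k<..h x}. (norm (u (x, l)))\<^sup>2 / (1 + real l))"
    using assms by (subst sum.union_disjoint [symmetric]) (auto intro: sum.cong)
  also have "(\<Sum>l\<in>{k<..h x}. (norm (u (x, l)))\<^sup>2 / (1 + real l)) \<le>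
      (\<Sum>l\<in>{k<..h x}. (norm (u (x, l)))\<^sup>2 / (real k + 1))"
    by (intro sum_mono divide_left_mono) auto
  also have "\<dots> \<le> ?M / (real k + 1)"
    unfolding sum_divide_distrib [symmetric] tooth_mass_def
    by (intro divide_right_mono sum_mono2) auto
  also have "(\<Sum>l\<le>k. (norm (u (x, l)))\<^sup>2 / (1 + real l)) \<le> 2 * hsum k * ?a + 2 * (real k + 1) * ?E"
    by (rule weighted_tooth_le_spine [OF assms])
  also have "2 * hsum k * ?a \<le> 2 * hsum k * (2 * (?M / (real k + 1)) + 2 * (real k + 1) * ?E)"
    using a by (intro mult_left_mono) auto
  finally have "(\<Sum>l\<le>h x. (norm (u (x, l)))\<^sup>2 / (1 + real l)) \<le>
      2 * hsum k * (2 * (?M / (real k + 1)) + 2 * (real k + 1) * ?E) + 2 * ((real k + 1) * ?E) +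
      ?M / (real k + 1)" by (simp only: mult.assoc)
  also have "\<dots> \<le> 2 * hsum k * (2 * (?M / (real k + 1)) + 2 * (real k + 1) * ?E) +
      2 * (hsum k * ((real k + 1) * ?E)) + hsum k * (?M / (real k + 1))"
  proof -
    have m: "a \<le> hsum k * a" if "0 \<le> a" for a
      using mult_right_mono [OF hsum_ge_1 [of k] that] by simp
    have "(real k + 1) * ?E \<le> hsum k * ((real k + 1) * ?E)"
      and "?M / (real k + 1) \<le> hsum k * (?M / (real k + 1))"
      by (intro m; simp)+
    then show ?thesis by linarith
  qed
  also have "\<dots> = hsum k * (5 * (?M / (real k + 1)) + 6 * ((real k + 1) * ?E))"
    by (simp add: algebra_simps)
  also have "\<dots> \<le> hsum k * (7 * (?M / (real k + 1)) + 7 * ((real k + 1) * ?E))"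
    by (intro mult_left_mono add_mono mult_right_mono) auto
  finally show ?thesis by (simp add: algebra_simps)
qed

subsection \<open>Generating functions of transition probabilities\<close>

text \<open>Truncation at \<open>M\<close> keeps the support finite, so summation by parts raises no
  convergence question. Division by the degree turns the equation of the walk into one for the plain
  adjacency sum over neighbours.\<close>

definition gf :: "nat \<Rightarrow> complex \<Rightarrow> int \<times> nat \<Rightarrow> int \<times> nat \<Rightarrow> complex" where
  "gf M z a v = (\<Sum>n<M. z ^ n * of_real (p n a v)) / of_real (deg v)"

lemma gf_equation:
  assumes "a \<in> verts" "v \<in> verts"
  shows "of_real (deg v) * gf M z a v =
    of_bool (a = v) + z * (\<Sum>w\<in>nb v. gf M z a w) - z ^ M * of_real (p M a v)"
proof -
  have "z * (\<Sum>w\<in>nb v. gf M z a w) = z * (\<Sum>n<M. \<Sum>w\<in>nb v. z ^ n * of_real (p n a w) / of_real (deg w))"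
    unfolding gf_def sum_divide_distrib by (subst sum.swap) simp
  also have "\<dots> = (\<Sum>n<M. z ^ Suc n * of_real (p (Suc n) a v))"
    unfolding p_last_step [OF assms] by (simp add: sum_distrib_left mult.assoc)
  also have "of_bool (a = v) + \<dots> = (\<Sum>n<Suc M. z ^ n * of_real (p n a v))"
    by (subst sum.lessThan_Suc_shift) simp
  also have "\<dots> = of_real (deg v) * gf M z a v + z ^ M * of_real (p M a v)"
    using deg_pos [of v] by (simp add: gf_def del: deg_pos)
  finally show ?thesis by simp
qed

lemma p_eq_0_outside:
  assumes "a \<in> verts" "\<bar>fst a\<bar> + int n < \<bar>fst v\<bar>"
  shows "p n a v = 0"
proof (rule ccontr)
  assume "p n a v \<noteq> 0"
  then have "v \<in> box a n" using p_support assms by blast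
  then show False using assms by (auto simp: box_def)
qed

lemma gf_eq_0_outside:
  assumes "a \<in> verts" "\<bar>fst a\<bar> + int M \<le> \<bar>fst v\<bar>"
  shows "gf M z a v = 0"
  unfolding gf_def using assms by (subst sum.neutral) (auto simp: p_eq_0_outside)

lemma box_subset_strip: "\<bar>fst a\<bar> + int n \<le> X \<Longrightarrow> box a n \<subseteq> strip X"
  by (auto simp: box_def strip_def)

lemma sum_power_le: "0 \<le> s \<Longrightarrow> s < 1 \<Longrightarrow> (\<Sum>n<M. s ^ n) \<le> 1 / (1 - s)" for s :: real
  by (subst sum_gp_strict) (auto simp: divide_simps)

lemma norm_gf_le:
  assumes "norm z = s" "s < 1"
  shows "norm (gf M z a v) \<le> 1 / (1 - s)"
proof -
  have s: "0 \<le> s" using assms norm_ge_zero [of z] by auto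
  have "norm (gf M z a v) \<le> norm (\<Sum>n<M. z ^ n * of_real (p n a v)) / 1"
    unfolding gf_def norm_divide norm_of_real
    using deg_ge_1 [of v] by (intro divide_left_mono) auto
  also have "\<dots> \<le> (\<Sum>n<M. norm (z ^ n * of_real (p n a v)))"
    by (simp add: norm_sum)
  also have "\<dots> \<le> (\<Sum>n<M. s ^ n)"
    using assms s by (intro sum_mono) (simp add: norm_mult norm_power p_le_1 mult_left_le)
  also have "\<dots> \<le> 1 / (1 - s)" using s assms by (rule_tac sum_power_le) auto
  finally show ?thesis .
qed

text \<open>Pairing \<open>gf_equation\<close> with the conjugate of \<open>gf\<close> and applying
  \<open>green_identity\<close> gives the premise of \<open>resolvent_energy_bound\<close>, with the
  value at \<open>a\<close> on the right up to a truncation error. That error is at most 1: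
  \<open>gf\<close> is bounded by \<open>1 / (1 - s)\<close>, the \<open>M\<close>-step distribution
  has total mass 1, and \<open>s ^ M \<le> 1 - s\<close>.\<close>

lemma dirichlet_gf_le:
  assumes a: "a \<in> verts" and z: "z = of_real s * cis \<theta>" and s: "1 / 2 \<le> s" "s < 1"
    and c: "0 \<le> cos \<theta>" and lam: "lam \<le> max \<bar>sin \<theta>\<bar> (1 - s)" "0 \<le> lam"
    and M: "s ^ M \<le> 1 - s" and X: "\<bar>fst a\<bar> + int M < X"
  shows "dirichlet X lam (gf M z a) \<le> 5 * (norm (gf M z a a) + 1)"
proof -
  define u where "u = gf M z a"
  define N where "N = (\<Sum>v\<in>strip X. deg v * (norm (u v))\<^sup>2)"
  define E where "E = (\<Sum>v\<in>strip X. \<Sum>w\<in>nb v. (norm (u v - u w))\<^sup>2) / 2"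
  define e where "e = (\<Sum>v\<in>strip X. of_real (p M a v) * cnj (u v))"
  have X0: "0 < X" using X by linarith
  have nz: "norm z = s" using s by (simp add: z norm_mult)
  have aS: "a \<in> strip X" using a X by (auto simp: strip_def verts_def)
  have "of_real N = (\<Sum>v\<in>strip X. cnj (u v) * (of_real (deg v) * u v))"
    unfolding N_def of_real_sum of_real_mult complex_norm_square by (simp add: mult_ac)
  also have "\<dots> = (\<Sum>v\<in>strip X. cnj (u v) * (of_bool (a = v) + z * (\<Sum>w\<in>nb v. u w) - z ^ M * of_real (p M a v)))"
    unfolding u_def by (intro sum.cong refl arg_cong2 [of _ _ _ _ "(*)"] gf_equation a)
      (auto simp: strip_verts)
  also have "\<dots> = (\<Sum>v\<in>strip X. cnj (u v) * of_bool (a = v) +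
      z * (cnj (u v) * (\<Sum>w\<in>nb v. u w)) - z ^ M * (of_real (p M a v) * cnj (u v)))"
    by (intro sum.cong refl) (simp only: ring_distribs mult_ac)
  also have "\<dots> = (\<Sum>v\<in>strip X. cnj (u v) * of_bool (a = v)) +
      z * (\<Sum>v\<in>strip X. cnj (u v) * (\<Sum>w\<in>nb v. u w)) - z ^ M * e"
    unfolding e_def by (simp only: sum.distrib sum_subtractf sum_distrib_left [symmetric])
  also have "(\<Sum>v\<in>strip X. cnj (u v) * of_bool (a = v)) = cnj (u a)"
  proof -
    have "(\<Sum>v\<in>strip X. cnj (u v) * of_bool (a = v)) = (\<Sum>v\<in>strip X. if a = v then cnj (u v) else 0)"
      by (intro sum.cong) auto
    then show ?thesis using aS by simp
  qed
  also have "(\<Sum>v\<in>strip X. cnj (u v) * (\<Sum>w\<in>nb v. u w)) = of_real N - of_real E"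
    unfolding N_def E_def using X by (intro green_identity) (auto simp: u_def a gf_eq_0_outside)
  finally have eq: "(1 - z) * of_real N + z * of_real E = cnj (u a) - z ^ M * e"
    by (simp add: algebra_simps)
  have "norm e \<le> (\<Sum>v\<in>strip X. p M a v * (1 / (1 - s)))"
    unfolding e_def
  proof (intro order.trans [OF norm_sum] sum_mono)
    fix v
    have "p M a v * norm (gf M z a v) \<le> p M a v * (1 / (1 - s))"
      by (intro mult_left_mono norm_gf_le [OF nz s(2)]) simp
    then show "norm (of_real (p M a v) * cnj (u v)) \<le> p M a v * (1 / (1 - s))"
      by (simp add: norm_mult u_def)
  qed
  also have "\<dots> = 1 / (1 - s)"
    unfolding sum_distrib_right [symmetric]
    using sum_p_eq_1 [OF finite_strip box_subset_strip a, of M X] X by simp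
  finally have "norm (z ^ M * e) \<le> (1 - s) * (1 / (1 - s))"
    unfolding norm_mult norm_power nz using M s by (intro mult_mono) auto
  then have "norm (z ^ M * e) \<le> 1" using s by simp
  then have "norm (cnj (u a) - z ^ M * e) \<le> norm (u a) + 1"
    using norm_triangle_ineq4 [of "cnj (u a)" "z ^ M * e"] by simp
  then have "E + lam * N \<le> 5 * (norm (u a) + 1)"
    using eq z s c lam by (intro resolvent_energy_bound)
      (auto simp: N_def E_def intro!: sum_nonneg)
  moreover have "dirichlet X lam u \<le> E + lam * N"
  proof -
    have "lam * (\<Sum>x\<in>{-X..X}. tooth_mass u x) \<le> lam * N"
      unfolding N_def by (intro mult_left_mono mass_ge_tooth_mass lam)
    then show ?thesis
      using energy_ge_dirichlet [of X u] X0
      by (simp add: dirichlet_def sum.distrib E_def sum_distrib_left [symmetric])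
  qed
  ultimately show ?thesis by (simp add: u_def)
qed

text \<open>A self-bounding argument. If \<open>b\<close> is the modulus at the starting point, the
  energy is at most \<open>5 * (b + 1)\<close>, while \<open>spine_value_bound\<close> gives
  \<open>b\<^sup>2\<close> of order \<open>R\<close> times the energy. Hence \<open>b\<close>, and
  then the energy, is of order \<open>R\<close>; the constant is
  \<open>155 = 5 * (30 + 1)\<close>.\<close>

lemma gf_spine_energy_le:
  assumes a: "a = (\<alpha>, 0)" and z: "z = of_real s * cis \<theta>" and s: "1 / 2 \<le> s" "s < 1"
    and c: "0 \<le> cos \<theta>" and lam: "lam \<le> max \<bar>sin \<theta>\<bar> (1 - s)" "0 \<le> lam"
    and M: "s ^ M \<le> 1 - s" and X: "\<bar>\<alpha>\<bar> + int M + 2 * int R < X" and R: "1 \<le> R"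
    and k: "\<And>x. int R \<le> \<bar>x\<bar> \<Longrightarrow> k \<le> h x"
    and lamR: "1 \<le> lam * (real R)\<^sup>2 * (real k + 1)" and kR: "real k + 1 \<le> A * (real R)\<^sup>2"
  shows "dirichlet X lam (gf M z a) \<le> 155 * (2 + A) * real R"
proof -
  let ?D = "dirichlet X lam (gf M z a)" and ?b = "norm (gf M z a a)"
  have av: "a \<in> verts" by (simp add: a verts_def)
  have "0 < A * (real R)\<^sup>2" using kR by linarith
  then have A: "0 < A" by (simp add: zero_less_mult_iff)
  have D: "?D \<le> 5 * (?b + 1)"
    using X by (intro dirichlet_gf_le [OF av z s c lam M]) (auto simp: a)
  have "?b\<^sup>2 \<le> 3 * (2 + A) * real R * ?D"
    using spine_value_bound [OF lam(2) R k lamR kR, of \<alpha> X "gf M z a"] X by (simp add: a)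
  also have "\<dots> \<le> 3 * (2 + A) * real R * (5 * (?b + 1))"
    using D A by (intro mult_left_mono) auto
  finally have b2: "?b * ?b \<le> 15 * (2 + A) * real R * (?b + 1)" by (simp add: power2_eq_square algebra_simps)
  have big: "1 \<le> 30 * (2 + A) * real R"
    using mult_mono [of 1 "30 * (2 + A)" 1 "real R"] A R by simp
  have b: "?b \<le> 30 * (2 + A) * real R"
  proof (cases "1 \<le> ?b")
    case True
    note b2
    also have "15 * (2 + A) * real R * (?b + 1) \<le> 15 * (2 + A) * real R * (2 * ?b)"
      using True A by (intro mult_left_mono) auto
    finally have "?b * ?b \<le> (30 * (2 + A) * real R) * ?b" by (simp add: algebra_simps)
    then show ?thesis using True by (subst (asm) mult_le_cancel_right_pos) auto
  next
    case False
    then show ?thesis using big by linarith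
  qed
  have "?D \<le> 5 * (30 * (2 + A) * real R + (2 + A) * real R)"
    using D b mult_mono [of 1 "2 + A" 1 "real R"] A R by simp
  then show ?thesis by (simp add: algebra_simps)
qed

text \<open>Columns with \<open>\<bar>x\<bar> < R\<close> are handled through the spine value, which
  is uniformly bounded there, the others through mass and energy. \<open>L\<close> is the size of
  \<epsilon> times the harmonic sum at this scale, pointwise for far columns and on average for near
  ones. The far part contributes \<open>7 + 7 * A\<close> and the near part
  \<open>12 + 8 * A\<close>.\<close>

lemma weighted_sum_le_dirichlet:
  fixes \<epsilon> :: "int \<Rightarrow> real"
  assumes lam: "0 \<le> lam" and R: "1 \<le> R"
    and k: "\<And>x. int R \<le> \<bar>x\<bar> \<Longrightarrow> k \<le> h x"
    and lamR: "1 \<le> lam * (real R)\<^sup>2 * (real k + 1)" and kR: "real k + 1 \<le> A * (real R)\<^sup>2"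
    and X: "3 * int R \<le> X" and \<epsilon>: "\<And>x. 0 \<le> \<epsilon> x" and L: "0 \<le> L"
    and far: "\<And>x. int R \<le> \<bar>x\<bar> \<Longrightarrow> \<epsilon> x * hsum k \<le> L"
    and near: "(\<Sum>x | \<bar>x\<bar> < int R. \<epsilon> x * hsum (h x)) \<le> L * real R"
    and near': "\<And>x. \<bar>x\<bar> < int R \<Longrightarrow> \<epsilon> x * (real (h x) + 1) \<le> A * L * (real R)\<^sup>2"
  shows "(\<Sum>x\<in>{-X..X}. \<epsilon> x * (\<Sum>l\<le>h x. (norm (u (x, l)))\<^sup>2 / (1 + real l))) \<le>
    (19 + 15 * A) * L * (real R)\<^sup>2 * dirichlet X lam u"
proof -
  let ?D = "dirichlet X lam u"
  define T where "T x = \<epsilon> x * (\<Sum>l\<le>h x. (norm (u (x, l)))\<^sup>2 / (1 + real l))" for x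
  define F where "F x = tooth_energy u x + lam * tooth_mass u x" for x
  define G where "G = {x. \<bar>x\<bar> < int R}"
  have "0 < A * (real R)\<^sup>2" using kR by linarith
  then have A: "0 < A" by (simp add: zero_less_mult_iff)
  have D0: "0 \<le> ?D" by (rule dirichlet_nonneg [OF lam])
  have F0: "0 \<le> F x" for x by (simp add: F_def lam)
  have FD: "(\<Sum>x\<in>{-X..X}. F x) \<le> ?D"
    unfolding dirichlet_def F_def using spine_energy_nonneg by simp
  have "G = {-int R<..<int R}" by (auto simp: G_def)
  then have Gf: "finite G" "G \<subseteq> {-X..X}" using X by auto
  have far_T: "T x \<le> 7 * L * (1 + A) * (real R)\<^sup>2 * F x" if "int R \<le> \<bar>x\<bar>" for x
  proof -
    let ?b = "tooth_mass u x / (real k + 1) + (real k + 1) * tooth_energy u x"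
    have "T x \<le> \<epsilon> x * (7 * hsum k * ?b)"
      unfolding T_def by (intro mult_left_mono weighted_tooth_le_mass k that \<epsilon>)
    also have "\<dots> = 7 * (\<epsilon> x * hsum k) * ?b" by simp
    also have "\<dots> \<le> 7 * L * ?b" using far [OF that] by (intro mult_right_mono mult_left_mono) auto
    also have "\<dots> \<le> 7 * L * ((1 + A) * (real R)\<^sup>2 * F x)"
    proof (intro mult_left_mono)
      have "1 * tooth_mass u x \<le> lam * (real R)\<^sup>2 * (real k + 1) * tooth_mass u x"
        using lamR by (intro mult_right_mono) auto
      then have "tooth_mass u x / (real k + 1) \<le> (real R)\<^sup>2 * (lam * tooth_mass u x)"
        by (simp add: field_simps)
      also have "\<dots> \<le> (1 + A) * (real R)\<^sup>2 * (lam * tooth_mass u x)"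
        using A lam mult_right_mono [of 1 "1 + A" "(real R)\<^sup>2 * (lam * tooth_mass u x)"] by (simp add: mult.assoc)
      finally have 1: "tooth_mass u x / (real k + 1) \<le> (1 + A) * (real R)\<^sup>2 * (lam * tooth_mass u x)" .
      have "real k + 1 \<le> (1 + A) * (real R)\<^sup>2"
        using kR A by (simp add: distrib_right add_increasing)
      then have "(real k + 1) * tooth_energy u x \<le> (1 + A) * (real R)\<^sup>2 * tooth_energy u x"
        by (intro mult_right_mono) auto
      with 1 show "?b \<le> (1 + A) * (real R)\<^sup>2 * F x" by (simp add: F_def distrib_left)
    qed (use L in simp)
    finally show ?thesis by (simp add: algebra_simps)
  qed
  have near_T: "T x \<le> \<epsilon> x * hsum (h x) * (6 * (2 + A) * real R * ?D) + 2 * A * L * (real R)\<^sup>2 * F x"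
    if "x \<in> G" for x
  proof -
    have x: "\<bar>x\<bar> < int R" using that by (simp add: G_def)
    have "T x \<le> \<epsilon> x * (2 * hsum (h x) * (norm (u (x, 0)))\<^sup>2 + 2 * (real (h x) + 1) * tooth_energy u x)"
      unfolding T_def by (intro mult_left_mono weighted_tooth_le_spine \<epsilon>) simp
    also have "\<dots> \<le> \<epsilon> x * (2 * hsum (h x) * (3 * (2 + A) * real R * ?D) + 2 * (real (h x) + 1) * F x)"
      using spine_value_bound [OF lam R k lamR kR, of x X u] X x lam
      by (intro mult_left_mono add_mono \<epsilon>) (auto simp: F_def)
    also have "\<dots> = \<epsilon> x * hsum (h x) * (6 * (2 + A) * real R * ?D) + 2 * (\<epsilon> x * (real (h x) + 1)) * F x"
      by (simp add: algebra_simps)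
    also have "\<dots> \<le> \<epsilon> x * hsum (h x) * (6 * (2 + A) * real R * ?D) + 2 * (A * L * (real R)\<^sup>2) * F x"
      using near' [OF x] F0 by (intro add_left_mono mult_right_mono mult_left_mono) auto
    finally show ?thesis by (simp add: mult.assoc)
  qed
  have c0: "0 \<le> 7 * L * (1 + A) * (real R)\<^sup>2" "0 \<le> 2 * A * L * (real R)\<^sup>2"
    using L A by auto
  have "(\<Sum>x\<in>{-X..X}. T x) = (\<Sum>x\<in>{-X..X} - G. T x) + (\<Sum>x\<in>G. T x)"
    by (intro sum.subset_diff Gf) auto
  also have "(\<Sum>x\<in>{-X..X} - G. T x) \<le> (\<Sum>x\<in>{-X..X} - G. 7 * L * (1 + A) * (real R)\<^sup>2 * F x)"
    by (intro sum_mono far_T) (auto simp: G_def)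
  also have "\<dots> \<le> (\<Sum>x\<in>{-X..X}. 7 * L * (1 + A) * (real R)\<^sup>2 * F x)"
    by (intro sum_mono2 mult_nonneg_nonneg F0 c0) auto
  also have "\<dots> \<le> 7 * L * (1 + A) * (real R)\<^sup>2 * ?D"
    unfolding sum_distrib_left [symmetric] by (intro mult_left_mono FD c0)
  also have "(\<Sum>x\<in>G. T x) \<le> (\<Sum>x\<in>G. \<epsilon> x * hsum (h x) * (6 * (2 + A) * real R * ?D) + 2 * A * L * (real R)\<^sup>2 * F x)"
    by (intro sum_mono near_T)
  also have "\<dots> = (\<Sum>x\<in>G. \<epsilon> x * hsum (h x)) * (6 * (2 + A) * real R * ?D) + 2 * A * L * (real R)\<^sup>2 * (\<Sum>x\<in>G. F x)"
    by (simp only: sum.distrib sum_distrib_right [symmetric] sum_distrib_left [symmetric])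
  also have "\<dots> \<le> L * real R * (6 * (2 + A) * real R * ?D) + 2 * A * L * (real R)\<^sup>2 * ?D"
  proof (intro add_mono mult_right_mono mult_left_mono c0)
    show "(\<Sum>x\<in>G. \<epsilon> x * hsum (h x)) \<le> L * real R" using near by (simp add: G_def)
    show "0 \<le> 6 * (2 + A) * real R * ?D" using A D0 by simp
    have "(\<Sum>x\<in>G. F x) \<le> (\<Sum>x\<in>{-X..X}. F x)" by (intro sum_mono2 Gf F0) auto
    with FD show "(\<Sum>x\<in>G. F x) \<le> ?D" by linarith
  qed
  finally show ?thesis
    unfolding T_def by (simp add: algebra_simps power2_eq_square)
qed

lemma gf_weighted_sum_le:
  fixes \<epsilon> :: "int \<Rightarrow> real"
  assumes a: "a = (\<alpha>, 0)" and z: "z = of_real s * cis \<theta>" and s: "1 / 2 \<le> s" "s < 1"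
    and c: "0 \<le> cos \<theta>" and lam: "lam \<le> max \<bar>sin \<theta>\<bar> (1 - s)" "0 \<le> lam"
    and M: "s ^ M \<le> 1 - s" and X: "\<bar>\<alpha>\<bar> + int M + 3 * int R < X" and R: "1 \<le> R"
    and k: "\<And>x. int R \<le> \<bar>x\<bar> \<Longrightarrow> k \<le> h x"
    and lamR: "1 \<le> lam * (real R)\<^sup>2 * (real k + 1)" and kR: "real k + 1 \<le> A * (real R)\<^sup>2"
    and \<epsilon>: "\<And>x. 0 \<le> \<epsilon> x" and L: "0 \<le> L"
    and far: "\<And>x. int R \<le> \<bar>x\<bar> \<Longrightarrow> \<epsilon> x * hsum k \<le> L"
    and near: "(\<Sum>x | \<bar>x\<bar> < int R. \<epsilon> x * hsum (h x)) \<le> L * real R"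
    and near': "\<And>x. \<bar>x\<bar> < int R \<Longrightarrow> \<epsilon> x * (real (h x) + 1) \<le> A * L * (real R)\<^sup>2"
  shows "(\<Sum>(x, l)\<in>strip X. \<epsilon> x / (1 + real l) * (norm (gf M z a (x, l)))\<^sup>2) \<le>
    155 * (2 + A) * (19 + 15 * A) * L * (real R) ^ 3"
proof -
  have "0 < A * (real R)\<^sup>2" using kR by linarith
  then have A: "0 < A" by (simp add: zero_less_mult_iff)
  have "(\<Sum>(x, l)\<in>strip X. \<epsilon> x / (1 + real l) * (norm (gf M z a (x, l)))\<^sup>2) =
      (\<Sum>x\<in>{-X..X}. \<epsilon> x * (\<Sum>l\<le>h x. (norm (gf M z a (x, l)))\<^sup>2 / (1 + real l)))"
    unfolding sum_strip sum_distrib_left by simp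
  also have "\<dots> \<le> (19 + 15 * A) * L * (real R)\<^sup>2 * dirichlet X lam (gf M z a)"
    using X by (intro weighted_sum_le_dirichlet [OF lam(2) R k lamR kR _ \<epsilon> L far near near']) auto
  also have "\<dots> \<le> (19 + 15 * A) * L * (real R)\<^sup>2 * (155 * (2 + A) * real R)"
    using X A L by (intro mult_left_mono gf_spine_energy_le [OF a z s c lam M _ R k lamR kR]) auto
  finally show ?thesis by (simp add: algebra_simps power2_eq_square power3_eq_cube)
qed

end

subsection \<open>Collisions of walks started on the spine\<close>

lemma has_integral_cos_even:
  fixes d :: int
  assumes "even d"
  shows "((\<lambda>\<theta>. cos (of_int d * \<theta>)) has_integral (if d = 0 then pi else 0)) {- (pi / 2)..pi / 2}"
proof (cases "d = 0")
  case True
  then show ?thesis using has_integral_const_real [of "1::real" "- (pi / 2)" "pi / 2"] by simp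
next
  case False
  have "((\<lambda>\<theta>. cos (of_int d * \<theta>)) has_integral
      (sin (of_int d * (pi / 2)) / of_int d - sin (of_int d * (- (pi / 2))) / of_int d)) {- (pi / 2)..pi / 2}"
    using False
    by (intro fundamental_theorem_of_calculus)
      (auto intro!: derivative_eq_intros simp: has_real_derivative_iff_has_vector_derivative [symmetric])
  moreover from assms obtain j where "d = 2 * j" by blast
  then have "sin (of_int d * (pi / 2)) = 0" by (auto simp: sin_zero_iff_int2)
  ultimately show ?thesis using False by simp
qed

text \<open>Since the coefficients live on indices of one parity, the squared modulus contains only
  even frequencies, and these are orthogonal already on an interval of length \<open>pi\<close>. On
  this interval \<open>cos \<theta>\<close> is nonnegative.\<close>

lemma parseval_half_period:
  fixes c :: "nat \<Rightarrow> real"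
  assumes "\<And>n. c n \<noteq> 0 \<Longrightarrow> even n = e"
  shows "((\<lambda>\<theta>. (norm (\<Sum>n<M. cis \<theta> ^ n * of_real (c n)))\<^sup>2) has_integral pi * (\<Sum>n<M. (c n)\<^sup>2))
    {- (pi / 2)..pi / 2}"
proof -
  have eq: "(norm (\<Sum>n<M. cis \<theta> ^ n * of_real (c n)))\<^sup>2 =
      (\<Sum>n<M. \<Sum>m<M. c n * c m * cos (of_int (int n - int m) * \<theta>))" for \<theta>
  proof -
    let ?S = "\<Sum>n<M. cis \<theta> ^ n * of_real (c n)"
    have "(norm ?S)\<^sup>2 = Re (?S * cnj ?S)"
      by (metis complex_norm_square Re_complex_of_real)
    also have "?S * cnj ?S = (\<Sum>n<M. \<Sum>m<M. of_real (c n * c m) * cis (of_int (int n - int m) * \<theta>))"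
      by (simp add: sum_product Complex.DeMoivre cis_cnj cis_mult algebra_simps)
    finally show ?thesis by simp
  qed
  have "((\<lambda>\<theta>. \<Sum>n<M. \<Sum>m<M. c n * c m * cos (of_int (int n - int m) * \<theta>)) has_integral
      (\<Sum>n<M. \<Sum>m<M. if n = m then pi * (c n)\<^sup>2 else 0)) {- (pi / 2)..pi / 2}"
  proof (intro has_integral_sum finite_lessThan)
    fix n m
    show "((\<lambda>\<theta>. c n * c m * cos (of_int (int n - int m) * \<theta>)) has_integral
      (if n = m then pi * (c n)\<^sup>2 else 0)) {- (pi / 2)..pi / 2}"
    proof (cases "c n * c m = 0")
      case True
      then show ?thesis by auto
    next
      case False
      then have "even n = e" "even m = e" using assms by auto
      then have "even (int n - int m)" by auto
      from has_integral_mult_right [OF has_integral_cos_even [OF this], of "c n * c m"]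
      show ?thesis by (auto simp: power2_eq_square mult_ac)
    qed
  qed
  then show ?thesis unfolding eq by (simp add: sum_distrib_left)
qed

lemma step_has_integral:
  fixes c \<tau> P :: real
  assumes "0 \<le> c" "0 \<le> \<tau>" "0 \<le> P"
  obtains I where "((\<lambda>\<theta>. if \<theta> \<in> {-\<tau>..\<tau>} then c else 0) has_integral I) {-P..P}" "I \<le> c * (2 * \<tau>)"
proof
  let ?m = "min \<tau> P"
  have "{-\<tau>..\<tau>} \<inter> {-P..P} = {-?m..?m}" by auto
  moreover have "((\<lambda>_. c) has_integral (?m - - ?m) *\<^sub>R c) {-?m..?m}"
  proof -
    have "- ?m \<le> \<tau>" "- ?m \<le> P" using assms by (auto simp: min_def)
    then show ?thesis using has_integral_const_real [of c "- ?m" ?m] by simp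
  qed
  ultimately show "((\<lambda>\<theta>. if \<theta> \<in> {-\<tau>..\<tau>} then c else 0) has_integral (?m - - ?m) *\<^sub>R c) {-P..P}"
    by (subst has_integral_restrict_Int) auto
  have "c * (2 * ?m) \<le> c * (2 * \<tau>)" using assms by (intro mult_left_mono) auto
  then show "(?m - - ?m) *\<^sub>R c \<le> c * (2 * \<tau>)" by (simp add: algebra_simps)
qed

lemma abs_le_2_abs_sin:
  fixes \<theta> :: real
  assumes "\<bar>\<theta>\<bar> \<le> pi / 2"
  shows "\<bar>\<theta>\<bar> \<le> 2 * \<bar>sin \<theta>\<bar>"
proof -
  have *: "x \<le> 2 * sin x" if x: "0 \<le> x" "x \<le> pi / 2" for x :: real
  proof (cases "x \<le> pi / 3")
    case True
    have "2 * sin 0 - 0 \<le> 2 * sin x - x"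
    proof (rule DERIV_nonneg_imp_nondecreasing [OF x(1)])
      fix y assume y: "0 \<le> y" "y \<le> x"
      have "cos (pi / 3) \<le> cos y" using y True pi_gt_zero by (intro cos_monotone_0_pi_le) auto
      then have "0 \<le> 2 * cos y - 1" by (simp add: cos_60)
      moreover have "((\<lambda>x. 2 * sin x - x) has_real_derivative 2 * cos y - 1) (at y)"
        by (auto intro!: derivative_eq_intros)
      ultimately show "\<exists>d. ((\<lambda>x. 2 * sin x - x) has_real_derivative d) (at y) \<and> 0 \<le> d" by blast
    qed
    then show ?thesis by simp
  next
    case False
    then have "sin (pi / 3) \<le> sin x" using x by (intro sin_monotone_2pi_le) auto
    then have "sqrt 3 \<le> 2 * sin x" by (simp add: sin_60)
    moreover have "x \<le> 1.6" using x pi_approx by simp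
    moreover have "1.6 \<le> sqrt (3::real)" by (intro real_le_rsqrt) (simp add: power2_eq_square)
    ultimately show ?thesis by linarith
  qed
  show ?thesis using * [of \<theta>] * [of "- \<theta>"] assms by (cases "0 \<le> \<theta>") auto
qed

context comb_walk
begin

text \<open>The circle is cut according to scales. By \<open>t(2)\<close> the rate
  \<open>t j\<close> is large enough for the scale \<open>R j\<close>, so an angle is assigned the
  first index \<open>j\<close> with \<open>t j \<le> lam\<close>. There the integrand is of order
  \<open>L j * R j ^ 3\<close>, on an arc of length of order \<open>t (j - 1)\<close>. As
  \<open>t m \<le> 1 - s \<le> lam\<close>, no index beyond \<open>m\<close> occurs.\<close>

lemma collision_sum_le:
  fixes \<epsilon> t L :: "_ \<Rightarrow> real" and R kk :: "nat \<Rightarrow> nat"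
  assumes a: "a = (\<alpha>, 0)" and s: "1 / 2 \<le> s" "s < 1" and M: "s ^ M \<le> 1 - s"
    and R: "\<And>j. 1 \<le> R j"
    and k: "\<And>j x. int (R j) \<le> \<bar>x\<bar> \<Longrightarrow> kk j \<le> h x"
    and t: "\<And>j. 0 \<le> t j" "\<And>j. 1 \<le> t j * (real (R j))\<^sup>2 * (real (kk j) + 1)" "t m \<le> 1 - s"
    and kR: "\<And>j. real (kk j) + 1 \<le> A * (real (R j))\<^sup>2"
    and \<epsilon>: "\<And>x. 0 \<le> \<epsilon> x" and L: "\<And>j. 0 \<le> L j"
    and far: "\<And>j x. int (R j) \<le> \<bar>x\<bar> \<Longrightarrow> \<epsilon> x * hsum (kk j) \<le> L j"
    and near: "\<And>j. (\<Sum>x | \<bar>x\<bar> < int (R j). \<epsilon> x * hsum (h x)) \<le> L j * real (R j)"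
    and near': "\<And>j x. \<bar>x\<bar> < int (R j) \<Longrightarrow> \<epsilon> x * (real (h x) + 1) \<le> A * L j * (real (R j))\<^sup>2"
    and X: "\<And>j. j \<le> m \<Longrightarrow> \<bar>\<alpha>\<bar> + int M + 3 * int (R j) < X"
  shows "(\<Sum>(x, l)\<in>strip X. \<epsilon> x / (1 + real l) * (\<Sum>n<M. s ^ (2 * n) * (p n a (x, l))\<^sup>2)) \<le>
    9 * (155 * (2 + A) * (19 + 15 * A)) *
      (\<Sum>j\<le>m. L j * real (R j) ^ 3 * (2 * (if j = 0 then 2 else 2 * t (j - 1))))"
proof -
  define K where "K = 155 * (2 + A) * (19 + 15 * A)"
  \<comment> \<open>For \<open>j = 0\<close> the value 2 covers the whole interval, because
    \<open>pi / 2 < 2\<close>. For later \<open>j\<close> minimality gives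
    \<open>\<bar>sin \<theta>\<bar> < t (j - 1)\<close>, and
    \<open>\<bar>\<theta>\<bar> \<le> 2 * \<bar>sin \<theta>\<bar>\<close> turns this into an
    arc.\<close>
  define \<tau> where "\<tau> j = (if j = 0 then 2 else 2 * t (j - 1))" for j
  define c where "c j = 9 * K * L j * real (R j) ^ 3" for j
  define I where "I = {- (pi / 2)..pi / 2}"
  define f where "f w = \<epsilon> (fst w) / (1 + real (snd w))" for w :: "int \<times> nat"
  define S where "S w = (\<Sum>n<M. s ^ (2 * n) * (p n a w)\<^sup>2)" for w
  define F where "F \<theta> = (\<Sum>w\<in>strip X. f w * (norm (\<Sum>n<M. cis \<theta> ^ n * of_real (s ^ n * p n a w)))\<^sup>2)" for \<theta>
  have "0 < A * (real (R 0))\<^sup>2" using kR [of 0] by linarith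
  then have A: "0 < A" by (simp add: zero_less_mult_iff)
  have K: "0 \<le> K" using A by (simp add: K_def)
  have c0: "0 \<le> c j" for j using K L [of j] by (simp add: c_def)
  have \<tau>0: "0 \<le> \<tau> j" for j using t by (simp add: \<tau>_def)
  have f0: "0 \<le> f w" for w using \<epsilon> by (simp add: f_def)
  have F_int: "(F has_integral (\<Sum>w\<in>strip X. f w * (pi * S w))) I"
    unfolding F_def
  proof (intro has_integral_sum finite_strip has_integral_mult_right)
    fix w
    have "((\<lambda>\<theta>. (norm (\<Sum>n<M. cis \<theta> ^ n * of_real (s ^ n * p n a w)))\<^sup>2) has_integral
        pi * (\<Sum>n<M. (s ^ n * p n a w)\<^sup>2)) I"
      unfolding I_def
    proof (rule parseval_half_period)
      fix n assume "s ^ n * p n a w \<noteq> 0"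
      then show "even n = (par w = par a)" using p_parity [of n a w] by auto
    qed
    then show "((\<lambda>\<theta>. (norm (\<Sum>n<M. cis \<theta> ^ n * of_real (s ^ n * p n a w)))\<^sup>2) has_integral pi * S w) I"
      by (simp add: S_def power_mult_distrib power_mult mult.commute [of 2])
  qed
  have F_bound: "F \<theta> \<le> (\<Sum>j\<le>m. if \<theta> \<in> {-\<tau> j..\<tau> j} then c j else 0)" if \<theta>: "\<theta> \<in> I" for \<theta>
  proof -
    define lam where "lam = max \<bar>sin \<theta>\<bar> (1 - s)"
    define z where "z = of_real s * cis \<theta>"
    define j where "j = (LEAST j. t j \<le> lam)"
    have tm: "t m \<le> lam" using t by (simp add: lam_def)
    have tj: "t j \<le> lam" unfolding j_def using tm by (rule LeastI)
    have jm: "j \<le> m" unfolding j_def using tm by (rule Least_le)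
    have \<theta>': "\<bar>\<theta>\<bar> \<le> pi / 2" using \<theta> by (auto simp: I_def)
    have "\<bar>\<theta>\<bar> \<le> \<tau> j"
    proof (cases j)
      case 0
      then show ?thesis using \<theta>' pi_less_4 by (simp add: \<tau>_def)
    next
      case (Suc i)
      have "\<not> t i \<le> lam" using not_less_Least [of i "\<lambda>j. t j \<le> lam"] Suc by (simp add: j_def)
      then show ?thesis using abs_le_2_abs_sin [OF \<theta>'] by (simp add: \<tau>_def Suc lam_def)
    qed
    then have in_j: "\<theta> \<in> {-\<tau> j..\<tau> j}" by auto
    \<comment> \<open>The factor 9 undoes the division of \<open>gf\<close> by the degree, which is
      at most 3.\<close>
    have "F \<theta> \<le> (\<Sum>w\<in>strip X. 9 * (f w * (norm (gf M z a w))\<^sup>2))"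
      unfolding F_def
    proof (rule sum_mono)
      fix w
      have "(\<Sum>n<M. cis \<theta> ^ n * of_real (s ^ n * p n a w)) = of_real (deg w) * gf M z a w"
        using deg_pos [of w]
        by (simp add: gf_def z_def power_mult_distrib mult_ac del: deg_pos)
      moreover have "(deg w)\<^sup>2 \<le> 3\<^sup>2" using deg_le_3 by (intro power_mono) auto
      ultimately have "(norm (\<Sum>n<M. cis \<theta> ^ n * of_real (s ^ n * p n a w)))\<^sup>2 \<le> 9 * (norm (gf M z a w))\<^sup>2"
        by (simp add: norm_mult power_mult_distrib mult_right_mono)
      then show "f w * (norm (\<Sum>n<M. cis \<theta> ^ n * of_real (s ^ n * p n a w)))\<^sup>2 \<le>
          9 * (f w * (norm (gf M z a w))\<^sup>2)"
        using mult_left_mono [OF _ f0 [of w]] by fastforce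
    qed
    also have "\<dots> = 9 * (\<Sum>(x, l)\<in>strip X. \<epsilon> x / (1 + real l) * (norm (gf M z a (x, l)))\<^sup>2)"
      by (simp add: sum_distrib_left f_def case_prod_beta)
    also have "\<dots> \<le> 9 * (155 * (2 + A) * (19 + 15 * A) * L j * (real (R j)) ^ 3)"
    proof (intro mult_left_mono gf_weighted_sum_le [OF a z_def s _ _ _ M X [OF jm] R k _ kR \<epsilon> L far near near'])
      show "0 \<le> cos \<theta>" using \<theta>' by (intro cos_ge_zero) auto
      show "lam \<le> max \<bar>sin \<theta>\<bar> (1 - s)" by (simp add: lam_def)
      show "0 \<le> lam" using s by (simp add: lam_def)
      have "t j * (real (R j))\<^sup>2 * (real (kk j) + 1) \<le> lam * (real (R j))\<^sup>2 * (real (kk j) + 1)"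
        using tj by (intro mult_right_mono) auto
      with t(2) [of j] show "1 \<le> lam * (real (R j))\<^sup>2 * (real (kk j) + 1)" by linarith
    qed auto
    also have "\<dots> = c j" by (simp add: c_def K_def)
    also have "\<dots> = (\<Sum>i\<in>{j}. if \<theta> \<in> {-\<tau> i..\<tau> i} then c i else 0)" using in_j by simp
    also have "\<dots> \<le> (\<Sum>j\<le>m. if \<theta> \<in> {-\<tau> j..\<tau> j} then c j else 0)"
      using jm c0 by (intro sum_mono2) auto
    finally show ?thesis .
  qed
  have "\<exists>J. ((\<lambda>\<theta>. if \<theta> \<in> {-\<tau> j..\<tau> j} then c j else 0) has_integral J) I \<and> J \<le> c j * (2 * \<tau> j)" for j
    using step_has_integral [OF c0 \<tau>0, of "pi / 2" j j] unfolding I_def by (metis pi_half_ge_zero)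
  then obtain J where J: "\<And>j. ((\<lambda>\<theta>. if \<theta> \<in> {-\<tau> j..\<tau> j} then c j else 0) has_integral J j) I"
      "\<And>j. J j \<le> c j * (2 * \<tau> j)"
    by metis
  have S0: "0 \<le> (\<Sum>w\<in>strip X. f w * S w)"
    using s by (intro sum_nonneg mult_nonneg_nonneg f0) (auto simp: S_def intro!: sum_nonneg)
  have "(\<Sum>w\<in>strip X. f w * S w) \<le> pi * (\<Sum>w\<in>strip X. f w * S w)"
    using mult_right_mono [OF _ S0, of 1 pi] pi_ge_two by simp
  also have "\<dots> = (\<Sum>w\<in>strip X. f w * (pi * S w))"
    by (simp add: sum_distrib_left mult_ac)
  also have "\<dots> \<le> (\<Sum>j\<le>m. J j)"
  proof (rule has_integral_le [OF F_int _ F_bound])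
    show "((\<lambda>\<theta>. \<Sum>j\<le>m. if \<theta> \<in> {-\<tau> j..\<tau> j} then c j else 0) has_integral (\<Sum>j\<le>m. J j)) I"
      by (intro has_integral_sum J finite_atMost)
  qed
  also have "\<dots> \<le> (\<Sum>j\<le>m. c j * (2 * \<tau> j))"
    by (intro sum_mono J)
  also have "\<dots> = 9 * K * (\<Sum>j\<le>m. L j * real (R j) ^ 3 * (2 * \<tau> j))"
    by (simp add: c_def sum_distrib_left mult_ac)
  finally show ?thesis
    by (simp add: f_def S_def K_def \<tau>_def case_prod_beta)
qed

subsection \<open>Weighted collisions and the teeth\<close>

text \<open>One simultaneous step of two independent walks.\<close>

definition avp :: "(int \<times> nat \<Rightarrow> int \<times> nat \<Rightarrow> real) \<Rightarrow> int \<times> nat \<Rightarrow> int \<times> nat \<Rightarrow> real" where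
  "avp F v w = av (\<lambda>v'. av (F v') w) v"

lemma av_mult_right: "av (\<lambda>w. \<phi> w * c) v = av \<phi> v * c"
  using av_cmult [of c \<phi> v] by (simp add: mult.commute)

lemma avp_mono:
  "(\<And>v' w'. v' \<in> nb v \<Longrightarrow> w' \<in> nb w \<Longrightarrow> F v' w' \<le> G v' w') \<Longrightarrow> avp F v w \<le> avp G v w"
  unfolding avp_def by (intro av_mono) auto

lemma avp_cong:
  "(\<And>v' w'. v' \<in> nb v \<Longrightarrow> w' \<in> nb w \<Longrightarrow> F v' w' = G v' w') \<Longrightarrow> avp F v w = avp G v w"
  unfolding avp_def by (intro av_cong) auto

lemma avp_const [simp]: "avp (\<lambda>_ _. c) v w = c"
  by (simp add: avp_def)

lemma avp_add: "avp (\<lambda>v w. F v w + G v w) v w = avp F v w + avp G v w"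
  by (simp add: avp_def av_add)

lemma avp_diff: "avp (\<lambda>v w. F v w - G v w) v w = avp F v w - avp G v w"
  by (simp add: avp_def av_diff)

lemma avp_cmult: "avp (\<lambda>v w. c * F v w) v w = c * avp F v w"
  by (simp add: avp_def av_cmult)

lemma avp_nonneg: "(\<And>v' w'. v' \<in> nb v \<Longrightarrow> w' \<in> nb w \<Longrightarrow> 0 \<le> F v' w') \<Longrightarrow> 0 \<le> avp F v w"
  using avp_mono [of v w "\<lambda>_ _. 0" F] by simp

lemma avp_le_const: "(\<And>v' w'. v' \<in> nb v \<Longrightarrow> w' \<in> nb w \<Longrightarrow> F v' w' \<le> c) \<Longrightarrow> avp F v w \<le> c"
  using avp_mono [of v w F "\<lambda>_ _. c"] by simp

text \<open>The mean \<open>f\<close>-weighted number of collisions at times below \<open>N\<close>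
  of walks from \<open>v\<close> and \<open>w\<close>. The discount is \<open>s\<^sup>2\<close> per
  step, one factor \<open>s\<close> for each walk, to match the square of a generating function on
  the circle of radius \<open>s\<close>.\<close>

primrec Psi :: "(int \<times> nat \<Rightarrow> real) \<Rightarrow> real \<Rightarrow> nat \<Rightarrow> int \<times> nat \<Rightarrow> int \<times> nat \<Rightarrow> real" where
  "Psi f s 0 = (\<lambda>v w. 0)"
| "Psi f s (Suc N) = (\<lambda>v w. (if v = w then f v else 0) + s\<^sup>2 * avp (Psi f s N) v w)"

lemma Psi_eq_sum:
  assumes "v \<in> verts" "w \<in> verts" "finite S" "box v N \<subseteq> S"
  shows "Psi f s N v w = (\<Sum>n<N. s ^ (2 * n) * (\<Sum>z\<in>S. f z * p n v z * p n w z))"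
  using assms
proof (induction N arbitrary: v w)
  case 0
  then show ?case by simp
next
  case (Suc N)
  have "v \<in> S" using Suc.prems by (auto simp: box_def verts_def)
  have "(\<Sum>z\<in>S. f z * p 0 v z * p 0 w z) = (\<Sum>z\<in>S. if v = z then (if v = w then f v else 0) else 0)"
    by (intro sum.cong) auto
  then have 0: "(\<Sum>z\<in>S. f z * p 0 v z * p 0 w z) = (if v = w then f v else 0)"
    using \<open>v \<in> S\<close> Suc.prems by simp
  have "avp (Psi f s N) v w = avp (\<lambda>v w. \<Sum>n<N. s ^ (2 * n) * (\<Sum>z\<in>S. f z * p n v z * p n w z)) v w"
    using Suc.prems nb_verts box_nb by (intro avp_cong Suc.IH) blast+
  also have "\<dots> = (\<Sum>n<N. s ^ (2 * n) * (\<Sum>z\<in>S. f z * p (Suc n) v z * p (Suc n) w z))"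
    unfolding avp_def
    by (simp add: av_sum av_cmult av_mult_right)
  finally have "s\<^sup>2 * avp (Psi f s N) v w =
      (\<Sum>n<N. s ^ (2 * Suc n) * (\<Sum>z\<in>S. f z * p (Suc n) v z * p (Suc n) w z))"
    by (simp add: sum_distrib_left power2_eq_square mult.assoc)
  then show ?case by (subst sum.lessThan_Suc_shift) (simp add: 0 del: p.simps)
qed

lemma Psi_nonneg: "(\<And>v. 0 \<le> f v) \<Longrightarrow> 0 \<le> Psi f s N v w"
  by (induction N arbitrary: v w) (auto intro!: add_nonneg_nonneg mult_nonneg_nonneg avp_nonneg)

lemma Psi_sym: "Psi f s N v w = Psi f s N w v"
proof (induction N arbitrary: v w)
  case (Suc N)
  have "avp (Psi f s N) v w = avp (Psi f s N) w v"
    unfolding avp_def by (subst av_swap) (intro av_cong Suc)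
  then show ?case by auto
qed simp

text \<open>By \<open>Psi_eq_sum\<close> this is a positive semidefinite form in the two starting
  points, so \<open>a * b \<le> a\<^sup>2 + b\<^sup>2 / 4\<close> applies under the sum. The small
  coefficient goes to the starting point whose diagonal value is still to be estimated.\<close>

lemma Psi_polarize:
  assumes f: "\<And>v. 0 \<le> f v" and "v \<in> verts" "w \<in> verts"
  shows "Psi f s N v w \<le> Psi f s N v v + Psi f s N w w / 4"
proof -
  let ?S = "box v N \<union> box w N"
  have fin: "finite ?S" by simp
  have "Psi f s N v w = (\<Sum>n<N. s ^ (2 * n) * (\<Sum>z\<in>?S. f z * p n v z * p n w z))"
    using assms by (intro Psi_eq_sum fin) auto
  also have "\<dots> \<le> (\<Sum>n<N. s ^ (2 * n) * (\<Sum>z\<in>?S. f z * p n v z * p n v z + f z * p n w z * p n w z / 4))"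
  proof (intro sum_mono mult_left_mono)
    fix n z
    have "0 \<le> f z * (p n v z - p n w z / 2)\<^sup>2" using f by simp
    then show "f z * p n v z * p n w z \<le> f z * p n v z * p n v z + f z * p n w z * p n w z / 4"
      by (simp add: power2_eq_square algebra_simps)
  qed simp
  also have "\<dots> = Psi f s N v v + Psi f s N w w / 4"
    using Psi_eq_sum [of v v ?S N f s] Psi_eq_sum [of w w ?S N f s] assms
    by (simp add: sum.distrib distrib_left sum_divide_distrib sum_distrib_left)
  finally show ?thesis .
qed

text \<open>Only finiteness matters here: it makes the supremum in \<open>Psi_diag_le\<close> exist
  before it is estimated.\<close>

lemma Psi_le_geometric:
  assumes f: "\<And>v. 0 \<le> f v" "\<And>v. f v \<le> 1" and s: "0 \<le> s" "s < 1"
  shows "Psi f s N v w \<le> 1 / (1 - s\<^sup>2)"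
proof (induction N arbitrary: v w)
  case 0
  then show ?case using s by (simp add: power_le_one)
next
  case (Suc N)
  have s2: "s\<^sup>2 < 1" using s by (simp add: power_less_one_iff)
  have "s\<^sup>2 * avp (Psi f s N) v w \<le> s\<^sup>2 * (1 / (1 - s\<^sup>2))"
    by (intro mult_left_mono avp_le_const Suc) simp
  then have "Psi f s (Suc N) v w \<le> 1 + s\<^sup>2 * (1 / (1 - s\<^sup>2))"
    using f(2) [of v] by (cases "v = w") (simp_all add: add_increasing)
  also have "\<dots> = 1 / (1 - s\<^sup>2)" using s2 by (simp add: field_simps)
  finally show ?case .
qed

text \<open>
  A Lyapunov function for two walks on a tooth, killed at the spine: it is superharmonic for the pair
  walk on the quarter plane, and its kink on the diagonal produces the weight \<open>1 / (4 * i)\<close> of a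
  collision at height \<open>i\<close>. The boundary value is \<open>0\<close> except at the corner, where \<open>x / 0 = 0\<close> makes it \<open>1 / 2\<close>.
\<close>

definition quad :: "real \<Rightarrow> real \<Rightarrow> real" where
  "quad i j = 1 / 2 - \<bar>i - j\<bar> / (2 * (i + j))"

lemma quad_sym: "quad i j = quad j i"
  by (simp add: quad_def abs_minus_commute add.commute)

lemma quad_nonneg:
  assumes "0 \<le> i" "0 \<le> j"
  shows "0 \<le> quad i j"
proof -
  have "\<bar>i - j\<bar> \<le> i + j" using assms by linarith
  then show ?thesis by (auto simp: quad_def divide_le_eq)
qed

lemma quad_diag: "quad i i = 1 / 2"
  by (simp add: quad_def)

text \<open>Put \<open>D = \<bar>i - j\<bar>\<close> and \<open>S = i + j\<close>. A parallel move
  keeps \<open>D\<close> and changes \<open>S\<close> by 2; an antiparallel move keeps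
  \<open>S\<close> and changes the signed difference by 2. Convexity of \<open>1 / S\<close> and of
  the absolute value makes the mean of \<open>D / S\<close> grow. On the diagonal both antiparallel
  moves raise \<open>D\<close> from 0 to 2, whence the gain \<open>1 / (4 * i)\<close>.\<close>

lemma quad_interior:
  fixes i j :: real
  assumes "1 \<le> i" "1 \<le> j" "i = j \<or> 1 \<le> \<bar>i - j\<bar>"
  shows "(quad (i + 1) (j + 1) + quad (i - 1) (j - 1) + quad (i + 1) (j - 1) + quad (i - 1) (j + 1)) / 4
    \<le> quad i j - (if i = j then 1 / (4 * i) else 0)"
proof (cases "i = j")
  case True
  have "quad (j + 1) (j - 1) = 1 / 2 - 1 / (2 * j)" "quad (j - 1) (j + 1) = 1 / 2 - 1 / (2 * j)"
    using assms by (simp_all add: quad_def)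
  then show ?thesis using assms True by (simp add: quad_diag field_simps)
next
  case False
  define D S where "D = \<bar>i - j\<bar>" and "S = i + j"
  have D: "1 \<le> D" using assms False by (simp add: D_def)
  have S: "2 < S" using assms D by (auto simp: D_def S_def)
  have 1: "quad (i + 1) (j + 1) = 1 / 2 - D / (2 * (S + 2))"
    and 2: "quad (i - 1) (j - 1) = 1 / 2 - D / (2 * (S - 2))"
    by (simp_all add: quad_def D_def S_def algebra_simps)
  have "quad (i + 1) (j - 1) + quad (i - 1) (j + 1) = 1 - (\<bar>i - j + 2\<bar> + \<bar>i - j - 2\<bar>) / (2 * S)"
    by (simp add: quad_def S_def algebra_simps add_divide_distrib)
  also have "\<dots> \<le> 1 - 2 * D / (2 * S)"
  proof (intro diff_left_mono divide_right_mono)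
    show "2 * D \<le> \<bar>i - j + 2\<bar> + \<bar>i - j - 2\<bar>"
      using abs_triangle_ineq [of "i - j + 2" "i - j - 2"] abs_mult [of 2 "i - j"]
      by (simp add: D_def algebra_simps)
  qed (use S in simp)
  finally have 3: "quad (i + 1) (j - 1) + quad (i - 1) (j + 1) \<le> 1 - D / S" by simp
  have "2 / S \<le> 1 / (S + 2) + 1 / (S - 2)"
    using S mult_strict_mono [of 2 S 2 S] by (simp add: divide_simps algebra_simps)
  then have "D / 2 * (2 / S) \<le> D / 2 * (1 / (S + 2) + 1 / (S - 2))"
    using D by (intro mult_left_mono) auto
  then have 4: "D / S \<le> D / (2 * (S + 2)) + D / (2 * (S - 2))"
    by (simp add: distrib_left)
  have "quad i j = 1 / 2 - D / (2 * S)" by (simp add: quad_def D_def S_def)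
  then show ?thesis using 1 2 3 4 False by simp
qed

text \<open>At the tip one walk is forced down and superharmonicity may fail, but by at most
  \<open>1 / H\<close>. The linear term in \<open>Psi_tooth_le\<close> pays for this.\<close>

lemma quad_top:
  fixes i H :: real
  assumes "1 \<le> i" "i + 1 \<le> H"
  shows "(quad (i + 1) (H - 1) + quad (i - 1) (H - 1)) / 2 \<le> quad i H + 1 / H"
proof -
  define D S where "D = H - i" and "S = i + H"
  have D: "1 \<le> D" using assms by (simp add: D_def)
  have S: "2 < S" "H \<le> S" "0 < H" using assms by (auto simp: S_def)
  have "quad (i + 1) (H - 1) = 1 / 2 - \<bar>D - 2\<bar> / (2 * S)"
    by (simp add: quad_def D_def S_def abs_minus_commute [of _ 2] algebra_simps)
      (metis abs_minus_commute add_diff_cancel diff_diff_eq2)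
  also have "\<dots> \<le> 1 / 2 - (D - 2) / (2 * S)"
    using S by (intro diff_left_mono divide_right_mono) auto
  also have "\<dots> = 1 / 2 - D / (2 * S) + 1 / S" using S by (simp add: field_simps)
  finally have 1: "quad (i + 1) (H - 1) \<le> 1 / 2 - D / (2 * S) + 1 / S" .
  have "quad (i - 1) (H - 1) = 1 / 2 - D / (2 * (S - 2))"
    using D by (simp add: quad_def D_def S_def algebra_simps)
  also have "\<dots> \<le> 1 / 2 - D / (2 * S)"
    using S D by (intro diff_left_mono divide_left_mono) auto
  finally have 2: "quad (i - 1) (H - 1) \<le> 1 / 2 - D / (2 * S)" .
  have 3: "1 / S \<le> 1 / H" using S by (intro divide_left_mono) auto
  have "0 \<le> 1 / H" using S by simp
  moreover have "quad i H = 1 / 2 - D / (2 * S)" using D by (simp add: quad_def D_def S_def)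
  ultimately show ?thesis using 1 2 3 by argo
qed

text \<open>The right-hand side is a supersolution of the recursion for \<open>Psi\<close>. Below
  the tip, four times the diagonal gain of \<open>quad\<close> is \<open>1 / i\<close>, which covers
  the weight \<open>1 / (1 + i)\<close>. When one walk is at the tip, the mean of the linear term
  drops by \<open>1 / h a\<close>, exactly the defect in \<open>quad_top\<close>. Once a walk is on
  the spine, \<open>B\<close> takes over.\<close>

lemma Psi_tooth_le:
  assumes f: "\<And>v. 0 \<le> f v" "\<And>x l. f (x, l) \<le> 1 / (1 + real l)" and s: "0 \<le> s" "s < 1"
    and B: "\<And>N k. k \<le> h a \<Longrightarrow> Psi f s N (a, 0) (a, k) \<le> B"
    and ij: "i \<le> h a" "j \<le> h a" and H: "0 < h a"
  shows "Psi f s N (a, i) (a, j) \<le> 4 * (quad i j + (real i + real j) / h a) + B"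
  using ij
proof (induction N arbitrary: i j)
  case 0
  have "0 \<le> B" using B [of 0 0] by simp
  then show ?case using quad_nonneg [of i j] by simp
next
  case (Suc N)
  let ?H = "real (h a)"
  let ?W = "\<lambda>i j. 4 * (quad (real i) (real j) + (real i + real j) / ?H) + B"
  have W0: "0 \<le> quad (real i) (real j) + (real i + real j) / ?H" for i j
    using quad_nonneg by simp
  show ?case
  proof (cases "i = 0 \<or> j = 0")
    case True
    have "Psi f s (Suc N) (a, i) (a, j) \<le> B"
    proof (cases "i = 0")
      case True
      then show ?thesis using B [of j "Suc N"] Suc.prems by (simp del: Psi.simps)
    next
      case False
      with True show ?thesis
        using B [of i "Suc N"] Psi_sym [of f s "Suc N" "(a, i)" "(a, 0)"] Suc.prems
        by (simp del: Psi.simps)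
    qed
    moreover have "B \<le> 4 * w + B" if "0 \<le> w" for w using that by simp
    from this [OF W0 [of i j]] have "B \<le> ?W i j" .
    ultimately show ?thesis by (rule order.trans)
  next
    case False
    then have i: "1 \<le> i" and j: "1 \<le> j" by auto
    define P where "P = Psi f s N"
    have P: "P (a, i) (a, j) \<le> ?W i j" if "i \<le> h a" "j \<le> h a" for i j
      using Suc.IH [OF that] by (simp add: P_def)
    have s2: "s\<^sup>2 \<le> 1" using s by (simp add: power_le_one)
    have "s\<^sup>2 * avp P (a, i) (a, j) \<le> 1 * avp P (a, i) (a, j)"
      using s2 f by (intro mult_right_mono avp_nonneg) (auto simp: P_def intro!: Psi_nonneg)
    moreover have "avp P (a, i) (a, j) \<le> ?W i j - (if i = j then 1 / i else 0)"
    proof -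
      define e where "e = (if i = j then 1 / (4 * real i) else 0)"
      have pred: "real (i - Suc 0) = real i - 1" "real (j - Suc 0) = real j - 1" using i j by auto
      have aux: "x / 2 \<le> y + c \<Longrightarrow> d = 0 \<Longrightarrow> 4 * (x / 2 + b - c) + B \<le> 4 * (y + b) + B - 4 * d"
        for x y c b d :: real
        by simp
      have dist: "real i = real j \<or> 1 \<le> \<bar>real i - real j\<bar>"
      proof -
        consider "i = j" | "Suc i \<le> j" | "Suc j \<le> i" by linarith
        then show ?thesis
        proof cases
          case 2
          then have "real i + 1 \<le> real j" by linarith
          then show ?thesis by linarith
        next
          case 3
          then have "real j + 1 \<le> real i" by linarith
          then show ?thesis by linarith
        qed simp
      qed
      consider "i < h a" "j < h a" | "i < h a" "j = h a" | "i = h a" "j < h a" | "i = h a" "j = h a"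
        using Suc.prems by linarith
      then have "avp P (a, i) (a, j) \<le> ?W i j - 4 * e"
      proof cases
        case 1
        have "avp P (a, i) (a, j) = (P (a, i - 1) (a, j - 1) + P (a, i - 1) (a, Suc j) +
            P (a, Suc i) (a, j - 1) + P (a, Suc i) (a, Suc j)) / 4"
          using 1 i j by (simp add: avp_def av_tooth add_divide_distrib)
        also have "\<dots> \<le> (?W (i - 1) (j - 1) + ?W (i - 1) (Suc j) + ?W (Suc i) (j - 1) + ?W (Suc i) (Suc j)) / 4"
          using 1 by (intro divide_right_mono add_mono P) auto
        also have "\<dots> = 4 * ((quad (real i + 1) (real j + 1) + quad (real i - 1) (real j - 1) +
            quad (real i + 1) (real j - 1) + quad (real i - 1) (real j + 1)) / 4 + (real i + real j) / ?H) + B"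
          by (simp add: pred algebra_simps add_divide_distrib diff_divide_distrib)
        also have "\<dots> \<le> ?W i j - 4 * e"
          using quad_interior [of i j] dist i j by (simp add: e_def split: if_splits)
        finally show ?thesis .
      next
        case 2
        have "avp P (a, i) (a, j) = (P (a, i - 1) (a, j - 1) + P (a, Suc i) (a, j - 1)) / 2"
          using 2 i j by (simp add: avp_def av_tooth)
        also have "\<dots> \<le> (?W (i - 1) (j - 1) + ?W (Suc i) (j - 1)) / 2"
          using 2 by (intro divide_right_mono add_mono P) auto
        also have "\<dots> = 4 * ((quad (real i + 1) (real j - 1) + quad (real i - 1) (real j - 1)) / 2 +
            (real i + real j) / ?H - 1 / ?H) + B"
          by (simp add: pred algebra_simps add_divide_distrib diff_divide_distrib)
        also have "\<dots> \<le> ?W i j - 4 * e"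
          by (rule aux, use quad_top [of i j] 2 i in \<open>simp_all add: e_def add.commute\<close>)
        finally show ?thesis .
      next
        case 3
        have "avp P (a, i) (a, j) = (P (a, i - 1) (a, j - 1) + P (a, i - 1) (a, Suc j)) / 2"
          using 3 i j by (simp add: avp_def av_tooth)
        also have "\<dots> \<le> (?W (i - 1) (j - 1) + ?W (i - 1) (Suc j)) / 2"
          using 3 by (intro divide_right_mono add_mono P) auto
        also have "\<dots> = 4 * ((quad (real j + 1) (real i - 1) + quad (real j - 1) (real i - 1)) / 2 +
            (real i + real j) / ?H - 1 / ?H) + B"
          by (simp add: pred quad_sym [of "real i - 1"] algebra_simps add_divide_distrib diff_divide_distrib)
        also have "\<dots> \<le> ?W i j - 4 * e"
          by (rule aux, use quad_top [of j i] 3 j in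
              \<open>simp_all add: e_def add.commute quad_sym [of "real (h a)" "real j"]\<close>)
        finally show ?thesis .
      next
        case 4
        have "avp P (a, i) (a, j) = P (a, i - 1) (a, j - 1)"
          using 4 i j by (simp add: avp_def av_tooth)
        also have "\<dots> \<le> ?W (i - 1) (j - 1)"
          using 4 by (intro P) auto
        also have "\<dots> = ?W i j - 8 / ?H"
          using 4 by (simp add: pred quad_diag algebra_simps add_divide_distrib diff_divide_distrib)
        \<comment> \<open>Both walks step down together, so the linear term drops by
          \<open>2 / ?H\<close>; this alone pays for the collision at the tip.\<close>
        also have "\<dots> \<le> ?W i j - 4 * e"
          using 4 H by (simp add: e_def field_simps)
        finally show ?thesis .
      qed
      then show ?thesis using i by (simp add: e_def split: if_splits)
    qed
    moreover have "(if (a, i) = (a, j) then f (a, i) else 0) \<le> (if i = j then 1 / real i else 0)"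
      using f(2) [of a i] i frac_le [of 1 1 "real i" "1 + real i"] by auto
    ultimately show ?thesis by (simp add: P_def)
  qed
qed

text \<open>
  Polarization bounds the expected number of collisions once a walk has reached the spine by a
  quarter of the supremum to be estimated, which is absorbed.
\<close>

lemma Psi_diag_le:
  assumes f: "\<And>v. 0 \<le> f v" "\<And>x l. f (x, l) \<le> 1 / (1 + real l)" and s: "0 \<le> s" "s < 1"
    and B: "\<And>N a. Psi f s N (a, 0) (a, 0) \<le> B"
    and v: "v \<in> verts"
  shows "Psi f s N v v \<le> 14 + 2 * B"
proof -
  define S where "S = {Psi f s N v v |N v. v \<in> verts}"
  have f1: "f v \<le> 1" for v
  proof -
    have "f v \<le> 1 / (1 + real (snd v))" using f(2) [of "fst v" "snd v"] by simp
    also have "\<dots> \<le> 1" by simp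
    finally show ?thesis .
  qed
  have bdd: "bdd_above S"
    unfolding S_def bdd_above_def using Psi_le_geometric [of f s, OF f(1) f1 s] by blast
  have S: "Psi f s N v v \<le> Sup S" if "v \<in> verts" for N v
    unfolding S_def using that by (intro cSup_upper bdd [unfolded S_def]) blast
  have B0: "0 \<le> B" using B [of 0 0] by simp
  have S0: "0 \<le> Sup S" using S [of "(0, 0)" 0] by (simp add: verts_def)
  have "Sup S \<le> 10 + (B + Sup S / 4)"
  proof (rule cSup_least)
    show "S \<noteq> {}" by (auto simp: S_def verts_def)
    fix y assume "y \<in> S"
    then obtain N a i where y: "y = Psi f s N (a, i) (a, i)" "i \<le> h a"
      by (auto simp: S_def verts_def)
    show "y \<le> 10 + (B + Sup S / 4)"
    proof (cases "h a = 0")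
      case True
      then show ?thesis using y B [of N a] S0 by simp
    next
      case False
      have "y \<le> 4 * (quad i i + (real i + real i) / h a) + (B + Sup S / 4)"
        unfolding y(1)
      proof (rule Psi_tooth_le [OF f s])
        fix N k assume "k \<le> h a"
        then have "(a, k) \<in> verts" "(a, 0) \<in> verts" by (auto simp: verts_def)
        then have "Psi f s N (a, 0) (a, k) \<le> Psi f s N (a, 0) (a, 0) + Psi f s N (a, k) (a, k) / 4"
          by (intro Psi_polarize f)
        also have "\<dots> \<le> B + Sup S / 4"
          using B [of N a] S [OF \<open>(a, k) \<in> verts\<close>, of N] by linarith
        finally show "Psi f s N (a, 0) (a, k) \<le> B + Sup S / 4" .
      qed (use y False in auto)
      also have "(real i + real i) / h a \<le> 2" using y False by (simp add: field_simps)
      finally show ?thesis by (simp add: quad_diag)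
    qed
  qed
  \<comment> \<open>Absorbing the quarter gives \<open>Sup S \<le> 4 / 3 * (10 + B)\<close>, which
    is rounded up. The 10 is \<open>4 * (1 / 2 + 2)\<close>, from the diagonal value of
    \<open>quad\<close> and the bound 2 for the linear term.\<close>
  then have "Sup S \<le> 14 + 2 * B" using B0 by linarith
  with S [OF v, of N] show ?thesis by linarith
qed


subsection \<open>Bounded harmonic functions\<close>

lemma av_const_fun: "av (\<lambda>_. c) = (\<lambda>_. c)"
  by (rule ext) simp

lemma av_diff_fun: "av (\<lambda>w. \<phi> w - \<psi> w) = (\<lambda>v. av \<phi> v - av \<psi> v)"
  by (rule ext) (rule av_diff)

lemma av_sum_fun: "av (\<lambda>w. \<Sum>i\<in>I. \<phi> i w) = (\<lambda>v. \<Sum>i\<in>I. av (\<phi> i) v)"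
  by (rule ext) (rule av_sum)

text \<open>The tip of a tooth has a single neighbour, so the two topmost values agree; the midpoint
  rule carries the equality down to the spine.\<close>

lemma harmonic_tooth_const:
  assumes "\<And>v. v \<in> verts \<Longrightarrow> av \<psi> v = \<psi> v" "l \<le> h x"
  shows "\<psi> (x, l) = \<psi> (x, 0)"
proof -
  have step: "\<psi> (x, l) = \<psi> (x, l - 1)" if "1 \<le> l" "l \<le> h x" for l
    using that(2,1)
  proof (induction l rule: inc_induct)
    case base
    then show ?case using assms(1) [of "(x, h x)"] by (simp add: verts_def av_tooth)
  next
    case (step l)
    then show ?case using assms(1) [of "(x, l)"] by (simp add: verts_def av_tooth)
  qed
  show ?thesis using assms(2)
  proof (induction l)
    case (Suc l)
    then show ?case using step [of "Suc l"] by simp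
  qed simp
qed

text \<open>Teeth being constant, their contribution at the spine cancels. The spine values then
  form an arithmetic progression, which is bounded only if its increment \<open>d\<close> is
  0.\<close>

lemma harmonic_bounded_const:
  assumes harm: "\<And>v. v \<in> verts \<Longrightarrow> av \<psi> v = \<psi> v" and bd: "\<And>v. v \<in> verts \<Longrightarrow> \<bar>\<psi> v\<bar> \<le> C"
    and v: "v \<in> verts"
  shows "\<psi> v = \<psi> (0, 0)"
proof -
  define g where "g x = \<psi> (x, 0)" for x
  have V: "(x, 0) \<in> verts" for x by (simp add: verts_def)
  have mid: "g (x + 1) - g x = g x - g (x - 1)" for x
    using harm [OF V, of x] harmonic_tooth_const [OF harm, of 1 x]
    by (auto simp: av_spine g_def split: if_splits)
  define d where "d = g 1 - g 0"
  have up: "g (int n + 1) - g (int n) = d" for n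
  proof (induction n)
    case (Suc n)
    then show ?case using mid [of "int n + 1"] by (simp add: add.commute)
  qed (simp add: d_def)
  have dn: "g (1 - int n) - g (- int n) = d" for n
  proof (induction n)
    case (Suc n)
    have "- int n - 1 = - int (Suc n)" "1 - int (Suc n) = - int n" "- int n + 1 = 1 - int n" by auto
    then show ?case using Suc mid [of "- int n"] by metis
  qed (simp add: d_def)
  have pos: "g (int n) = g 0 + real n * d" for n
  proof (induction n)
    case (Suc n)
    then show ?case using up [of n] by (simp add: algebra_simps)
  qed simp
  have neg: "g (- int n) = g 0 - real n * d" for n
  proof (induction n)
    case (Suc n)
    then show ?case using dn [of "Suc n"] by (simp add: algebra_simps)
  qed simp
  have "d = 0"
  proof (rule ccontr)
    assume "d \<noteq> 0"
    then obtain n :: nat where "(2 * C + 1) / \<bar>d\<bar> < n" using reals_Archimedean2 by blast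
    then have "2 * C + 1 < \<bar>real n * d\<bar>" using \<open>d \<noteq> 0\<close> by (simp add: field_simps abs_mult)
    moreover have "\<bar>real n * d\<bar> \<le> 2 * C"
      using pos [of n] bd [OF V, of "int n"] bd [OF V, of 0] by (simp add: g_def)
    ultimately show False by linarith
  qed
  then have g: "g x = g 0" for x
    using pos [of "nat x"] neg [of "nat (- x)"] by (cases "0 \<le> x") auto
  obtain x l where "v = (x, l)" by force
  then show ?thesis
    using harmonic_tooth_const [OF harm, of l x] v g [of x] by (simp add: verts_def g_def)
qed

text \<open>A splitting into the eigenvalues 1 and -1 of \<open>av\<close>: the sum of \<phi> and
  \<open>av \<phi>\<close> is harmonic, and their difference becomes harmonic after multiplication
  by the bipartite sign. Two steps preserve parity, so constancy on parity classes is all that can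
  hold.\<close>

lemma two_step_harmonic_const:
  assumes harm: "\<And>v. v \<in> verts \<Longrightarrow> av (av \<phi>) v = \<phi> v" and bd: "\<And>v. v \<in> verts \<Longrightarrow> \<bar>\<phi> v\<bar> \<le> C"
    and "v \<in> verts" "w \<in> verts" "par v = par w"
  shows "\<phi> v = \<phi> w"
proof -
  define sg :: "int \<times> nat \<Rightarrow> real" where "sg v = (if par v then 1 else -1)" for v
  define \<psi>1 where "\<psi>1 v = \<phi> v + av \<phi> v" for v
  define \<psi>2 where "\<psi>2 v = sg v * (\<phi> v - av \<phi> v)" for v
  have bd': "\<bar>av \<phi> v\<bar> \<le> C" if v: "v \<in> verts" for v
  proof -
    have "- C \<le> \<phi> w \<and> \<phi> w \<le> C" if "w \<in> nb v" for w using bd nb_verts [OF v that] by fastforce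
    then show ?thesis using av_mono [of v "\<lambda>_. - C" \<phi>] av_mono [of v \<phi> "\<lambda>_. C"] by (simp add: abs_le_iff)
  qed
  have 1: "\<psi>1 v = \<psi>1 (0, 0)" if "v \<in> verts" for v
  proof (rule harmonic_bounded_const [OF _ _ that])
    show "av \<psi>1 v = \<psi>1 v" if "v \<in> verts" for v
      unfolding \<psi>1_def using harm [OF that] by (simp add: av_add)
    show "\<bar>\<psi>1 v\<bar> \<le> 2 * C" if "v \<in> verts" for v
      unfolding \<psi>1_def using bd [OF that] bd' [OF that] by linarith
  qed
  have 2: "\<psi>2 v = \<psi>2 (0, 0)" if "v \<in> verts" for v
  proof (rule harmonic_bounded_const [OF _ _ that])
    show "av \<psi>2 v = \<psi>2 v" if "v \<in> verts" for v
    proof -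
      have "av \<psi>2 v = av (\<lambda>w. - sg v * (\<phi> w - av \<phi> w)) v"
        unfolding \<psi>2_def using par_nb by (intro av_cong) (auto simp: sg_def)
      also have "\<dots> = \<psi>2 v"
        unfolding av_cmult av_diff using harm [OF that] by (simp add: \<psi>2_def algebra_simps)
      finally show ?thesis .
    qed
    show "\<bar>\<psi>2 v\<bar> \<le> 2 * C" if "v \<in> verts" for v
      unfolding \<psi>2_def sg_def using bd [OF that] bd' [OF that] by auto
  qed
  have "2 * \<phi> v = \<psi>1 v + sg v * \<psi>2 v" for v
    by (simp add: \<psi>1_def \<psi>2_def sg_def)
  from this [of v] this [of w] show ?thesis
    using 1 2 assms by (simp add: sg_def)
qed

subsection \<open>Bounded harmonic functions of the pair walk\<close>

text \<open>Two steps of the first walk alone. The square of \<open>avp\<close> factors into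
  \<open>A2\<close> and \<open>B2\<close>, which commute. With two steps, unlike with one, the walk
  can return to its start, so that \<open>A2\<close> dominates a ninth of the identity.\<close>

definition A2 :: "(int \<times> nat \<Rightarrow> int \<times> nat \<Rightarrow> real) \<Rightarrow> int \<times> nat \<Rightarrow> int \<times> nat \<Rightarrow> real" where
  "A2 F v w = av (av (\<lambda>v'. F v' w)) v"

definition B2 :: "(int \<times> nat \<Rightarrow> int \<times> nat \<Rightarrow> real) \<Rightarrow> int \<times> nat \<Rightarrow> int \<times> nat \<Rightarrow> real" where
  "B2 F v w = av (av (F v)) w"

lemma A2_B2_commute: "A2 (B2 F) = B2 (A2 F)"
proof -
  define t1 t2 where "t1 F = (\<lambda>v w. av (\<lambda>v'. F v' w) v)" and "t2 F = (\<lambda>v w. av (F v) w)"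
    for F :: "int \<times> nat \<Rightarrow> int \<times> nat \<Rightarrow> real"
  have swap: "t1 (t2 F) = t2 (t1 F)" for F
    unfolding t1_def t2_def by (intro ext av_swap)
  have "A2 F = t1 (t1 F)" "B2 F = t2 (t2 F)" for F
    by (intro ext, simp add: A2_def B2_def t1_def t2_def)+
  then show ?thesis using swap by simp
qed

lemma avp_avp_eq: "avp (avp F) = A2 (B2 F)"
proof (intro ext)
  fix v w
  have "avp (avp F) v w = av (\<lambda>v'. av (\<lambda>w'. av (\<lambda>v''. av (F v'') w') v') w) v"
    by (simp add: avp_def [abs_def])
  also have "\<dots> = av (\<lambda>v'. av (\<lambda>v''. av (\<lambda>w'. av (F v'') w') w) v') v"
    by (intro av_cong av_swap)
  finally show "avp (avp F) v w = A2 (B2 F) v w" by (simp add: A2_def B2_def)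
qed

lemma A2_diff: "A2 (\<lambda>v w. F v w - G v w) v w = A2 F v w - A2 G v w"
  by (simp add: A2_def av_diff_fun)

lemma B2_diff: "B2 (\<lambda>v w. F v w - G v w) v w = B2 F v w - B2 G v w"
  by (simp add: B2_def av_diff_fun)

lemma A2_mono:
  assumes "v \<in> verts" "\<And>v'. v' \<in> verts \<Longrightarrow> F v' w \<le> G v' w"
  shows "A2 F v w \<le> A2 G v w"
  unfolding A2_def using assms nb_verts by (intro av_mono) blast

lemma B2_mono:
  assumes "w \<in> verts" "\<And>w'. w' \<in> verts \<Longrightarrow> F v w' \<le> G v w'"
  shows "B2 F v w \<le> B2 G v w"
  unfolding B2_def using assms nb_verts by (intro av_mono) blast

lemma A2_ge:
  assumes v: "v \<in> verts" and F: "\<And>v'. v' \<in> verts \<Longrightarrow> 0 \<le> F v' w"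
  shows "F v w / 9 \<le> A2 F v w"
proof -
  have one: "\<phi> y / 3 \<le> av \<phi> v"
    if y: "y \<in> nb v" and \<phi>: "\<And>y. y \<in> nb v \<Longrightarrow> 0 \<le> \<phi> y" for \<phi> v y
  proof -
    have "\<phi> y / 3 \<le> \<phi> y / deg v"
      using deg_le_3 [of v] \<phi> [OF y] by (intro divide_left_mono) (auto simp: card_gt_0_iff)
    also have "\<dots> \<le> av \<phi> v"
      unfolding av_def using y \<phi> by (intro divide_right_mono member_le_sum) auto
    finally show ?thesis .
  qed
  obtain y where y: "y \<in> nb v" using nb_nonempty by blast
  have yV: "y \<in> verts" using nb_verts v y by blast
  have nn: "0 \<le> av (\<lambda>v'. F v' w) y" if "y \<in> nb v" for y
    using nb_verts [OF v that] nb_verts F by (intro av_nonneg) blast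
  have "F v w / 3 \<le> av (\<lambda>v'. F v' w) y"
    using yV nb_sym [OF v y] nb_verts F by (intro one) auto
  moreover have "av (\<lambda>v'. F v' w) y / 3 \<le> A2 F v w"
    unfolding A2_def using nn by (intro one y) auto
  ultimately show ?thesis by linarith
qed

text \<open>
  A Choquet--Deny argument: where \<open>D = H - A2 H\<close> nearly attains its supremum, so do its averages
  under any composition of few single-walk steps, because the pair step dominates a multiple of
  the identity; summing the telescoping series then contradicts the boundedness of \<open>H\<close>.
\<close>

lemma avp_harmonic_le_A2:
  assumes H: "\<And>v w. 0 \<le> H v w" "\<And>v w. H v w \<le> 1" and inv: "avp H = H"
    and vw: "v0 \<in> verts" "w0 \<in> verts"
  shows "H v0 w0 \<le> A2 H v0 w0"
proof (rule ccontr)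
  assume contra: "\<not> H v0 w0 \<le> A2 H v0 w0"
  define D where "D v w = H v w - A2 H v w" for v w
  define S where "S = {D v w |v w. v \<in> verts \<and> w \<in> verts}"
  define M where "M = Sup S"
  have AB_H: "A2 (B2 H) = H" using inv avp_avp_eq by metis
  have A2H0: "0 \<le> A2 H v w" for v w
    unfolding A2_def by (intro av_nonneg H)
  have "D v w \<le> 1" for v w using H(2) [of v w] A2H0 [of v w] by (simp add: D_def)
  then have bdd: "bdd_above S" unfolding S_def bdd_above_def by blast
  have DM: "D v w \<le> M" if "v \<in> verts" "w \<in> verts" for v w
    unfolding M_def S_def using that by (intro cSup_upper bdd [unfolded S_def]) blast
  have M0: "0 < M" using DM [OF vw] contra by (simp add: D_def)
  have A2_fun_diff: "A2 (\<lambda>v w. F v w - G v w) = (\<lambda>v w. A2 F v w - A2 G v w)" for F G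
    by (intro ext A2_diff)
  have B2_fun_diff: "B2 (\<lambda>v w. F v w - G v w) = (\<lambda>v w. B2 F v w - B2 G v w)" for F G
    by (intro ext B2_diff)
  have D_fun: "D = (\<lambda>v w. H v w - A2 H v w)" by (simp add: D_def fun_eq_iff)
  have AB_D: "A2 (B2 D) = D"
    unfolding D_fun B2_fun_diff A2_fun_diff using AB_H A2_B2_commute by metis
  define G where "G v w = M - D v w" for v w
  have const: "A2 (\<lambda>_ _. c) = (\<lambda>_ _. c)" "B2 (\<lambda>_ _. c) = (\<lambda>_ _. c)" for c
    by (intro ext, simp add: A2_def B2_def av_const_fun)+
  have G0: "0 \<le> G v w" if "v \<in> verts" "w \<in> verts" for v w using DM [OF that] by (simp add: G_def)
  have G_fun: "G = (\<lambda>v w. M - D v w)" by (simp add: G_def fun_eq_iff)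
  have Apow_comm: "(A2 ^^ i) (B2 F) = B2 ((A2 ^^ i) F)" for i F
    by (induction i) (simp_all add: A2_B2_commute)
  have ABpow_nonneg: "0 \<le> (A2 ^^ i) ((B2 ^^ n) G) v w" if "v \<in> verts" "w \<in> verts" for i n v w
    using that
  proof (induction i arbitrary: v)
    case 0
    then show ?case
    proof (induction n arbitrary: w)
      case (Suc n)
      then show ?case using B2_mono [of w "\<lambda>_ _. 0" v "(B2 ^^ n) G"] by (simp add: const)
    qed (simp add: G0)
  next
    case (Suc i)
    then show ?case using A2_mono [of v "\<lambda>_ _. 0" w "(A2 ^^ i) ((B2 ^^ n) G)"] by (simp add: const)
  qed
  have AB_G: "A2 (B2 G) = G"
    unfolding G_fun B2_fun_diff A2_fun_diff const AB_D ..
  have AB_pow: "(A2 ^^ n) ((B2 ^^ n) G) = G" for n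
  proof (induction n)
    case (Suc n)
    have "(A2 ^^ Suc n) ((B2 ^^ Suc n) G) = A2 (B2 ((A2 ^^ n) ((B2 ^^ n) G)))"
      by (simp add: Apow_comm)
    then show ?case using Suc AB_G by simp
  qed simp
  \<comment> \<open>\<open>AB_pow\<close> recovers \<open>G\<close> only when the powers of
    \<open>A2\<close> and \<open>B2\<close> agree. A smaller power of \<open>A2\<close> is raised to
    the required one at the price of a factor 9 per application.\<close>
  have low: "(A2 ^^ i) ((B2 ^^ n) G) v w \<le> 9 ^ j * (A2 ^^ (i + j)) ((B2 ^^ n) G) v w"
    if "v \<in> verts" "w \<in> verts" for i j n v w
  proof (induction j)
    case (Suc j)
    have "(A2 ^^ (i + j)) ((B2 ^^ n) G) v w / 9 \<le> A2 ((A2 ^^ (i + j)) ((B2 ^^ n) G)) v w"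
      by (rule A2_ge [OF that(1)]) (rule ABpow_nonneg [OF _ that(2)])
    then have "9 ^ j * (A2 ^^ (i + j)) ((B2 ^^ n) G) v w \<le> 9 ^ j * (9 * (A2 ^^ (i + Suc j)) ((B2 ^^ n) G) v w)"
      by (intro mult_left_mono) auto
    from order.trans [OF Suc this] show ?case by simp
  qed simp
  have tele: "(\<Sum>i<n. (A2 ^^ i) D v w) = H v w - (A2 ^^ n) H v w" for n v w
  proof (induction n)
    case (Suc n)
    have "(A2 ^^ n) D v w = (A2 ^^ n) H v w - (A2 ^^ Suc n) H v w" for v w
    proof -
      have "(A2 ^^ n) (\<lambda>v w. F v w - G v w) = (\<lambda>v w. (A2 ^^ n) F v w - (A2 ^^ n) G v w)" for F G
        by (induction n) (simp_all add: A2_fun_diff)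
      then show ?thesis unfolding D_fun by (simp add: funpow_swap1)
    qed
    with Suc show ?case by simp
  qed simp
  have Bn_le: "(B2 ^^ n) F v w \<le> 1" if "\<And>v w. F v w \<le> 1" for n F v w
  proof (induction n arbitrary: w)
    case (Suc n)
    then show ?case unfolding funpow.simps o_def B2_def
      by (intro av_le_const) 
  qed (simp add: that)
  have "real n * (M / 2) \<le> 1" for n
  proof -
    have "S \<noteq> {}" using vw unfolding S_def by blast
    \<comment> \<open>The deficit is chosen so that after at most \<open>n\<close> losses of a
      factor 9 it is still at most \<open>M / 2\<close>.\<close>
    moreover have "M - M / (2 * 9 ^ n) < Sup S" using M0 by (simp add: M_def [symmetric])
    ultimately have "\<exists>y\<in>S. M - M / (2 * 9 ^ n) < y" using less_cSupD by blast
    then obtain v w where y: "v \<in> verts" "w \<in> verts" "M - M / (2 * 9 ^ n) < D v w"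
      unfolding S_def by blast
    have key: "M / 2 \<le> (A2 ^^ i) ((B2 ^^ n) D) v w" if "i < n" for i
    proof -
      have pow_diff: "(A2 ^^ i) ((B2 ^^ n) (\<lambda>v w. F v w - G v w)) =
          (\<lambda>v w. (A2 ^^ i) ((B2 ^^ n) F) v w - (A2 ^^ i) ((B2 ^^ n) G) v w)" for F G
      proof -
        have "(B2 ^^ n) (\<lambda>v w. F v w - G v w) = (\<lambda>v w. (B2 ^^ n) F v w - (B2 ^^ n) G v w)"
          by (induction n) (simp_all add: B2_fun_diff)
        moreover have "(A2 ^^ i) (\<lambda>v w. F v w - G v w) = (\<lambda>v w. (A2 ^^ i) F v w - (A2 ^^ i) G v w)" for F G
          by (induction i) (simp_all add: A2_fun_diff)
        ultimately show ?thesis by simp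
      qed
      have pow_const: "(A2 ^^ i) ((B2 ^^ n) (\<lambda>_ _. M)) = (\<lambda>_ _. M)"
      proof -
        have "(B2 ^^ n) (\<lambda>_ _. M) = (\<lambda>_ _. M)" by (induction n) (simp_all add: const)
        moreover have "(A2 ^^ i) (\<lambda>_ _. M) = (\<lambda>_ _. M)" by (induction i) (simp_all add: const)
        ultimately show ?thesis by simp
      qed
      have "(A2 ^^ i) ((B2 ^^ n) G) v w \<le> 9 ^ (n - i) * (A2 ^^ (i + (n - i))) ((B2 ^^ n) G) v w"
        by (rule low [OF y(1,2)])
      also have "\<dots> = 9 ^ (n - i) * G v w" using that AB_pow by simp
      also have "\<dots> \<le> 9 ^ n * G v w"
        using G0 [OF y(1,2)] by (intro mult_right_mono power_increasing) auto
      also have "\<dots> \<le> 9 ^ n * (M / (2 * 9 ^ n))"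
        using y by (intro mult_left_mono) (auto simp: G_def)
      also have "\<dots> = M / 2" by simp
      finally have "(A2 ^^ i) ((B2 ^^ n) G) v w \<le> M / 2" .
      then show ?thesis unfolding G_fun pow_diff pow_const by simp
    qed
    have Asum: "(\<Sum>i<n. (A2 ^^ i) ((B2 ^^ k) D) v w) =
        (B2 ^^ k) (\<lambda>v w. \<Sum>i<n. (A2 ^^ i) D v w) v w" for k v w
    proof -
      have comm: "(A2 ^^ i) ((B2 ^^ k) F) = (B2 ^^ k) ((A2 ^^ i) F)" for i F
        by (induction k arbitrary: F) (simp_all add: Apow_comm)
      have "(B2 ^^ k) (\<lambda>v w. \<Sum>i<n. F i v w) = (\<lambda>v w. \<Sum>i<n. (B2 ^^ k) (F i) v w)" for F :: "nat \<Rightarrow> _"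
        by (induction k) (simp_all add: B2_def [abs_def] av_sum_fun)
      then show ?thesis by (simp add: comm)
    qed
    have "real n * (M / 2) = (\<Sum>i<n. M / 2)" by simp
    also have "\<dots> \<le> (\<Sum>i<n. (A2 ^^ i) ((B2 ^^ n) D) v w)"
      by (intro sum_mono key) auto
    \<comment> \<open>The \<open>n\<close> terms, each at least \<open>M / 2\<close>, telescope to a
      \<open>B2\<close>-average of \<open>H - (A2 ^^ n) H\<close>, which never exceeds 1. As
      \<open>n\<close> is arbitrary, this is incompatible with \<open>0 < M\<close>.\<close>
    also have "\<dots> = (B2 ^^ n) (\<lambda>v w. H v w - (A2 ^^ n) H v w) v w"
      unfolding Asum tele ..
    also have "\<dots> \<le> 1"
    proof (rule Bn_le)
      fix v w
      have "0 \<le> (A2 ^^ n) H v w"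
      proof (induction n arbitrary: v)
        case (Suc n)
        then show ?case unfolding funpow.simps o_def A2_def by (intro av_nonneg)
      qed (simp add: H)
      then show "H v w - (A2 ^^ n) H v w \<le> 1" using H(2) [of v w] by linarith
    qed
    finally show ?thesis .
  qed
  moreover obtain n :: nat where "2 / M < n" using reals_Archimedean2 by blast
  ultimately show False using M0 by (auto simp: field_simps not_le [symmetric])
qed

text \<open>\<open>avp_harmonic_le_A2\<close> for \<open>H\<close> and for \<open>1 - H\<close>
  shows that \<open>H\<close> is invariant under two steps of the first walk alone, and by symmetry
  of the second. The Liouville property of a single walk then settles each coordinate up to
  parity.\<close>

lemma avp_harmonic_const:
  assumes H: "\<And>v w. 0 \<le> H v w" "\<And>v w. H v w \<le> 1" and inv: "avp H = H"
    and vw: "v \<in> verts" "w \<in> verts" "v' \<in> verts" "w' \<in> verts" "par v = par v'" "par w = par w'"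
  shows "H v w = H v' w'"
proof -
  have harm: "A2 F v w = F v w"
    if F: "\<And>v w. 0 \<le> F v w" "\<And>v w. F v w \<le> 1" "avp F = F" and vw: "v \<in> verts" "w \<in> verts" for F v w
  proof -
    have "F v w \<le> A2 F v w" by (rule avp_harmonic_le_A2 [OF F vw])
    moreover have "1 - F v w \<le> A2 (\<lambda>v w. 1 - F v w) v w"
    proof (rule avp_harmonic_le_A2 [OF _ _ _ vw])
      show "avp (\<lambda>v w. 1 - F v w) = (\<lambda>v w. 1 - F v w)"
        by (intro ext) (simp add: avp_diff F(3))
    qed (auto simp: F)
    moreover have "A2 (\<lambda>v w. 1 - F v w) v w = 1 - A2 F v w"
      unfolding A2_diff by (simp add: A2_def av_const_fun)
    ultimately show ?thesis by linarith
  qed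
  have bd: "\<bar>H v w\<bar> \<le> 1" for v w using H [of v w] by auto
  have "H v w = H v' w"
    by (rule two_step_harmonic_const [of "\<lambda>v. H v w" 1])
      (use harm [OF H inv] vw bd in \<open>auto simp: A2_def\<close>)
  moreover have inv': "avp (\<lambda>v w. H w v) = (\<lambda>v w. H w v)"
  proof (intro ext)
    fix v w
    have "avp (\<lambda>v w. H w v) v w = avp H w v" unfolding avp_def by (rule av_swap)
    then show "avp (\<lambda>v w. H w v) v w = H w v" by (simp add: inv)
  qed
  have "H v' w = H v' w'"
    by (rule two_step_harmonic_const [of "\<lambda>w. H v' w" 1])
      (use harm [OF _ _ inv', of _ v'] H vw bd in \<open>auto simp: A2_def\<close>)
  ultimately show ?thesis by simp
qed

subsection \<open>A zero-one law\<close>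

lemma avp_const_fun: "avp (\<lambda>_ _. c) = (\<lambda>_ _. c)"
  by (intro ext) simp

lemma avp_diff_fun: "avp (\<lambda>v w. F v w - G v w) = (\<lambda>v w. avp F v w - avp G v w)"
  by (intro ext avp_diff)

lemma avp_cmult_fun: "avp (\<lambda>v w. c * F v w) = (\<lambda>v w. c * avp F v w)"
  by (intro ext avp_cmult)

text \<open>The probability of a meeting at one of the times \<open>0, ..., M - 1\<close>; the
  recursion stops at the first meeting.\<close>

primrec col :: "nat \<Rightarrow> int \<times> nat \<Rightarrow> int \<times> nat \<Rightarrow> real" where
  "col 0 = (\<lambda>v w. 0)"
| "col (Suc M) = (\<lambda>v w. if v = w then 1 else avp (col M) v w)"

lemma col_bounds: "0 \<le> col M v w \<and> col M v w \<le> 1"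
  by (induction M arbitrary: v w) (auto intro: avp_nonneg avp_le_const)

lemma col_Suc_mono: "col M v w \<le> col (Suc M) v w"
proof (induction M arbitrary: v w)
  case (Suc M)
  then show ?case by (auto simp del: col.simps(1) intro!: avp_mono simp: col.simps(2))
qed (use col_bounds [of 1] in simp)

definition colinf :: "int \<times> nat \<Rightarrow> int \<times> nat \<Rightarrow> real" where
  "colinf v w = (SUP M. col M v w)"

lemma av_tendsto:
  "(\<And>w. w \<in> nb v \<Longrightarrow> (\<lambda>n. \<phi> n w) \<longlonglongrightarrow> \<psi> w) \<Longrightarrow> (\<lambda>n. av (\<phi> n) v) \<longlonglongrightarrow> av \<psi> v"
  unfolding av_def by (intro tendsto_intros) auto

lemma avp_tendsto:
  "(\<And>v w. (\<lambda>n. F n v w) \<longlonglongrightarrow> G v w) \<Longrightarrow> (\<lambda>n. avp (F n) v w) \<longlonglongrightarrow> avp G v w"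
  unfolding avp_def by (intro av_tendsto)

lemma avp_pow_tendsto:
  "(\<And>v w. (\<lambda>n. F n v w) \<longlonglongrightarrow> G v w) \<Longrightarrow> (\<lambda>n. (avp ^^ N) (F n) v w) \<longlonglongrightarrow> (avp ^^ N) G v w"
  by (induction N arbitrary: v w) (auto intro: avp_tendsto)

lemma avp_pow_mono:
  "(\<And>v w. F v w \<le> G v w) \<Longrightarrow> (avp ^^ N) F v w \<le> (avp ^^ N) G v w"
  by (induction N arbitrary: v w) (auto intro: avp_mono)

lemma col_tendsto: "(\<lambda>M. col M v w) \<longlonglongrightarrow> colinf v w"
  unfolding colinf_def
  by (intro LIMSEQ_incseq_SUP) (auto simp: bdd_above_def incseq_Suc_iff col_Suc_mono
      simp del: col.simps intro: exI [of _ 1] conjunct2 [OF col_bounds])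

lemma col_le_colinf: "col M v w \<le> colinf v w"
  unfolding colinf_def using col_bounds
  by (intro cSUP_upper UNIV_I) (unfold bdd_above_def, blast)

lemma colinf_bounds: "0 \<le> colinf v w" "colinf v w \<le> 1"
  using col_tendsto [of v w] col_bounds by (meson LIMSEQ_le_const LIMSEQ_le_const2)+

lemma colinf_eq: "colinf v w = (if v = w then 1 else avp colinf v w)"
proof -
  have "(\<lambda>M. col (Suc M) v w) \<longlonglongrightarrow> (if v = w then 1 else avp colinf v w)"
    by (auto intro: avp_tendsto col_tendsto)
  moreover have "(\<lambda>M. col (Suc M) v w) \<longlonglongrightarrow> colinf v w"
    by (rule LIMSEQ_Suc [OF col_tendsto])
  ultimately show ?thesis using LIMSEQ_unique by blast
qed

lemma tail_bounds: "0 \<le> (avp ^^ N) colinf v w \<and> (avp ^^ N) colinf v w \<le> 1"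
  by (induction N arbitrary: v w) (auto simp: colinf_bounds intro!: avp_nonneg avp_le_const)

lemma tail_Suc_le: "(avp ^^ Suc N) colinf v w \<le> (avp ^^ N) colinf v w"
proof -
  have "avp colinf v w \<le> colinf v w" for v w
    using colinf_eq [of v w] avp_le_const [of v w colinf 1] colinf_bounds by auto
  then have "(avp ^^ N) (avp colinf) v w \<le> (avp ^^ N) colinf v w"
    by (rule avp_pow_mono)
  then show ?thesis by (simp add: funpow_swap1)
qed

text \<open>The probability of infinitely many collisions: \<open>(avp ^^ N) colinf\<close> is that
  of a collision at time \<open>N\<close> or later, and it decreases in \<open>N\<close>.\<close>

definition hinf :: "int \<times> nat \<Rightarrow> int \<times> nat \<Rightarrow> real" where
  "hinf v w = (INF N. (avp ^^ N) colinf v w)"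

lemma hinf_tendsto: "(\<lambda>N. (avp ^^ N) colinf v w) \<longlonglongrightarrow> hinf v w"
  unfolding hinf_def
  by (intro LIMSEQ_decseq_INF) (auto simp: bdd_below_def decseq_Suc_iff
      simp del: funpow.simps intro!: exI [of _ 0] conjunct1 [OF tail_bounds] tail_Suc_le)

lemma hinf_bounds: "0 \<le> hinf v w" "hinf v w \<le> 1"
  using hinf_tendsto [of v w] tail_bounds by (meson LIMSEQ_le_const LIMSEQ_le_const2)+

lemma hinf_harmonic: "avp hinf = hinf"
proof (intro ext)
  fix v w
  have "(\<lambda>N. (avp ^^ Suc N) colinf v w) \<longlonglongrightarrow> avp hinf v w"
    by (auto intro: avp_tendsto hinf_tendsto)
  moreover have "(\<lambda>N. (avp ^^ Suc N) colinf v w) \<longlonglongrightarrow> hinf v w"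
    by (rule LIMSEQ_Suc [OF hinf_tendsto])
  ultimately show "avp hinf v w = hinf v w" using LIMSEQ_unique by blast
qed

lemma hinf_le_colinf: "hinf v w \<le> colinf v w"
proof -
  have "hinf v w \<le> (avp ^^ 0) colinf v w"
    unfolding hinf_def using tail_bounds
    by (intro cINF_lower UNIV_I) (unfold bdd_below_def, blast)
  then show ?thesis by simp
qed

text \<open>\<open>avp_harmonic_const\<close> gives one constant for two even starting points and
  one for two odd ones. A single pair step from the origin leads from the even class to the odd one
  and identifies the constants.\<close>

lemma hinf_const:
  assumes "v \<in> verts" "w \<in> verts" "par v = par w"
  shows "hinf v w = hinf (0, 0) (0, 0)"
proof (cases "par v")
  case True
  then show ?thesis
    using assms by (intro avp_harmonic_const hinf_bounds hinf_harmonic) (auto simp: verts_def par_def)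
next
  case False
  have odd: "hinf v w = hinf (1, 0) (1, 0)"
    if "v \<in> verts" "w \<in> verts" "\<not> par v" "\<not> par w" for v w
    using that by (intro avp_harmonic_const hinf_bounds hinf_harmonic) (auto simp: verts_def par_def)
  have o: "(0, 0) \<in> verts" "par (0, 0)" by (auto simp: verts_def par_def)
  have "hinf (0, 0) (0, 0) = avp hinf (0, 0) (0, 0)" by (simp add: hinf_harmonic)
  also have "\<dots> = avp (\<lambda>_ _. hinf (1, 0) (1, 0)) (0, 0) (0, 0)"
    using nb_verts [OF o(1)] par_nb [of _ "(0, 0)"] o by (intro avp_cong odd) auto
  finally show ?thesis using odd [of v w] assms False by simp
qed

text \<open>
  The zero-one law for the event of infinitely many collisions: the probability \<open>c\<close> of this event
  does not depend on the starting points, so avoiding collisions for \<open>M\<close> steps and then having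
  only finitely many of them costs a factor \<open>1 - c\<close>; letting \<open>M\<close> tend to infinity forces
  collisions to be avoidable with probability \<open>0\<close> unless \<open>c = 0\<close>.
\<close>

lemma zero_one_law:
  assumes pos: "0 < hinf (0, 0) (0, 0)"
  shows "(avp ^^ N) colinf (0, 0) (0, 0) = 1"
proof -
  define c where "c = hinf (0, 0) (0, 0)"
  have le: "1 - colinf v w \<le> (1 - c) * (1 - col M v w)"
    if "v \<in> verts" "w \<in> verts" "par v = par w" for M v w
    using that
  proof (induction M arbitrary: v w)
    case 0
    then show ?case using hinf_le_colinf [of v w] hinf_const [of v w] by (simp add: c_def)
  next
    case (Suc M)
    show ?case
    proof (cases "v = w")
      case True
      then show ?thesis using colinf_eq [of v w] by simp
    next
      case False
      have "1 - colinf v w = avp (\<lambda>v w. 1 - colinf v w) v w"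
        using False colinf_eq [of v w] by (simp add: avp_diff)
      also have "\<dots> \<le> avp (\<lambda>v w. (1 - c) * (1 - col M v w)) v w"
        using Suc.prems nb_verts par_nb by (intro avp_mono Suc.IH) blast+
      also have "\<dots> = (1 - c) * (1 - col (Suc M) v w)"
        using False by (simp add: avp_cmult avp_diff)
      finally show ?thesis .
    qed
  qed
  have one: "colinf v w = 1" if "v \<in> verts" "w \<in> verts" "par v = par w" for v w
  proof -
    have "1 - colinf v w \<le> (1 - c) * (1 - colinf v w)"
    proof (rule LIMSEQ_le_const)
      show "(\<lambda>M. (1 - c) * (1 - col M v w)) \<longlonglongrightarrow> (1 - c) * (1 - colinf v w)"
        by (intro tendsto_intros col_tendsto)
    qed (use le [OF that] in blast)
    then have "c * (1 - colinf v w) \<le> 0" by (simp add: algebra_simps)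
    then have "1 - colinf v w \<le> 0" using pos by (simp add: c_def mult_le_0_iff)
    then show ?thesis using colinf_bounds(2) [of v w] by simp
  qed
  have "(avp ^^ N) colinf v w = 1" if "v \<in> verts" "w \<in> verts" "par v = par w" for v w
    using that
  proof (induction N arbitrary: v w)
    case (Suc N)
    have "(avp ^^ Suc N) colinf v w = avp (\<lambda>_ _. 1) v w"
      unfolding funpow.simps o_def
      using Suc.prems nb_verts par_nb by (intro avp_cong Suc.IH) blast+
    then show ?case by simp
  qed (simp add: one)
  then show ?thesis by (simp add: verts_def)
qed

subsection \<open>Expectations over finite paths of the pair walk\<close>

text \<open>The mean of a functional of the list of the \<open>n + 1\<close> pairs visited at times
  \<open>0, ..., n\<close>. The recursion on the first step stays within the calculus of
  \<open>avp\<close>; path measures enter only when the result is transferred.\<close>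

primrec pexp :: "nat \<Rightarrow> (((int \<times> nat) \<times> (int \<times> nat)) list \<Rightarrow> real) \<Rightarrow> int \<times> nat \<Rightarrow> int \<times> nat \<Rightarrow> real" where
  "pexp 0 F = (\<lambda>v w. F [(v, w)])"
| "pexp (Suc n) F = (\<lambda>v w. avp (pexp n (\<lambda>xs. F ((v, w) # xs))) v w)"

lemma pexp_mono: "(\<And>xs. F xs \<le> G xs) \<Longrightarrow> pexp n F v w \<le> pexp n G v w"
  by (induction n arbitrary: F G v w) (auto intro: avp_mono)

lemma pexp_const [simp]: "pexp n (\<lambda>_. c) = (\<lambda>_ _. c)"
  by (induction n) (auto intro!: ext)

lemma pexp_add: "pexp n (\<lambda>xs. F xs + G xs) v w = pexp n F v w + pexp n G v w"
proof (induction n arbitrary: F G v w)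
  case (Suc n)
  have "pexp n (\<lambda>xs. F xs + G xs) = (\<lambda>v w. pexp n F v w + pexp n G v w)" for F G
    by (intro ext Suc)
  then show ?case by (simp add: avp_add)
qed simp

lemma pexp_cmult: "pexp n (\<lambda>xs. c * F xs) v w = c * pexp n F v w"
proof (induction n arbitrary: F v w)
  case (Suc n)
  have "pexp n (\<lambda>xs. c * F xs) = (\<lambda>v w. c * pexp n F v w)" for F
    by (intro ext Suc)
  then show ?case by (simp add: avp_cmult)
qed simp

definition hit :: "nat \<Rightarrow> ('a \<times> 'a) list \<Rightarrow> bool" where
  "hit N xs \<longleftrightarrow> (\<exists>q\<in>set (drop N xs). fst q = snd q)"

text \<open>The times from \<open>N\<close> to \<open>n\<close> are \<open>Suc n - N\<close> in
  number. For \<open>N > n\<close> the truncated subtraction leaves \<open>col 0\<close>, and both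
  sides are 0.\<close>

lemma pexp_hit: "pexp n (\<lambda>xs. of_bool (hit N xs)) v w = (avp ^^ N) (col (Suc n - N)) v w"
proof (induction n arbitrary: N v w)
  case 0
  have "(avp ^^ N) (\<lambda>_ _. 0) = (\<lambda>_ _. 0)" for N
    by (induction N) (simp_all add: avp_const_fun)
  then show ?case by (cases N) (simp_all add: hit_def)
next
  case (Suc n)
  show ?case
  proof (cases N)
    case 0
    have *: "pexp n (\<lambda>xs. of_bool (hit 0 xs)) = col (Suc n)"
      using Suc [of 0] by (intro ext) simp
    show ?thesis
    proof (cases "v = w")
      case True
      then have "(\<lambda>xs. of_bool (hit 0 ((v, w) # xs)) :: real) = (\<lambda>_. 1)"
        by (auto simp: hit_def)
      then show ?thesis using True 0 by (simp add: avp_def del: col.simps) simp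
    next
      case False
      then have "(\<lambda>xs. of_bool (hit 0 ((v, w) # xs)) :: real) = (\<lambda>xs. of_bool (hit 0 xs))"
        by (auto simp: hit_def)
      then show ?thesis using False 0 * by simp
    qed
  next
    case (Suc N')
    have "pexp n (\<lambda>xs. of_bool (hit N' xs)) = (avp ^^ N') (col (Suc n - N'))"
      by (intro ext Suc.IH)
    moreover have "(\<lambda>xs. of_bool (hit N ((v, w) # xs)) :: real) = (\<lambda>xs. of_bool (hit N' xs))"
      by (simp add: hit_def Suc)
    ultimately show ?thesis using Suc by simp
  qed
qed

section \<open>First and second moments of the weighted collision count\<close>

primrec wcol :: "('a \<Rightarrow> real) \<Rightarrow> real \<Rightarrow> ('a \<times> 'a) list \<Rightarrow> real" where
  "wcol f s [] = 0"
| "wcol f s (q # xs) = (if fst q = snd q then f (fst q) else 0) + s\<^sup>2 * wcol f s xs"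

lemma wcol_nonneg: "(\<And>v. 0 \<le> f v) \<Longrightarrow> 0 \<le> wcol f s xs"
  by (induction xs) auto

lemma wcol_le_if_not_hit:
  assumes f: "\<And>v. 0 \<le> f v" "\<And>v. f v \<le> 1" and s: "0 \<le> s" "s \<le> 1" and "\<not> hit N xs"
  shows "wcol f s xs \<le> real N"
  using assms(5)
proof (induction xs arbitrary: N)
  case (Cons q xs)
  have s2: "s\<^sup>2 * wcol f s xs \<le> 1 * wcol f s xs"
    using s by (intro mult_right_mono wcol_nonneg f) (simp add: power_le_one)
  show ?case
  proof (cases N)
    case 0
    then have "fst q \<noteq> snd q" "\<not> hit 0 xs" using Cons.prems by (auto simp: hit_def)
    then show ?thesis using Cons.IH [of 0] s2 0 by simp
  next
    case (Suc N')
    then have "\<not> hit N' xs" using Cons.prems by (simp add: hit_def)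
    then have "wcol f s xs \<le> N'" by (rule Cons.IH)
    then show ?thesis using s2 f(2) [of "fst q"] Suc by auto
  qed
qed simp

lemma pexp_wcol: "pexp n (wcol f s) = Psi f s (Suc n)"
proof (induction n)
  case 0
  show ?case by (auto intro!: ext simp: avp_def av_const_fun)
next
  case (Suc n)
  show ?case
  proof (intro ext)
    fix v w
    have "(\<lambda>xs. wcol f s ((v, w) # xs)) = (\<lambda>xs. (if v = w then f v else 0) + s\<^sup>2 * wcol f s xs)"
      by (intro ext) simp
    then have "pexp n (\<lambda>xs. wcol f s ((v, w) # xs)) =
        (\<lambda>v' w'. (if v = w then f v else 0) + s\<^sup>2 * Psi f s (Suc n) v' w')"
      by (simp add: pexp_add pexp_cmult Suc fun_eq_iff del: Psi.simps)
    then show "pexp (Suc n) (wcol f s) v w = Psi f s (Suc (Suc n)) v w"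
      unfolding pexp.simps(2) Psi.simps(2) [of f s "Suc n"]
      by (simp only: avp_add avp_cmult avp_const)
  qed
qed

text \<open>Expand the square at time 0. The cross term carries a factor that vanishes off the
  diagonal, and on the diagonal it multiplies a value of \<open>Psi\<close> from a common starting
  point, at most \<kappa>. So only diagonal bounds on \<open>Psi\<close> are needed, and the second
  moment is at most \<open>2 * \<kappa>\<close> times the first.\<close>

lemma pexp_wcol_square:
  assumes f: "\<And>v. 0 \<le> f v" and s: "0 \<le> s" "s \<le> 1"
    and \<kappa>: "\<And>N v. v \<in> verts \<Longrightarrow> Psi f s N v v \<le> \<kappa>" and vw: "v \<in> verts" "w \<in> verts"
  shows "pexp n (\<lambda>xs. (wcol f s xs)\<^sup>2) v w \<le> 2 * \<kappa> * Psi f s (Suc n) v w"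
  using vw
proof (induction n arbitrary: v w)
  case 0
  have \<kappa>0: "0 \<le> \<kappa>" using \<kappa> [of v 0] 0 by simp
  have "Psi f s (Suc 0) v v = f v" by (simp add: avp_def av_const_fun)
  then have "f v \<le> \<kappa>" using \<kappa> [of v "Suc 0"] 0 by simp
  then have "f v * f v \<le> (2 * \<kappa>) * f v" using f [of v] \<kappa>0 by (intro mult_right_mono) auto
  then show ?case by (auto simp: avp_const_fun power2_eq_square)
next
  case (Suc n)
  define g where "g = (if v = w then f v else 0)"
  define P where "P = Psi f s (Suc n)"
  have \<kappa>0: "0 \<le> \<kappa>" using \<kappa> [of v 0] Suc.prems by simp
  have g0: "0 \<le> g" using f by (simp add: g_def)
  have s2: "s\<^sup>2 \<le> 1" using s by (simp add: power_le_one)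
  have P0: "0 \<le> P v w" for v w unfolding P_def by (rule Psi_nonneg [OF f])
  have next_P: "Psi f s (Suc (Suc n)) v w = g + s\<^sup>2 * avp P v w"
    unfolding Psi.simps(2) [of f s "Suc n"] P_def g_def ..
  have gk: "g * (g + s\<^sup>2 * avp P v w) \<le> g * \<kappa>"
  proof (cases "v = w")
    case True
    then show ?thesis using \<kappa> [of v "Suc (Suc n)"] Suc.prems g0 next_P
      by (intro mult_left_mono) (simp_all del: Psi.simps)
  qed (simp add: g_def)
  have "(\<lambda>xs. (wcol f s ((v, w) # xs))\<^sup>2) =
      (\<lambda>xs. g\<^sup>2 + (2 * g * s\<^sup>2 * wcol f s xs + (s\<^sup>2)\<^sup>2 * (wcol f s xs)\<^sup>2))"
    by (intro ext) (simp add: g_def power2_sum power_mult_distrib algebra_simps)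
  then have "pexp (Suc n) (\<lambda>xs. (wcol f s xs)\<^sup>2) v w =
      avp (\<lambda>v' w'. g\<^sup>2 + (2 * g * s\<^sup>2 * P v' w' + (s\<^sup>2)\<^sup>2 * pexp n (\<lambda>xs. (wcol f s xs)\<^sup>2) v' w')) v w"
    by (simp add: pexp_add [abs_def] pexp_cmult [abs_def] pexp_wcol P_def fun_eq_iff del: Psi.simps)
  also have "\<dots> \<le> avp (\<lambda>v' w'. g\<^sup>2 + (2 * g * s\<^sup>2 * P v' w' + s\<^sup>2 * (2 * \<kappa> * P v' w'))) v w"
  proof (intro avp_mono add_left_mono)
    fix v' w' assume "v' \<in> nb v" "w' \<in> nb w"
    then have "v' \<in> verts" "w' \<in> verts" using Suc.prems nb_verts by blast+
    then have IH: "pexp n (\<lambda>xs. (wcol f s xs)\<^sup>2) v' w' \<le> 2 * \<kappa> * P v' w'"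
      unfolding P_def by (rule Suc.IH)
    have "(s\<^sup>2)\<^sup>2 * pexp n (\<lambda>xs. (wcol f s xs)\<^sup>2) v' w' \<le> (s\<^sup>2)\<^sup>2 * (2 * \<kappa> * P v' w')"
      by (intro mult_left_mono IH) simp
    also have "\<dots> \<le> s\<^sup>2 * (2 * \<kappa> * P v' w')"
      using \<kappa>0 P0 s2 by (intro mult_right_mono) (auto simp: power2_eq_square mult_left_le)
    finally show "(s\<^sup>2)\<^sup>2 * pexp n (\<lambda>xs. (wcol f s xs)\<^sup>2) v' w' \<le> s\<^sup>2 * (2 * \<kappa> * P v' w')" .
  qed
  also have "\<dots> = g\<^sup>2 + (2 * g * s\<^sup>2 * avp P v w + s\<^sup>2 * (2 * \<kappa> * avp P v w))"
    by (simp only: avp_add avp_cmult avp_const)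
  also have "\<dots> = 2 * (g * (g + s\<^sup>2 * avp P v w)) - g\<^sup>2 + 2 * \<kappa> * (s\<^sup>2 * avp P v w)"
    by (simp add: power2_eq_square algebra_simps)
  also have "\<dots> \<le> 2 * (g * \<kappa>) - 0 + 2 * \<kappa> * (s\<^sup>2 * avp P v w)"
    using gk zero_le_power2 [of g] by linarith
  also have "\<dots> = 2 * \<kappa> * Psi f s (Suc (Suc n)) v w"
    unfolding next_P by (simp add: algebra_simps)
  finally show ?case .
qed

text \<open>
  The second moment method. The quadratic polynomial in the proof is bounded by the indicator
  of a collision after time \<open>N\<close>, so no Cauchy--Schwarz inequality is needed.
\<close>

lemma hit_prob_ge:
  assumes f: "\<And>v. 0 \<le> f v" "\<And>v. f v \<le> 1" and s: "0 \<le> s" "s \<le> 1"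
    and \<kappa>: "\<And>N v. v \<in> verts \<Longrightarrow> Psi f s N v v \<le> C * Psi f s (Suc n) (0, 0) (0, 0)"
    and C: "0 < C" and big: "2 * real N < Psi f s (Suc n) (0, 0) (0, 0)"
  shows "1 / (8 * C) \<le> (avp ^^ N) (col (Suc n - N)) (0, 0) (0, 0)"
proof -
  define P where "P = Psi f s (Suc n) (0, 0) (0, 0)"
  have P: "0 < P" using big by (simp add: P_def)
  have o: "(0, 0) \<in> verts" by (simp add: verts_def)
  \<comment> \<open>Chosen so that \<open>\<alpha> * y - \<beta> * y\<^sup>2 = 1 - (y / (4 * C * P)
    - 1)\<^sup>2\<close>. Without a collision from time \<open>N\<close> on, the count is at most
    \<open>N < P / 2\<close>, and subtracting \<open>\<alpha> * (P / 2)\<close> makes the polynomial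
    nonpositive. Its mean is at least
    \<open>1 / (2 * C) - 1 / (8 * C) - 1 / (4 * C) = 1 / (8 * C)\<close>.\<close>
  define \<alpha> \<beta> where "\<alpha> = 1 / (2 * C) / P" and "\<beta> = 1 / (16 * C\<^sup>2) / P\<^sup>2"
  have \<alpha>: "0 < \<alpha>" and \<beta>: "0 < \<beta>" using P C by (auto simp: \<alpha>_def \<beta>_def)
  have pt: "\<alpha> * wcol f s xs + (- \<beta> * (wcol f s xs)\<^sup>2 + (- \<alpha> * (P / 2))) \<le> of_bool (hit N xs)" for xs
  proof (cases "hit N xs")
    case True
    let ?y = "wcol f s xs"
    have "0 \<le> (?y / (4 * C * P) - 1)\<^sup>2" by simp
    also have "\<dots> = \<beta> * ?y\<^sup>2 - \<alpha> * ?y + 1"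
      using P C by (simp add: \<alpha>_def \<beta>_def power2_eq_square field_simps)
    finally have "\<alpha> * ?y - \<beta> * ?y\<^sup>2 \<le> 1" by simp
    moreover have "0 \<le> \<alpha> * (P / 2)" using \<alpha> P by simp
    ultimately show ?thesis using True by simp
  next
    case False
    then have "wcol f s xs \<le> P / 2"
      using wcol_le_if_not_hit [of f s, OF f s False] big [folded P_def] by simp
    then have "\<alpha> * wcol f s xs \<le> \<alpha> * (P / 2)" using \<alpha> by (intro mult_left_mono) auto
    moreover have "0 \<le> \<beta> * (wcol f s xs)\<^sup>2" using \<beta> by simp
    ultimately show ?thesis using False by simp
  qed
  have "pexp n (\<lambda>xs. (wcol f s xs)\<^sup>2) (0, 0) (0, 0) \<le> 2 * (C * P) * P"
    using pexp_wcol_square [OF f(1) s \<kappa> o o] by (simp add: P_def)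
  then have "\<beta> * pexp n (\<lambda>xs. (wcol f s xs)\<^sup>2) (0, 0) (0, 0) \<le> \<beta> * (2 * (C * P) * P)"
    using \<beta> by (intro mult_left_mono) auto
  also have "\<dots> = 1 / (8 * C)" using P C by (simp add: \<beta>_def power2_eq_square)
  finally have sq: "\<beta> * pexp n (\<lambda>xs. (wcol f s xs)\<^sup>2) (0, 0) (0, 0) \<le> 1 / (8 * C)" .
  have "1 / (8 * C) = \<alpha> * P - 1 / (8 * C) - \<alpha> * (P / 2)"
    using P C by (simp add: \<alpha>_def field_simps)
  also have "\<dots> \<le> \<alpha> * P + (- \<beta> * pexp n (\<lambda>xs. (wcol f s xs)\<^sup>2) (0, 0) (0, 0) + (- \<alpha> * (P / 2)))"
    using sq by simp
  also have "\<dots> = pexp n (\<lambda>xs. \<alpha> * wcol f s xs + (- \<beta> * (wcol f s xs)\<^sup>2 + (- \<alpha> * (P / 2)))) (0, 0) (0, 0)"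
    by (simp only: pexp_add pexp_cmult pexp_const pexp_wcol P_def)
  also have "\<dots> \<le> pexp n (\<lambda>xs. of_bool (hit N xs)) (0, 0) (0, 0)"
    by (rule pexp_mono) (rule pt)
  finally show ?thesis unfolding pexp_hit .
qed

text \<open>The discount and the horizon may depend on \<open>K\<close>; only \<open>C\<close> is
  fixed. With \<open>K = 2 * N\<close> the second moment method bounds the probability of a
  collision after time \<open>N\<close> below by \<open>1 / (8 * C)\<close>, independently of
  \<open>N\<close>, and the zero-one law raises this to 1.\<close>

lemma recurrent_collisions:
  assumes f: "\<And>v. 0 \<le> f v" "\<And>v. f v \<le> 1" and C: "0 < C"
    and ex: "\<And>K. \<exists>s n. 0 \<le> s \<and> s \<le> 1 \<and> K < Psi f s (Suc n) (0, 0) (0, 0) \<and>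
      (\<forall>N. \<forall>v\<in>verts. Psi f s N v v \<le> C * Psi f s (Suc n) (0, 0) (0, 0))"
  shows "(avp ^^ N) colinf (0, 0) (0, 0) = 1"
proof (rule zero_one_law)
  have "1 / (8 * C) \<le> (avp ^^ N) colinf (0, 0) (0, 0)" for N
  proof -
    obtain s n where sn: "0 \<le> s" "s \<le> 1" "2 * real N < Psi f s (Suc n) (0, 0) (0, 0)"
      "\<And>N v. v \<in> verts \<Longrightarrow> Psi f s N v v \<le> C * Psi f s (Suc n) (0, 0) (0, 0)"
      using ex by blast
    have "1 / (8 * C) \<le> (avp ^^ N) (col (Suc n - N)) (0, 0) (0, 0)"
      by (rule hit_prob_ge [OF f sn(1,2) sn(4) C sn(3)])
    also have "\<dots> \<le> (avp ^^ N) colinf (0, 0) (0, 0)"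
      by (intro avp_pow_mono col_le_colinf)
    finally show ?thesis .
  qed
  then have "1 / (8 * C) \<le> hinf (0, 0) (0, 0)"
    using hinf_tendsto by (meson LIMSEQ_le_const)
  then show "0 < hinf (0, 0) (0, 0)" using C by (smt (verit) divide_pos_pos)
qed

subsection \<open>Finitely many collisions\<close>

lemma Psi_Suc_mono:
  assumes "\<And>v. 0 \<le> f v"
  shows "Psi f s N v w \<le> Psi f s (Suc N) v w"
proof (induction N arbitrary: v w)
  case 0
  show ?case using Psi_nonneg [of f s "Suc 0", OF assms] by simp
next
  case (Suc N)
  have "s\<^sup>2 * avp (Psi f s N) v w \<le> s\<^sup>2 * avp (Psi f s (Suc N)) v w"
    by (intro mult_left_mono avp_mono Suc) simp
  then show ?case unfolding Psi.simps(2) [of f s "Suc N"] Psi.simps(2) [of f s N] by simp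
qed

lemma avp_pow_Psi:
  "(avp ^^ K) (Psi f 1 N) = (\<lambda>v w. Psi f 1 (K + N) v w - Psi f 1 K v w)"
proof (induction K)
  case (Suc K)
  then show ?case by (auto simp: avp_diff_fun intro!: ext)
qed simp

text \<open>Restarting at the first collision shows that the probability of meeting is at most the
  mean weighted number of collisions divided by \<open>c\<close>. Applied from time \<open>K\<close>
  on, this bounds the probability of a late collision by the tail of a convergent series.\<close>

lemma transient_collisions:
  assumes f: "\<And>v. 0 \<le> f v" and c: "0 < c"
    and low: "\<And>v. v \<in> verts \<Longrightarrow> \<exists>N. c \<le> Psi f 1 N v v"
    and bd: "\<And>N. Psi f 1 N (0, 0) (0, 0) \<le> B"
  shows "(\<lambda>N. (avp ^^ N) colinf (0, 0) (0, 0)) \<longlonglongrightarrow> 0"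
proof -
  let ?o = "(0::int, 0::nat)"
  have inc: "incseq (\<lambda>N. Psi f 1 N v w)" for v w
    by (intro incseq_SucI Psi_Suc_mono f)
  \<comment> \<open>The \<open>N\<close> in \<open>low\<close> depends on the vertex of the
    collision, with no uniform choice, so the comparison holds only eventually in \<open>N\<close>.
    Finiteness of neighbourhoods lets this pass through one pair step.\<close>
  have ev: "\<forall>\<^sub>F N in sequentially. c * col M v w \<le> Psi f 1 N v w"
    if "v \<in> verts" "w \<in> verts" for M v w
    using that
  proof (induction M arbitrary: v w)
    case 0
    then show ?case by (simp add: Psi_nonneg f)
  next
    case (Suc M)
    show ?case
    proof (cases "v = w")
      case True
      obtain N0 where "c \<le> Psi f 1 N0 v v" using low Suc.prems by blast
      then have "c \<le> Psi f 1 N v v" if "N0 \<le> N" for N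
        using incseqD [OF inc that, of v v] by linarith
      then show ?thesis using True by (auto simp: eventually_sequentially)
    next
      case False
      have "\<forall>\<^sub>F N in sequentially. \<forall>v'\<in>nb v. \<forall>w'\<in>nb w. c * col M v' w' \<le> Psi f 1 N v' w'"
        using Suc nb_verts by (intro eventually_ball_finite ballI) auto
      then have "\<forall>\<^sub>F N in sequentially. c * col (Suc M) v w \<le> Psi f 1 (Suc N) v w"
      proof eventually_elim
        case (elim N)
        have "c * avp (col M) v w = avp (\<lambda>v w. c * col M v w) v w" by (simp add: avp_cmult)
        also have "\<dots> \<le> avp (Psi f 1 N) v w" using elim by (intro avp_mono) auto
        finally show ?case using False by simp
      qed
      then show ?thesis by (subst (asm) eventually_sequentially_Suc)
    qed
  qed
  have ev_pow: "\<forall>\<^sub>F N in sequentially. (avp ^^ K) (\<lambda>v w. c * col M v w) v w \<le> (avp ^^ K) (Psi f 1 N) v w"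
    if "v \<in> verts" "w \<in> verts" for M K v w
    using that
  proof (induction K arbitrary: v w)
    case (Suc K)
    have "\<forall>\<^sub>F N in sequentially. \<forall>v'\<in>nb v. \<forall>w'\<in>nb w.
        (avp ^^ K) (\<lambda>v w. c * col M v w) v' w' \<le> (avp ^^ K) (Psi f 1 N) v' w'"
      using Suc nb_verts by (intro eventually_ball_finite ballI) auto
    then show ?case
    proof eventually_elim
      case (elim N)
      then show ?case by (auto intro!: avp_mono)
    qed
  qed (use ev in simp)
  have bdd: "bdd_above (range (\<lambda>N. Psi f 1 N ?o ?o))" using bd by (auto simp: bdd_above_def)
  define L where "L = (SUP N. Psi f 1 N ?o ?o)"
  have L: "(\<lambda>N. Psi f 1 N ?o ?o) \<longlonglongrightarrow> L"
    unfolding L_def by (intro LIMSEQ_incseq_SUP bdd inc)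
  have o: "?o \<in> verts" by (simp add: verts_def)
  have le: "c * (avp ^^ K) (col M) ?o ?o \<le> L - Psi f 1 K ?o ?o" for K M
  proof -
    have cm: "(avp ^^ K) (\<lambda>v w. c * F v w) = (\<lambda>v w. c * (avp ^^ K) F v w)" for F
      by (induction K) (simp_all add: avp_cmult_fun)
    obtain N where "(avp ^^ K) (\<lambda>v w. c * col M v w) ?o ?o \<le> (avp ^^ K) (Psi f 1 N) ?o ?o"
      using ev_pow [OF o o, of K M] by (auto simp: eventually_sequentially)
    then have "c * (avp ^^ K) (col M) ?o ?o \<le> Psi f 1 (K + N) ?o ?o - Psi f 1 K ?o ?o"
      by (simp add: cm avp_pow_Psi)
    also have "Psi f 1 (K + N) ?o ?o \<le> L" unfolding L_def by (intro cSUP_upper bdd) auto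
    finally show ?thesis by simp
  qed
  have "c * (avp ^^ K) colinf ?o ?o \<le> L - Psi f 1 K ?o ?o" for K
    by (rule LIMSEQ_le_const2 [OF tendsto_mult_left [OF avp_pow_tendsto [OF col_tendsto]]])
      (use le in blast)
  then have up: "(avp ^^ K) colinf ?o ?o \<le> (L - Psi f 1 K ?o ?o) / c" for K
    using c by (simp add: pos_le_divide_eq mult.commute)
  have "(\<lambda>K. (L - Psi f 1 K ?o ?o) / c) \<longlonglongrightarrow> (L - L) / c"
    using c by (intro tendsto_intros L) auto
  then have lim: "(\<lambda>K. (L - Psi f 1 K ?o ?o) / c) \<longlonglongrightarrow> 0" by simp
  show ?thesis
  proof (rule tendsto_sandwich [OF _ _ tendsto_const lim])
    show "\<forall>\<^sub>F K in sequentially. 0 \<le> (avp ^^ K) colinf ?o ?o" using tail_bounds by simp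
    show "\<forall>\<^sub>F K in sequentially. (avp ^^ K) colinf ?o ?o \<le> (L - Psi f 1 K ?o ?o) / c" using up by simp
  qed
qed

subsection \<open>Lower bounds\<close>

lemma av_pow_ge:
  assumes "\<And>v. v \<in> verts \<Longrightarrow> \<phi> v - c \<le> av \<phi> v" "v \<in> verts"
  shows "\<phi> v - real n * c \<le> (av ^^ n) \<phi> v"
  using assms(2)
proof (induction n arbitrary: v)
  case (Suc n)
  have "\<phi> v - real (Suc n) * c \<le> av \<phi> v - real n * c"
    using assms(1) [OF Suc.prems] by (simp add: algebra_simps)
  also have "\<dots> = av (\<lambda>w. \<phi> w - real n * c) v" by (simp add: av_diff)
  also have "\<dots> \<le> (av ^^ Suc n) \<phi> v"
    unfolding funpow.simps o_def using Suc nb_verts by (intro av_mono) blast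
  finally show ?case .
qed simp

text \<open>The parabola \<open>q\<close> equals 1 at the start, vanishes at heights
  \<open>0\<close> and \<open>2 * l\<close>, and loses exactly \<open>1 / l\<^sup>2\<close> in mean
  per step of the free walk. Continued by 0, it is nonnegative and at most the indicator of these
  heights, so its mean bounds the probability from below. Reflection at the tip, which is at height
  \<open>l\<close> or above, can only raise the mean.\<close>

lemma stay_near_prob:
  assumes l: "1 \<le> l" "l \<le> h x"
  shows "1 - real n / (real l)\<^sup>2 \<le> (\<Sum>k\<le>min (2 * l) (h x). p n (x, l) (x, k))"
proof -
  define q where "q k = 1 - ((k - real l) / real l)\<^sup>2" for k :: real
  define \<phi> where "\<phi> v = (if fst v = x \<and> snd v \<le> 2 * l then q (real (snd v)) else 0)" for v
  have l0: "0 < real l" using l by simp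
  have q_le: "q k \<le> 1" for k by (simp add: q_def)
  have q_ge: "0 \<le> q k" if "0 \<le> k" "k \<le> 2 * real l" for k
  proof -
    have "\<bar>(k - real l) / real l\<bar> \<le> 1" using that l0 by (simp add: abs_le_iff)
    then show ?thesis by (simp add: q_def abs_square_le_1)
  qed
  have \<phi>0: "0 \<le> \<phi> v" for v using q_ge by (simp add: \<phi>_def)
  have q_mid: "(q (k - 1) + q (k + 1)) / 2 = q k - 1 / (real l)\<^sup>2" for k
    using l0 by (simp add: q_def power2_eq_square field_simps)
  have q_end: "q (2 * real l) = 0" "q 0 = 0" using l0 by (simp_all add: q_def field_simps)
  have step: "\<phi> v - 1 / (real l)\<^sup>2 \<le> av \<phi> v" if v: "v \<in> verts" for v
  proof (cases "fst v = x \<and> snd v \<noteq> 0 \<and> snd v < 2 * l")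
    case True
    then obtain k where v_eq: "v = (x, k)" and k: "0 < k" "k < 2 * l" by (cases v) auto
    have kh: "k \<le> h x" using v by (simp add: verts_def v_eq)
    have pred: "real (k - Suc 0) = real k - 1" using k by simp
    show ?thesis
    proof (cases "k < h x")
      case True
      then have "av \<phi> v = (q (real k - 1) + q (real k + 1)) / 2"
        using k kh by (simp add: v_eq av_tooth \<phi>_def pred add.commute)
      then show ?thesis using k q_mid [of "real k"] by (simp add: \<phi>_def v_eq)
    next
      case False
      then have "av \<phi> v = q (real k - 1)"
        using k kh by (simp add: v_eq av_tooth \<phi>_def pred)
      moreover have "q (real k + 1) \<le> q (real k - 1)"
      proof -
        have "real l \<le> real k" using False l by simp
        then have "0 \<le> (real k - real l) * 4 / (real l)\<^sup>2" by simp
        also have "\<dots> = q (real k - 1) - q (real k + 1)"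
          using l0 by (simp add: q_def power2_eq_square field_simps)
        finally show ?thesis by simp
      qed
      ultimately show ?thesis using k q_mid [of "real k"] by (simp add: \<phi>_def v_eq)
    qed
  next
    case False
    then have "\<phi> v = 0"
    proof -
      have "\<phi> v = 0" if "snd v = 2 * l" using q_end that by (simp add: \<phi>_def)
      moreover have "\<phi> v = 0" if "snd v = 0" using q_end that by (simp add: \<phi>_def)
      moreover have "\<phi> v = 0" if "fst v \<noteq> x \<or> 2 * l < snd v" using that by (auto simp: \<phi>_def)
      ultimately show ?thesis using False by linarith
    qed
    moreover have "0 \<le> av \<phi> v" by (intro av_nonneg \<phi>0)
    moreover have "0 \<le> 1 / (real l)\<^sup>2" by simp
    ultimately show ?thesis by linarith
  qed
  have v: "(x, l) \<in> verts" using l by (simp add: verts_def)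
  define S where "S = box (x, l) n"
  define K where "K = (\<lambda>k. (x, k)) ` {..min (2 * l) (h x)}"
  have "\<phi> (x, l) - real n * (1 / (real l)\<^sup>2) \<le> (av ^^ n) \<phi> (x, l)"
    by (rule av_pow_ge [OF step v])
  also have "\<dots> = (\<Sum>w\<in>S. p n (x, l) w * \<phi> w)"
    by (intro av_pow_eq_sum v) (auto simp: S_def)
  also have "\<dots> \<le> (\<Sum>w\<in>S. if w \<in> K then p n (x, l) w else 0)"
  proof (rule sum_mono)
    fix w assume "w \<in> S"
    then have "w \<in> verts" using box_subset_verts by (auto simp: S_def)
    then have "w \<in> K" if "\<phi> w \<noteq> 0"
      using that by (cases w) (auto simp: K_def \<phi>_def verts_def split: if_splits)
    moreover have "\<phi> w \<le> 1" using q_le by (simp add: \<phi>_def)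
    ultimately show "p n (x, l) w * \<phi> w \<le> (if w \<in> K then p n (x, l) w else 0)"
      by (cases "\<phi> w = 0") (auto simp: mult_left_le)
  qed
  also have "\<dots> = (\<Sum>w\<in>S \<inter> K. p n (x, l) w)" by (simp add: S_def sum.inter_restrict)
  also have "\<dots> \<le> (\<Sum>w\<in>K. p n (x, l) w)" by (intro sum_mono2) (auto simp: K_def)
  also have "\<dots> = (\<Sum>k\<le>min (2 * l) (h x). p n (x, l) (x, k))"
    unfolding K_def by (subst sum.reindex) (auto intro: inj_onI)
  finally show ?thesis by (simp add: \<phi>_def q_def)
qed

text \<open>For about \<open>l\<^sup>2 / 2\<close> steps the walk stays at heights up to
  \<open>2 * l\<close> with probability at least \<open>1 / 2\<close>. Cauchy--Schwarz over at most
  \<open>3 * l\<close> vertices makes each meeting probability at least \<open>1 / (12 * l)\<close>,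
  and the weight there is at least \<open>1 / (3 * l)\<close>. Summing over time gives
  \<open>1 / 72\<close>.\<close>

lemma Psi_local_lower_bound:
  assumes v: "v \<in> verts"
  shows "\<exists>N. 1 / 72 \<le> Psi (\<lambda>(x, l). 1 / (1 + real l)) 1 N v v"
proof -
  let ?f = "\<lambda>(x :: int, l). 1 / (1 + real l)"
  obtain x l where xl: "v = (x, l)" by force
  show ?thesis
  proof (cases "l = 0")
    case True
    have "avp (\<lambda>_ _. 0) v v = 0" by simp
    then have "Psi ?f 1 (Suc 0) v v = 1" using True by (simp add: xl)
    then show ?thesis by (intro exI [of _ "Suc 0"]) simp
  next
    case False
    then have l: "1 \<le> l" "l \<le> h x" using v by (auto simp: verts_def xl)
    define N where "N = Suc (l\<^sup>2 div 2)"
    define K where "K = min (2 * l) (h x)"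
    have Nl: "(real l)\<^sup>2 \<le> 2 * real N"
    proof -
      have "l\<^sup>2 \<le> 2 * N" by (simp add: N_def)
      then have "real (l\<^sup>2) \<le> real (2 * N)" by (rule of_nat_mono)
      then show ?thesis by simp
    qed
    have each: "1 / (36 * (real l)\<^sup>2) \<le> (\<Sum>z\<in>box v N \<union> (\<lambda>k. (x, k)) ` {..K}. ?f z * p n v z * p n v z)"
      if n: "n < N" for n
    proof -
      have "2 * n \<le> l\<^sup>2" using n by (simp add: N_def)
      then have "real (2 * n) \<le> real (l\<^sup>2)" by (rule of_nat_mono)
      then have "1 / 2 \<le> 1 - real n / (real l)\<^sup>2" using l by (simp add: field_simps)
      also have "\<dots> \<le> (\<Sum>k\<le>K. p n v (x, k))"
        using stay_near_prob [OF l, of n] by (simp add: K_def xl)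
      finally have "(1 / 2)\<^sup>2 \<le> (\<Sum>k\<le>K. p n v (x, k))\<^sup>2" by (intro power_mono) auto
      also have "\<dots> \<le> (\<Sum>k\<le>K. (p n v (x, k))\<^sup>2) * card {..K}"
        by (rule sum_squared_le_sum_of_squares)
      also have "\<dots> \<le> (\<Sum>k\<le>K. (p n v (x, k))\<^sup>2) * (3 * real l)"
        using l by (intro mult_left_mono sum_nonneg) (auto simp: K_def)
      finally have 1: "1 / (12 * real l) \<le> (\<Sum>k\<le>K. (p n v (x, k))\<^sup>2)"
        using l by (simp add: field_simps power2_eq_square)
      have "1 / (36 * (real l)\<^sup>2) = 1 / (12 * real l) * (1 / (3 * real l))"
        by (simp add: power2_eq_square)
      also have "\<dots> \<le> (\<Sum>k\<le>K. (p n v (x, k))\<^sup>2) * (1 / (3 * real l))"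
        using 1 by (intro mult_right_mono) auto
      also have "\<dots> = (\<Sum>k\<le>K. (p n v (x, k))\<^sup>2 * (1 / (3 * real l)))"
        by (rule sum_distrib_right)
      also have "\<dots> \<le> (\<Sum>k\<le>K. (p n v (x, k))\<^sup>2 * ?f (x, k))"
        using l by (intro sum_mono mult_left_mono) (auto simp: K_def intro!: frac_le)
      also have "\<dots> = (\<Sum>z\<in>(\<lambda>k. (x, k)) ` {..K}. ?f z * p n v z * p n v z)"
        by (subst sum.reindex) (auto intro!: inj_onI sum.cong simp: power2_eq_square)
      also have "\<dots> \<le> (\<Sum>z\<in>box v N \<union> (\<lambda>k. (x, k)) ` {..K}. ?f z * p n v z * p n v z)"
        by (intro sum_mono2) auto
      finally show ?thesis .
    qed
    have "1 / 72 \<le> real N * (1 / (36 * (real l)\<^sup>2))"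
      using Nl l by (simp add: field_simps)
    also have "\<dots> = (\<Sum>n<N. 1 / (36 * (real l)\<^sup>2))" by simp
    also have "\<dots> \<le> (\<Sum>n<N. \<Sum>z\<in>box v N \<union> (\<lambda>k. (x, k)) ` {..K}. ?f z * p n v z * p n v z)"
      by (intro sum_mono each) auto
    also have "\<dots> = Psi ?f 1 N v v"
      by (subst Psi_eq_sum [OF v v, of "box v N \<union> (\<lambda>k. (x, k)) ` {..K}"]) auto
    finally show ?thesis by blast
  qed
qed

text \<open>Start at \<open>(x, l)\<close> and kill the walk on leaving
  \<open>\<bar>y\<bar> < 2 * x\<close>. The supersolution \<open>V\<close> bounds the mean lifetime,
  and \<open>T\<close> is at least four times that bound, so survival up to \<open>T\<close> has
  probability at most \<open>1 / 4\<close>. The hat function \<open>u\<close> is \<open>x\<close> at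
  the start and decreases in mean only at the origin or by killing beyond its support; at most
  \<open>x / 2\<close> of it can remain at time \<open>T\<close>, so the origin is visited at least
  \<open>x / 2\<close> times in mean. Reversibility and Cauchy--Schwarz over \<open>T\<close> times
  finish.\<close>

lemma green_lower_bound:
  fixes x :: nat
  assumes x: "0 < x" and l: "l \<le> h (int x)" and hm: "\<And>y. \<bar>y\<bar> < 2 * int x \<Longrightarrow> h y \<le> hm"
    and T: "4 * (2 * real l * real hm + 4 * (real x)\<^sup>2 * (real hm + 1)) \<le> real T"
  shows "(real x)\<^sup>2 / (36 * real T) \<le> (\<Sum>n<T. (p n (0, 0) (int x, l))\<^sup>2)"
proof -
  let ?o = "(0::int, 0::nat)" and ?w = "(int x, l)"
  define r where "r = 2 * int x"
  define K where "K \<phi> v = (if \<bar>fst v\<bar> < r then av \<phi> v else 0)" for \<phi> v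
  define u where "u v = (if \<bar>fst v\<bar> < r then real_of_int (r - \<bar>fst v\<bar>) else 0)" for v :: "int \<times> nat"
  define b where "b v = (if \<bar>fst v\<bar> < r then 1 else 0 :: real)" for v :: "int \<times> nat"
  define d where "d v = (if v = ?o then 1 else 0 :: real)" for v
  define A where "A = real hm + 1"
  \<comment> \<open>On a tooth, \<open>2 * h * l - l\<^sup>2\<close> loses exactly 1 in mean per
    step, also at the reflecting tip. From the spine a step into the tooth gains
    \<open>2 * h - 1\<close>, and \<open>A = hm + 1\<close> makes the concave spine part outweigh
    this. With \<open>\<le> r\<close> instead of \<open>< r\<close> the spine formula persists at
    the boundary columns, where it gives 0.\<close>
  define V where "V v = (if \<bar>fst v\<bar> \<le> r then 2 * real (h (fst v)) * real (snd v) - (real (snd v))\<^sup>2 +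
      A * (real_of_int (r\<^sup>2 - (fst v)\<^sup>2)) else 0)" for v
  have o: "?o \<in> verts" and w: "?w \<in> verts" using l by (auto simp: verts_def)
  have K_mono: "K \<phi> v \<le> K \<psi> v" if "v \<in> verts" "\<And>v. v \<in> verts \<Longrightarrow> \<phi> v \<le> \<psi> v" for \<phi> \<psi> v
    unfolding K_def by (auto intro!: av_mono that(2) nb_verts [OF that(1)])
  have K_add: "K (\<lambda>v. \<phi> v + \<psi> v) = (\<lambda>v. K \<phi> v + K \<psi> v)" for \<phi> \<psi>
    by (intro ext) (simp add: K_def av_add)
  have Kpow_mono: "(K ^^ n) \<phi> v \<le> (K ^^ n) \<psi> v" if "v \<in> verts" "\<And>v. v \<in> verts \<Longrightarrow> \<phi> v \<le> \<psi> v" for n \<phi> \<psi> v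
    using that(1)
  proof (induction n arbitrary: v)
    case (Suc n)
    then show ?case unfolding funpow.simps o_def by (intro K_mono)
  qed (simp add: that)
  have Kpow_add: "(K ^^ n) (\<lambda>v. \<phi> v + \<psi> v) = (\<lambda>v. (K ^^ n) \<phi> v + (K ^^ n) \<psi> v)" for n \<phi> \<psi>
    by (induction n) (simp_all add: K_add)
  have K_cmult: "K (\<lambda>v. c * \<phi> v) = (\<lambda>v. c * K \<phi> v)" for c \<phi>
    by (intro ext) (simp add: K_def av_cmult)
  have Kpow_cmult: "(K ^^ n) (\<lambda>v. c * \<phi> v) = (\<lambda>v. c * (K ^^ n) \<phi> v)" for n c \<phi>
    by (induction n) (simp_all add: K_cmult)
  have resolvent_le: "\<phi> v \<le> (\<Sum>n<T. (K ^^ n) g v) + (K ^^ T) \<phi> v"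
    if "v \<in> verts" "\<And>v. v \<in> verts \<Longrightarrow> \<phi> v \<le> g v + K \<phi> v" for T \<phi> g v
  proof (induction T)
    case (Suc T)
    have "(K ^^ T) \<phi> v \<le> (K ^^ T) (\<lambda>v. g v + K \<phi> v) v" by (rule Kpow_mono [OF that])
    also have "\<dots> = (K ^^ T) g v + (K ^^ Suc T) \<phi> v" by (simp add: Kpow_add funpow_swap1)
    finally show ?case using Suc by simp
  qed simp
  have resolvent_ge: "(\<Sum>n<T. (K ^^ n) g v) + (K ^^ T) \<phi> v \<le> \<phi> v"
    if "v \<in> verts" "\<And>v. v \<in> verts \<Longrightarrow> g v + K \<phi> v \<le> \<phi> v" for T \<phi> g v
  proof (induction T)
    case (Suc T)
    have "(K ^^ T) g v + (K ^^ Suc T) \<phi> v = (K ^^ T) (\<lambda>v. g v + K \<phi> v) v"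
      by (simp add: Kpow_add funpow_swap1)
    also have "\<dots> \<le> (K ^^ T) \<phi> v" by (rule Kpow_mono [OF that])
    finally show ?case using Suc by simp
  qed simp
  have u_step: "u v \<le> d v + K u v" if v: "v \<in> verts" for v
  proof (cases "\<bar>fst v\<bar> < r")
    case True
    obtain y k where vk: "v = (y, k)" by force
    have uy: "u (y, j) = real_of_int (r - \<bar>y\<bar>)" for j using True by (simp add: u_def vk)
    show ?thesis
    proof (cases "k = 0")
      case False
      then have "av u v = u v"
        using v by (simp add: vk av_tooth verts_def uy)
      then show ?thesis using True by (simp add: K_def d_def)
    next
      case k0: True
      have nb: "u (y - 1, 0) = real_of_int (r - \<bar>y - 1\<bar>)" "u (y + 1, 0) = real_of_int (r - \<bar>y + 1\<bar>)"
        using True by (auto simp: u_def vk)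
      show ?thesis
      proof (cases "y = 0")
        case True
        then show ?thesis using nb uy [of 0] uy [of 1] \<open>\<bar>fst v\<bar> < r\<close> k0
          by (simp add: K_def vk d_def av_spine field_simps)
      next
        case False
        then have "\<bar>y - 1\<bar> + \<bar>y + 1\<bar> = 2 * \<bar>y\<bar>" by linarith
        then have "(r - \<bar>y - 1\<bar>) + (r - \<bar>y + 1\<bar>) = 2 * (r - \<bar>y\<bar>)" by simp
        then have "u (y - 1, 0) + u (y + 1, 0) = 2 * real_of_int (r - \<bar>y\<bar>)"
          unfolding nb of_int_add [symmetric] by simp
        then have "av u v = u v" unfolding vk k0 av_spine uy by (simp add: field_simps)
        then show ?thesis using True by (simp add: K_def d_def)
      qed
    qed
  next
    case False
    then show ?thesis by (simp add: u_def K_def d_def)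
  qed
  have A: "1 \<le> A" by (simp add: A_def)
  have V0: "0 \<le> V v" if v: "v \<in> verts" for v
  proof (cases "\<bar>fst v\<bar> \<le> r")
    case True
    have "real (snd v) * real (snd v) \<le> 2 * real (h (fst v)) * real (snd v)"
      using v by (intro mult_right_mono) (auto simp: verts_def)
    moreover have "\<bar>fst v\<bar> \<le> \<bar>r\<bar>" using True by linarith
    then have "(fst v)\<^sup>2 \<le> r\<^sup>2" by (simp only: abs_le_square_iff)
    then have "0 \<le> real_of_int (r\<^sup>2 - (fst v)\<^sup>2)" by (subst of_int_0_le_iff) linarith
    then have "0 \<le> A * real_of_int (r\<^sup>2 - (fst v)\<^sup>2)" using A by (intro mult_nonneg_nonneg) auto
    ultimately show ?thesis by (simp add: V_def power2_eq_square)
  qed (simp add: V_def)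
  have V_step: "b v + K V v \<le> V v" if v: "v \<in> verts" for v
  proof (cases "\<bar>fst v\<bar> < r")
    case True
    obtain y k where vk: "v = (y, k)" by force
    have yr: "\<bar>y\<bar> < r" using True by (simp add: vk)
    define c where "c = A * real_of_int (r\<^sup>2 - y\<^sup>2)"
    have Vy: "V (y, j) = 2 * real (h y) * real j - (real j)\<^sup>2 + c" for j
      using yr by (simp add: V_def c_def)
    show ?thesis
    proof (cases "k = 0")
      case False
      have pred: "real (k - Suc 0) = real k - 1" using False by simp
      have "av V v = V v - 1"
      proof (cases "k < h y")
        case True
        then show ?thesis using False v
          by (simp add: vk av_tooth verts_def Vy pred power2_eq_square field_simps)
      next
        case False
        then have "k = h y" using v by (simp add: vk verts_def)
        then show ?thesis using \<open>k \<noteq> 0\<close>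
          by (simp add: vk av_tooth Vy pred power2_eq_square algebra_simps)
      qed
      then show ?thesis using True by (simp add: K_def b_def)
    next
      case k0: True
      have V1: "V (y - 1, 0) = A * real_of_int (r\<^sup>2 - (y - 1)\<^sup>2)"
        "V (y + 1, 0) = A * real_of_int (r\<^sup>2 - (y + 1)\<^sup>2)"
        using yr by (auto simp: V_def)
      have sum: "V (y - 1, 0) + V (y + 1, 0) = 2 * c - 2 * A"
        unfolding V1 c_def by (simp add: power2_eq_square algebra_simps)
      have "real (h y) \<le> real hm" using hm [of y] yr by (simp add: r_def)
      then have "av V v \<le> V v - 1"
        unfolding vk k0 av_spine sum Vy by (auto simp: A_def field_simps)
      then show ?thesis using True by (simp add: K_def b_def)
    qed
  next
    case False
    then show ?thesis using V0 [OF v] by (simp add: b_def K_def)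
  qed
  have Kb: "K b v \<le> b v" if "v \<in> verts" for v
    by (auto simp: K_def b_def intro!: av_le_const)
  have Kpow_b_dec: "(K ^^ T) b v \<le> (K ^^ n) b v" if "v \<in> verts" "n \<le> T" for n T v
    using that(2)
  proof (induction rule: dec_induct)
    case (step m)
    have "(K ^^ Suc m) b v = (K ^^ m) (K b) v" by (simp add: funpow_swap1)
    also have "\<dots> \<le> (K ^^ m) b v" by (rule Kpow_mono [OF that(1) Kb])
    finally show ?case using step by linarith
  qed simp
  have Kpow_nonneg: "0 \<le> (K ^^ n) \<phi> v" if "v \<in> verts" "\<And>v. v \<in> verts \<Longrightarrow> 0 \<le> \<phi> v" for n \<phi> v
  proof -
    have "K (\<lambda>_. 0) = (\<lambda>_. 0)" by (intro ext) (simp add: K_def)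
    then have "(K ^^ n) (\<lambda>_. 0) = (\<lambda>_. 0)" by (induction n) simp_all
    then show ?thesis using Kpow_mono [OF that(1), of "\<lambda>_. 0" \<phi> n] that(2) by simp
  qed
  have T0: "0 < real T"
  proof -
    have "0 < 4 * (2 * real l * real hm + 4 * (real x)\<^sup>2 * (real hm + 1))"
      using x by (intro mult_pos_pos add_nonneg_pos) auto
    then show ?thesis using T by (rule order.strict_trans2)
  qed
  have "real T * (K ^^ T) b ?w = (\<Sum>n<T. (K ^^ T) b ?w)" by simp
  also have "\<dots> \<le> (\<Sum>n<T. (K ^^ n) b ?w)" by (intro sum_mono Kpow_b_dec w) auto
  also have "\<dots> \<le> V ?w"
  proof -
    have "(\<Sum>n<T. (K ^^ n) b ?w) + (K ^^ T) V ?w \<le> V ?w" by (rule resolvent_ge [OF w V_step])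
    moreover have "0 \<le> (K ^^ T) V ?w" by (rule Kpow_nonneg [OF w V0])
    ultimately show ?thesis by linarith
  qed
  also have "\<dots> \<le> 2 * real l * real hm + 4 * (real x)\<^sup>2 * (real hm + 1)"
  proof -
    have "V ?w = 2 * real (h (int x)) * real l - (real l)\<^sup>2 + A * real_of_int (r\<^sup>2 - (int x)\<^sup>2)"
      by (simp add: V_def r_def)
    also have "\<dots> \<le> 2 * real hm * real l - 0 + A * (4 * (real x)\<^sup>2)"
    proof (intro add_mono diff_mono)
      show "2 * real (h (int x)) * real l \<le> 2 * real hm * real l"
        using hm [of "int x"] x by (intro mult_right_mono) auto
      show "A * real_of_int (r\<^sup>2 - (int x)\<^sup>2) \<le> A * (4 * (real x)\<^sup>2)"
        using A by (intro mult_left_mono) (auto simp: r_def power2_eq_square)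
    qed simp
    also have "\<dots> = 2 * real l * real hm + 4 * (real x)\<^sup>2 * (real hm + 1)"
      by (simp add: A_def algebra_simps)
    finally show ?thesis .
  qed
  finally have "real T * (K ^^ T) b ?w \<le> 2 * real l * real hm + 4 * (real x)\<^sup>2 * (real hm + 1)" .
  from order.trans [OF mult_left_mono [OF this, of 4] T]
  have "4 * (real T * (K ^^ T) b ?w) \<le> real T" by simp
  then have Kb4: "(K ^^ T) b ?w \<le> 1 / 4" using T0 by (simp add: field_simps)
  have "(K ^^ T) u ?w \<le> (K ^^ T) (\<lambda>v. real_of_int r * b v) ?w"
    by (rule Kpow_mono [OF w]) (auto simp: u_def b_def)
  also have "\<dots> = real_of_int r * (K ^^ T) b ?w" by (simp add: Kpow_cmult)
  also have "\<dots> \<le> real_of_int r * (1 / 4)" using Kb4 by (intro mult_left_mono) (auto simp: r_def)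
  finally have "(K ^^ T) u ?w \<le> real x / 2" by (simp add: r_def)
  have "u ?w = real x" using x by (simp add: u_def r_def)
  have visits: "real x / 2 \<le> (\<Sum>n<T. (K ^^ n) d ?w)"
  proof -
    have "u ?w \<le> (\<Sum>n<T. (K ^^ n) d ?w) + (K ^^ T) u ?w" by (rule resolvent_le [OF w u_step])
    then show ?thesis using \<open>(K ^^ T) u ?w \<le> real x / 2\<close> \<open>u ?w = real x\<close> by linarith
  qed
  have K_le_p: "0 \<le> (K ^^ n) d v \<and> (K ^^ n) d v \<le> p n v ?o" for n v
  proof (induction n arbitrary: v)
    case (Suc n)
    have "av ((K ^^ n) d) v \<le> p (Suc n) v ?o" using Suc by (auto intro!: av_mono)
    moreover have "0 \<le> av ((K ^^ n) d) v" using Suc by (intro av_nonneg) auto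
    moreover have "(K ^^ Suc n) d v = (if \<bar>fst v\<bar> < r then av ((K ^^ n) d) v else 0)"
      by (simp add: K_def)
    ultimately show ?case by (auto simp del: p.simps funpow.simps)
  qed (simp add: d_def)
  have "(K ^^ n) d ?w \<le> 3 * p n ?o ?w" for n
  proof -
    have "1 * p n ?w ?o \<le> deg ?w * p n ?w ?o" using deg_ge_1 by (intro mult_right_mono) auto
    also have "\<dots> = deg ?o * p n ?o ?w" by (rule p_reversible [OF w o])
    also have "\<dots> \<le> 3 * p n ?o ?w" using deg_le_3 by (intro mult_right_mono) auto
    finally show ?thesis using K_le_p [of n ?w] by linarith
  qed
  then have "(\<Sum>n<T. (K ^^ n) d ?w) \<le> (\<Sum>n<T. 3 * p n ?o ?w)" by (intro sum_mono)
  with visits have "real x / 6 \<le> (\<Sum>n<T. p n ?o ?w)"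
    by (simp add: sum_distrib_left [symmetric])
  then have "(real x / 6)\<^sup>2 \<le> (\<Sum>n<T. p n ?o ?w)\<^sup>2" by (intro power_mono) auto
  also have "\<dots> \<le> (\<Sum>n<T. (p n ?o ?w)\<^sup>2) * card {..<T}" by (rule sum_squared_le_sum_of_squares)
  finally have "(real x)\<^sup>2 / 36 \<le> (\<Sum>n<T. (p n ?o ?w)\<^sup>2) * real T" by (simp add: power_divide)
  then have "(real x)\<^sup>2 / 36 / real T \<le> (\<Sum>n<T. (p n ?o ?w)\<^sup>2)"
    by (subst pos_divide_le_eq [OF T0])
  then show ?thesis by simp
qed

end

subsection \<open>Logarithmic profiles\<close>

text \<open>The added 1 keeps the value at least 1, so that negative powers stay bounded near the
  origin.\<close>

definition lg :: "int \<Rightarrow> real" where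
  "lg x = 1 + ln (max \<bar>real_of_int x\<bar> 1)"

definition tooth_height :: "real \<Rightarrow> int \<Rightarrow> nat" where
  "tooth_height \<gamma> x = nat \<lfloor>log_profile \<gamma> x\<rfloor>"

lemma lg_ge_1: "1 \<le> lg x"
  by (simp add: lg_def)

lemma lg_pos [simp]: "0 < lg x"
  using lg_ge_1 [of x] by linarith

lemma lg_neq_0 [simp]: "lg x \<noteq> 0"
  using lg_pos [of x] by linarith

lemma lg_mono: "\<bar>x\<bar> \<le> \<bar>y\<bar> \<Longrightarrow> lg x \<le> lg y"
  unfolding lg_def by (auto intro!: add_left_mono ln_mono max.mono)

lemma max_pow2: "max \<bar>real_of_int (2 ^ j)\<bar> 1 = (2::real) ^ j"
  by (simp add: max_absorb1)

lemma lg_pow2: "lg (2 ^ j) = 1 + real j * ln 2"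
  unfolding lg_def max_pow2 by (simp add: ln_realpow)

lemma lg_pow2_bounds: "(real j + 1) / 2 \<le> lg (2 ^ j)" "lg (2 ^ j) \<le> real j + 1"
proof -
  have "1 / 2 \<le> ln (2::real)" "ln (2::real) \<le> 1" using ln2_ge_two_thirds ln_2_less_1 by auto
  then have "real j * (1 / 2) \<le> real j * ln 2" "real j * ln 2 \<le> real j * 1"
    by (intro mult_left_mono; simp)+
  then show "(real j + 1) / 2 \<le> lg (2 ^ j)" "lg (2 ^ j) \<le> real j + 1"
    by (simp_all add: lg_pow2)
qed

lemma lg_pow2_Suc: "lg (2 ^ Suc j) \<le> 2 * lg (2 ^ j)"
proof -
  have "ln (2::real) \<le> 1" using ln_2_less_1 by simp
  moreover have "0 \<le> real j * ln 2" by simp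
  ultimately have "ln 2 \<le> 1 + real j * ln 2" by linarith
  then show ?thesis unfolding lg_pow2 by (simp add: algebra_simps)
qed

lemma sum_inverse_sqrt_le: "(\<Sum>x=1..n. 1 / sqrt (real x)) \<le> 2 * sqrt (real n)"
proof (induction n)
  case (Suc n)
  have "sqrt (real n) \<le> sqrt (real (Suc n))" by simp
  then have "1 = (sqrt (real (Suc n)) - sqrt (real n)) * (sqrt (real (Suc n)) + sqrt (real n))"
    by (simp add: algebra_simps)
  also have "\<dots> \<le> (sqrt (real (Suc n)) - sqrt (real n)) * (2 * sqrt (real (Suc n)))"
    using \<open>sqrt (real n) \<le> _\<close> by (intro mult_left_mono) auto
  finally have "1 / sqrt (real (Suc n)) \<le> 2 * (sqrt (real (Suc n)) - sqrt (real n))"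
    
    by (subst pos_divide_le_eq) (simp, simp only: mult_ac)
  with Suc show ?case by simp
qed simp

text \<open>Slow variation: the ratio \<rho> of \<open>lg\<close> at \<open>2 ^ j\<close> and at
  \<open>x\<close> is at least 1 and at most twice the square root of
  \<open>2 ^ j / \<bar>x\<bar>\<close> (for \<open>x \<noteq> 0\<close>). Since
  \<open>- \<beta> \<le> 1\<close>, its power is at most \<rho> itself, and the square roots sum to
  order \<open>2 ^ j\<close>. The constant is 2 for \<open>x = 0\<close> and 4 for each
  sign.\<close>

lemma sum_lg_powr_le:
  assumes \<beta>: "-1 \<le> \<beta>"
  shows "(\<Sum>x | \<bar>x\<bar> < 2 ^ j. lg x powr \<beta>) \<le> 10 * lg (2 ^ j) powr \<beta> * 2 ^ j"
proof -
  let ?R = "(2::real) ^ j"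
  define q where "q x = 2 * (sqrt ?R / sqrt (max \<bar>real_of_int x\<bar> 1))" for x :: int
  have pt: "lg x powr \<beta> \<le> lg (2 ^ j) powr \<beta> * q x" if x: "\<bar>x\<bar> < 2 ^ j" for x
  proof -
    define y where "y = max \<bar>real_of_int x\<bar> 1"
    have y: "1 \<le> y" by (simp add: y_def)
    have "real_of_int \<bar>x\<bar> \<le> real_of_int (2 ^ j)" using x by (intro of_int_le_iff [THEN iffD2]) simp
    then have yR: "y \<le> ?R" by (simp add: y_def)
    define r where "r = ?R / y"
    have r: "1 \<le> r" using y yR by (simp add: r_def)
    have ln_r: "ln r = ln ?R - ln y" using y by (simp add: r_def ln_div)
    define \<rho> where "\<rho> = lg (2 ^ j) / lg x"
    have rho: "1 \<le> \<rho>" using lg_mono [of x "2 ^ j"] x lg_pos [of x] by (simp add: \<rho>_def del: lg_pos)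
    have "lg (2 ^ j) = lg x + ln r"
      unfolding ln_r lg_pow2 by (simp add: lg_def y_def ln_realpow)
    moreover have "ln r \<le> lg x * ln r" using r lg_ge_1 [of x] by (simp add: mult_le_cancel_right1)
    ultimately have "\<rho> \<le> 1 + ln r" using lg_pos [of x] by (simp add: \<rho>_def field_simps del: lg_pos)
    also have "\<dots> = 1 + 2 * ln (sqrt r)" using r by (simp add: ln_sqrt)
    also have "\<dots> \<le> 2 * sqrt r"
      using ln_le_minus_one [of "sqrt r"] r by simp
    finally have rho_le: "\<rho> \<le> 2 * sqrt r" .
    have "lg x powr \<beta> = lg (2 ^ j) powr \<beta> * \<rho> powr (- \<beta>)"
      using lg_pos [of x] lg_pos [of "2 ^ j"]
      by (simp add: \<rho>_def powr_divide powr_minus field_simps del: lg_pos)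
    also have "\<dots> \<le> lg (2 ^ j) powr \<beta> * \<rho> powr 1"
      using rho \<beta> by (intro mult_left_mono powr_mono) auto
    also have "\<dots> \<le> lg (2 ^ j) powr \<beta> * q x"
      using rho rho_le by (intro mult_left_mono) (auto simp: q_def r_def y_def real_sqrt_divide)
    finally show ?thesis .
  qed
  have q_sum: "(\<Sum>x | \<bar>x\<bar> < 2 ^ j. q x) \<le> 10 * ?R"
  proof -
    define n :: nat where "n = 2 ^ j"
    have sub: "{x::int. \<bar>x\<bar> < 2 ^ j} \<subseteq> {0} \<union> int ` {1..n} \<union> (\<lambda>x. - int x) ` {1..n}"
    proof
      fix x :: int assume "x \<in> {x. \<bar>x\<bar> < 2 ^ j}"
      then have n: "nat \<bar>x\<bar> \<le> n" by (simp add: n_def nat_le_iff)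
      consider "x = 0" | "1 \<le> x" | "x \<le> -1" by linarith
      then show "x \<in> {0} \<union> int ` {1..n} \<union> (\<lambda>x. - int x) ` {1..n}"
      proof cases
        case 2
        then show ?thesis using n by (intro UnI1 UnI2 image_eqI [of _ _ "nat x"]) auto
      next
        case 3
        then show ?thesis using n by (intro UnI2 image_eqI [of _ _ "nat (- x)"]) auto
      qed simp
    qed
    have q0: "0 \<le> q x" for x by (simp add: q_def)
    have pos: "(\<Sum>x\<in>int ` {1..n}. q x) \<le> 4 * ?R" "(\<Sum>x\<in>(\<lambda>x. - int x) ` {1..n}. q x) \<le> 4 * ?R"
    proof -
      have "(\<Sum>x\<in>{1..n}. q (int x)) = (\<Sum>x\<in>{1..n}. 2 * sqrt ?R * (1 / sqrt (real x)))"
        by (intro sum.cong) (auto simp: q_def max_def)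
      also have "\<dots> \<le> 2 * sqrt ?R * (2 * sqrt (real n))"
        unfolding sum_distrib_left [symmetric] by (intro mult_left_mono sum_inverse_sqrt_le) auto
      also have "\<dots> = 4 * ?R" by (simp add: n_def)
      finally have *: "(\<Sum>x\<in>{1..n}. q (int x)) \<le> 4 * ?R" .
      show "(\<Sum>x\<in>int ` {1..n}. q x) \<le> 4 * ?R"
        using * by (subst sum.reindex) (auto simp: inj_on_def)
      have "q (- int x) = q (int x)" for x by (simp add: q_def)
      then show "(\<Sum>x\<in>(\<lambda>x. - int x) ` {1..n}. q x) \<le> 4 * ?R"
        using * by (subst sum.reindex) (auto simp: inj_on_def)
    qed
    have "(\<Sum>x | \<bar>x\<bar> < 2 ^ j. q x) \<le> (\<Sum>x\<in>{0} \<union> int ` {1..n} \<union> (\<lambda>x. - int x) ` {1..n}. q x)"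
      by (intro sum_mono2 sub q0) auto
    also have "\<dots> \<le> (\<Sum>x\<in>{0} \<union> int ` {1..n}. q x) + (\<Sum>x\<in>(\<lambda>x. - int x) ` {1..n}. q x)"
      using q0 by (subst sum.union_inter [symmetric]) (auto intro!: sum_nonneg)
    also have "(\<Sum>x\<in>{0} \<union> int ` {1..n}. q x) \<le> (\<Sum>x\<in>{0}. q x) + (\<Sum>x\<in>int ` {1..n}. q x)"
      using q0 by (subst sum.union_inter [symmetric]) (auto intro!: sum_nonneg)
    also have "(\<Sum>x\<in>{0}. q x) \<le> 2 * ?R"
    proof -
      have "sqrt ?R \<le> ?R" using real_sqrt_le_iff [of ?R "?R\<^sup>2"] self_le_power [of ?R 2] by simp
      then show ?thesis by (simp add: q_def)
    qed
    finally show ?thesis using pos by linarith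
  qed
  have "(\<Sum>x | \<bar>x\<bar> < 2 ^ j. lg x powr \<beta>) \<le> (\<Sum>x | \<bar>x\<bar> < 2 ^ j. lg (2 ^ j) powr \<beta> * q x)"
    by (intro sum_mono pt) auto
  also have "\<dots> \<le> lg (2 ^ j) powr \<beta> * (10 * ?R)"
    unfolding sum_distrib_left [symmetric] by (intro mult_left_mono q_sum) auto
  finally show ?thesis by (simp add: mult_ac)
qed

lemma hsum_eq_harm: "comb_walk.hsum n = harm (Suc n)"
  unfolding comb_walk.hsum_def harm_def
  by (rule sum.reindex_bij_witness [of _ "\<lambda>k. k - 1" Suc]) (auto simp: divide_inverse)

lemma hsum_le_ln: "comb_walk.hsum n \<le> 1 + ln (real n + 1)"
  using euler_mascheroni_sequence_decreasing [of 1 "Suc n"] 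
  unfolding hsum_eq_harm by (simp add: harm_def add.commute)

lemma hsum_ge_ln: "ln (real n + 2) \<le> comb_walk.hsum n"
  using harm_ge_ln [of "Suc n"] unfolding hsum_eq_harm by (simp add: add_ac)

section \<open>Tooth heights and weights at dyadic scales\<close>

locale log_comb =
  fixes \<gamma> :: real
  assumes gamma_pos: "0 < \<gamma>"
begin

sublocale comb_walk "tooth_height \<gamma>" .

abbreviation kk :: "nat \<Rightarrow> nat" where
  "kk j \<equiv> tooth_height \<gamma> (2 ^ j)"

lemma tooth_height_mono:
  assumes "\<bar>x\<bar> \<le> \<bar>y\<bar>"
  shows "tooth_height \<gamma> x \<le> tooth_height \<gamma> y"
proof -
  have xy: "\<bar>real_of_int x\<bar> \<le> \<bar>real_of_int y\<bar>" using assms by linarith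
  then have "ln (max \<bar>real_of_int x\<bar> 1) powr \<gamma> \<le> ln (max \<bar>real_of_int y\<bar> 1) powr \<gamma>"
    using gamma_pos by (intro powr_mono2 ln_mono max.mono) auto
  with xy have "log_profile \<gamma> x \<le> log_profile \<gamma> y"
    unfolding log_profile_def by (intro mult_mono) auto
  then show ?thesis unfolding tooth_height_def by (intro nat_mono floor_mono)
qed

lemma real_tooth_height: "real (tooth_height \<gamma> x) \<le> log_profile \<gamma> x"
  "log_profile \<gamma> x < real (tooth_height \<gamma> x) + 1"
  using log_profile_nonneg [of \<gamma> x] by (auto simp: tooth_height_def)

lemma tooth_height_le: "real (tooth_height \<gamma> x) + 1 \<le> 2 * max \<bar>real_of_int x\<bar> 1 * lg x powr \<gamma>"
proof -
  have "ln (max \<bar>real_of_int x\<bar> 1) powr \<gamma> \<le> lg x powr \<gamma>"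
    using gamma_pos by (intro powr_mono2) (auto simp: lg_def)
  then have "log_profile \<gamma> x \<le> max \<bar>real_of_int x\<bar> 1 * lg x powr \<gamma>"
    unfolding log_profile_def by (intro mult_mono) auto
  moreover have "1 \<le> max \<bar>real_of_int x\<bar> 1 * lg x powr \<gamma>"
    using mult_mono [of 1 "max \<bar>real_of_int x\<bar> 1" 1 "lg x powr \<gamma>"] ge_one_powr_ge_zero [OF lg_ge_1, of \<gamma> x] gamma_pos
    by simp
  ultimately show ?thesis using real_tooth_height(1) [of x] by linarith
qed

lemma kk_le: "real (kk j) + 1 \<le> 2 * 2 ^ j * lg (2 ^ j) powr \<gamma>"
  using tooth_height_le [of "2 ^ j"] unfolding max_pow2 .

text \<open>The factor \<open>4 powr \<gamma>\<close> pays for replacing \<open>ln (2 ^ j)\<close>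
  by \<open>lg (2 ^ j)\<close>, which is at most four times as large when \<open>j \<ge> 1\<close>.
  For \<open>j = 0\<close> the tooth is trivial and the added 1 suffices.\<close>

lemma kk_ge: "2 ^ j * lg (2 ^ j) powr \<gamma> / 4 powr \<gamma> \<le> real (kk j) + 1"
proof (cases "j = 0")
  case True
  have "1 \<le> (4::real) powr \<gamma>" using gamma_pos by (intro ge_one_powr_ge_zero) auto
  then have "1 / 4 powr \<gamma> \<le> 1" by simp
  then show ?thesis using True lg_pow2 [of 0] by (simp add: add_increasing)
next
  case False
  then have j: "1 \<le> real j" by simp
  have l2: "1 / 2 \<le> ln (2::real)" using ln2_ge_two_thirds by simp
  have "lg (2 ^ j) / 4 \<le> real j * ln 2"
  proof -
    have "1 / 2 \<le> real j * ln 2" using mult_mono [OF j l2] by simp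
    then show ?thesis by (simp add: lg_pow2)
  qed
  then have "(lg (2 ^ j) / 4) powr \<gamma> \<le> (real j * ln 2) powr \<gamma>"
    using gamma_pos lg_ge_1 [of "2 ^ j"] by (intro powr_mono2) auto
  then have "2 ^ j * (lg (2 ^ j) / 4) powr \<gamma> \<le> 2 ^ j * (real j * ln 2) powr \<gamma>"
    by (intro mult_left_mono) auto
  also have "\<dots> = log_profile \<gamma> (2 ^ j)"
    unfolding log_profile_def max_pow2 by (simp add: ln_realpow)
  also have "\<dots> \<le> real (kk j) + 1" using real_tooth_height(2) [of "2 ^ j"] by simp
  finally show ?thesis using lg_ge_1 [of "2 ^ j"] by (simp add: powr_divide)
qed

lemma hsum_tooth_le: "hsum (tooth_height \<gamma> x) \<le> (2 + \<gamma>) * lg x"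
proof -
  have y: "1 \<le> max \<bar>real_of_int x\<bar> 1" by simp
  have "hsum (tooth_height \<gamma> x) \<le> 1 + ln (real (tooth_height \<gamma> x) + 1)" by (rule hsum_le_ln)
  also have "\<dots> \<le> 1 + ln (2 * max \<bar>real_of_int x\<bar> 1 * lg x powr \<gamma>)"
    using tooth_height_le [of x] by (intro add_left_mono ln_mono) auto
  also have "\<dots> = 1 + ln 2 + ln (max \<bar>real_of_int x\<bar> 1) + \<gamma> * ln (lg x)"
    using y lg_pos [of x] by (simp add: ln_mult ln_powr del: lg_pos)
  also have "\<dots> \<le> 2 * lg x + \<gamma> * lg x"
  proof (intro add_mono mult_left_mono)
    have "ln (2::real) \<le> 1" using ln_2_less_1 by simp
    moreover have "0 \<le> ln (max \<bar>real_of_int x\<bar> 1)" by simp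
    moreover have "1 + a + m \<le> 2 * (1 + m)" if "a \<le> 1" "0 \<le> m" for a m :: real
      using that unfolding distrib_left by linarith
    ultimately show "1 + ln 2 + ln (max \<bar>real_of_int x\<bar> 1) \<le> 2 * lg x" unfolding lg_def by blast
    show "ln (lg x) \<le> lg x" using ln_le_minus_one [OF lg_pos, of x] by linarith
  qed (use gamma_pos in simp)
  finally show ?thesis by (simp add: algebra_simps)
qed

text \<open>The source of the constant \<open>A\<close> in the energy estimates. The additional
  power of \<open>lg\<close> leaves room for weights with an exponent \<beta> as low as -1.\<close>

lemma exists_scale_constant: "\<exists>A. 1 \<le> A \<and> (\<forall>j. 2 * lg (2 ^ j) powr (\<gamma> + 1) \<le> A * 2 ^ j)"
proof -
  have "(\<lambda>j::nat. 2 * (real j + 1) powr (\<gamma> + 1) / 2 ^ j) \<longlonglongrightarrow> 0"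
    using gamma_pos by real_asymp
  then have "Bseq (\<lambda>j::nat. 2 * (real j + 1) powr (\<gamma> + 1) / 2 ^ j)"
    by (rule convergent_imp_Bseq [OF convergentI])
  then obtain A where A: "0 < A" "\<And>j::nat. norm (2 * (real j + 1) powr (\<gamma> + 1) / 2 ^ j) \<le> A"
    by (auto elim!: BseqE)
  have "2 * lg (2 ^ j) powr (\<gamma> + 1) \<le> (1 + A) * 2 ^ j" for j
  proof -
    have "2 * lg (2 ^ j) powr (\<gamma> + 1) \<le> 2 * (real j + 1) powr (\<gamma> + 1)"
      using lg_pow2_bounds [of j] lg_ge_1 [of "2 ^ j"] gamma_pos
      by (intro mult_left_mono powr_mono2) auto
    also have "\<dots> \<le> A * 2 ^ j" using A(2) [of j] by (simp add: field_simps)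
    also have "\<dots> \<le> (1 + A) * 2 ^ j" by (intro mult_right_mono) auto
    finally show ?thesis .
  qed
  then show ?thesis using A(1) by (intro exI [of _ "1 + A"]) auto
qed

text \<open>\<open>\<beta> = 1\<close> is the plain weight for the transient case,
  \<open>\<beta> = \<gamma> - 1\<close> the one for the recurrent case. In general the scale
  \<open>2 ^ i\<close> contributes \<open>lg (2 ^ i) powr (\<beta> - \<gamma>)\<close>.\<close>

definition weight :: "real \<Rightarrow> int \<times> nat \<Rightarrow> real" where
  "weight \<beta> = (\<lambda>(x, l). lg x powr (\<beta> - 1) / (1 + real l))"

text \<open>The reciprocal of the order of the exit time from the strip \<open>\<bar>x\<bar> < 2 ^ j\<close>.\<close>

definition tt :: "nat \<Rightarrow> real" where
  "tt j = 1 / (4 ^ j * (real (kk j) + 1))"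

text \<open>An instance of \<open>collision_sum_le\<close> with \<open>R j = 2 ^ j\<close>. Scale
  \<open>j\<close> costs \<open>L j * 8 ^ j\<close> on an arc of order \<open>tt (j - 1)\<close>; as
  \<open>tt i\<close> is comparable to \<open>1 / (8 ^ i * lg (2 ^ i) powr \<gamma>)\<close>, only
  powers of \<open>lg\<close> survive.\<close>

lemma spine_collision_bound:
  assumes \<beta>: "-1 \<le> \<beta>" "\<beta> \<le> 1"
  shows "\<exists>c\<ge>0. \<forall>\<alpha> s M m. 1 / 2 \<le> s \<longrightarrow> s < 1 \<longrightarrow> s ^ M \<le> 1 - s \<longrightarrow> tt m \<le> 1 - s \<longrightarrow>
    (\<exists>X0. \<forall>X\<ge>X0. (\<Sum>z\<in>strip X. weight \<beta> z * (\<Sum>n<M. s ^ (2 * n) * (p n (\<alpha>, 0) z)\<^sup>2)) \<le>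
      c * (1 + (\<Sum>i<m. lg (2 ^ i) powr (\<beta> - \<gamma>))))"
proof -
  obtain A where A: "1 \<le> A" "\<And>j. 2 * lg (2 ^ j) powr (\<gamma> + 1) \<le> A * 2 ^ j"
    using exists_scale_constant by blast
  \<comment> \<open>The two factors are the constants of \<open>sum_lg_powr_le\<close> and
    \<open>hsum_tooth_le\<close>.\<close>
  define c0 where "c0 = 10 * (2 + \<gamma>)"
  define L where "L j = c0 * lg (2 ^ j) powr \<beta>" for j
  define K where "K = 9 * (155 * (2 + A) * (19 + 15 * A))"
  have c0: "1 \<le> c0" using gamma_pos by (simp add: c0_def)
  have K0: "0 \<le> K" using A by (simp add: K_def)
  have four: "((2::real) ^ j)\<^sup>2 = 4 ^ j" for j by (simp add: power_mult [symmetric] mult.commute [of j] power_mult)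
  have kA: "real (kk j) + 1 \<le> A * L j * (2 ^ j)\<^sup>2" "real (kk j) + 1 \<le> A * (2 ^ j)\<^sup>2" for j
  proof -
    let ?l = "lg (2 ^ j)"
    have "real (kk j) + 1 \<le> 2 ^ j * (2 * ?l powr \<gamma>)" using kk_le [of j] by simp
    also have "?l powr \<gamma> = ?l powr (\<gamma> + 1) * ?l powr (-1)"
      unfolding powr_add [symmetric] by simp
    also have "2 ^ j * (2 * (?l powr (\<gamma> + 1) * ?l powr (-1))) =
        2 ^ j * (2 * ?l powr (\<gamma> + 1) * ?l powr (-1))"
      by (simp only: mult.assoc)
    also have "\<dots> \<le> 2 ^ j * (A * 2 ^ j * ?l powr (-1))"
      using A(2) by (intro mult_left_mono mult_right_mono) auto
    finally have 1: "real (kk j) + 1 \<le> A * (2 ^ j)\<^sup>2 * ?l powr (-1)" by (simp add: power2_eq_square mult_ac)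
    also have "\<dots> \<le> A * (2 ^ j)\<^sup>2 * 1"
      using A powr_mono [of "-1" 0 ?l] lg_ge_1 [of "2 ^ j"] by (intro mult_left_mono) auto
    finally show "real (kk j) + 1 \<le> A * (2 ^ j)\<^sup>2" by simp
    have "?l powr (-1) \<le> ?l powr \<beta>" using lg_ge_1 \<beta> by (intro powr_mono) auto
    also have "\<dots> \<le> L j" using c0 by (simp add: L_def mult_le_cancel_right1)
    finally have "A * (2 ^ j)\<^sup>2 * ?l powr (-1) \<le> A * (2 ^ j)\<^sup>2 * L j" using A by (intro mult_left_mono) auto
    with 1 show "real (kk j) + 1 \<le> A * L j * (2 ^ j)\<^sup>2" by (simp add: mult_ac)
  qed
  have eps_le: "lg x powr (\<beta> - 1) \<le> lg y powr (\<beta> - 1)" if "\<bar>y\<bar> \<le> \<bar>x\<bar>" for x y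
    using that \<beta> lg_mono lg_pos by (intro powr_mono2') auto
  have eps1: "lg x powr (\<beta> - 1) \<le> 1" for x
    using eps_le [of 0 x] by (simp add: lg_def)
  have far: "lg x powr (\<beta> - 1) * hsum (kk j) \<le> L j" if "int (2 ^ j) \<le> \<bar>x\<bar>" for j x
  proof -
    have "lg x powr (\<beta> - 1) * hsum (kk j) \<le> lg (2 ^ j) powr (\<beta> - 1) * ((2 + \<gamma>) * lg (2 ^ j))"
      using that by (intro mult_mono eps_le hsum_tooth_le) auto
    also have "\<dots> = (2 + \<gamma>) * lg (2 ^ j) powr \<beta>"
      using lg_pos [of "2 ^ j"] by (simp add: powr_diff del: lg_pos)
    also have "\<dots> \<le> L j" using gamma_pos unfolding L_def c0_def by (intro mult_right_mono) auto
    finally show ?thesis .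
  qed
  have near: "(\<Sum>x | \<bar>x\<bar> < int (2 ^ j). lg x powr (\<beta> - 1) * hsum (tooth_height \<gamma> x)) \<le> L j * real (2 ^ j)" for j
  proof -
    have "(\<Sum>x | \<bar>x\<bar> < int (2 ^ j). lg x powr (\<beta> - 1) * hsum (tooth_height \<gamma> x)) \<le>
        (\<Sum>x | \<bar>x\<bar> < int (2 ^ j). (2 + \<gamma>) * lg x powr \<beta>)"
    proof (rule sum_mono)
      fix x
      have "lg x powr (\<beta> - 1) * hsum (tooth_height \<gamma> x) \<le> lg x powr (\<beta> - 1) * ((2 + \<gamma>) * lg x)"
        by (intro mult_left_mono hsum_tooth_le) auto
      also have "\<dots> = (2 + \<gamma>) * lg x powr \<beta>"
        using lg_pos [of x] by (simp add: powr_diff del: lg_pos)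
      finally show "lg x powr (\<beta> - 1) * hsum (tooth_height \<gamma> x) \<le> (2 + \<gamma>) * lg x powr \<beta>" .
    qed
    also have "\<dots> \<le> (2 + \<gamma>) * (10 * lg (2 ^ j) powr \<beta> * 2 ^ j)"
      unfolding sum_distrib_left [symmetric] using sum_lg_powr_le [OF \<beta>(1), of j] gamma_pos
      by (intro mult_left_mono) auto
    finally show ?thesis by (simp add: L_def c0_def algebra_simps)
  qed
  have near': "lg x powr (\<beta> - 1) * (real (tooth_height \<gamma> x) + 1) \<le> A * L j * (real (2 ^ j))\<^sup>2"
    if "\<bar>x\<bar> < int (2 ^ j)" for x j
  proof -
    have "lg x powr (\<beta> - 1) * (real (tooth_height \<gamma> x) + 1) \<le> 1 * (real (kk j) + 1)"
      using that tooth_height_mono [of x "2 ^ j"] by (intro mult_mono eps1) auto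
    then show ?thesis using kA(1) [of j] by simp
  qed
  define c where "c = K * (4 * c0 + 64 * c0 * 4 powr \<gamma>)"
  have terms: "L j * real (2 ^ j) ^ 3 * (2 * (if j = 0 then 2 else 2 * tt (j - 1))) \<le>
      (if j = 0 then 4 * c0 else 64 * c0 * 4 powr \<gamma> * lg (2 ^ (j - 1)) powr (\<beta> - \<gamma>))" for j
  proof (cases j)
    case 0
    then show ?thesis using lg_pow2 [of 0] by (simp add: L_def)
  next
    case (Suc i)
    let ?l = "lg (2 ^ i)"
    have l0: "0 < ?l" by simp
    have Lj: "L j \<le> c0 * (2 * ?l powr \<beta>)"
    proof -
      have "lg (2 ^ j) powr \<beta> \<le> 2 * ?l powr \<beta>"
      proof (cases "0 \<le> \<beta>")
        case True
        then have "lg (2 ^ j) powr \<beta> \<le> (2 * ?l) powr \<beta>"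
          using lg_pow2_Suc [of i] Suc by (intro powr_mono2 less_imp_le [OF lg_pos]) auto
        also have "\<dots> = 2 powr \<beta> * ?l powr \<beta>" using l0 by (simp add: powr_mult)
        also have "\<dots> \<le> 2 powr 1 * ?l powr \<beta>" using \<beta> by (intro mult_right_mono powr_mono) auto
        finally show ?thesis by simp
      next
        case False
        then have "lg (2 ^ j) powr \<beta> \<le> ?l powr \<beta>"
          using Suc by (intro powr_mono2' lg_mono) auto
        then show ?thesis by (smt (verit) powr_ge_zero)
      qed
      then show ?thesis unfolding L_def using c0 by (intro mult_left_mono) auto
    qed
    have kpos: "0 < real (kk i) + 1" by linarith
    have "L j * real (2 ^ j) ^ 3 * (2 * (if j = 0 then 2 else 2 * tt (j - 1))) =
        L j * (32 * (2 ^ i / (real (kk i) + 1)))"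
    proof -
      have cube: "real (2 ^ j) ^ 3 = 8 * (2 ^ i * 4 ^ i)"
        by (simp add: Suc power_mult_distrib power3_eq_cube four [symmetric] power2_eq_square)
      have "x * (8 * (a * b)) * (2 * (2 * (1 / (b * k)))) = x * (32 * (a / k))"
        if "0 < b" "0 < k" for x a b k :: real
        using that by simp
      from this [of "4 ^ i" "real (kk i) + 1" "L j" "2 ^ i"] kpos show ?thesis
        unfolding cube by (simp add: Suc tt_def)
    qed
    also have "\<dots> \<le> c0 * (2 * ?l powr \<beta>) * (32 * (4 powr \<gamma> * ?l powr (- \<gamma>)))"
    proof (intro mult_mono Lj)
      have main: "2 ^ i * ?l powr \<gamma> \<le> 4 powr \<gamma> * (real (kk i) + 1)"
        using kk_ge [of i] by (simp add: field_simps)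
      have aux: "a * l \<le> f * k \<Longrightarrow> 0 < l \<Longrightarrow> 0 < k \<Longrightarrow> a / k \<le> f / l" for a l f k :: real
        by (simp add: field_simps)
      have "2 ^ i / (real (kk i) + 1) \<le> 4 powr \<gamma> / ?l powr \<gamma>"
        by (rule aux [OF main _ kpos]) simp
      then show "2 ^ i / (real (kk i) + 1) \<le> 4 powr \<gamma> * ?l powr - \<gamma>"
        by (simp add: powr_minus divide_inverse)
    qed (use c0 kpos in auto)
    also have "\<dots> = 64 * c0 * 4 powr \<gamma> * ?l powr (\<beta> - \<gamma>)"
      by (simp add: powr_diff powr_minus field_simps)
    finally show ?thesis using Suc by simp
  qed
  have sum_terms: "(\<Sum>j\<le>m. L j * real (2 ^ j) ^ 3 * (2 * (if j = 0 then 2 else 2 * tt (j - 1)))) \<le>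
      4 * c0 + 64 * c0 * 4 powr \<gamma> * (\<Sum>i<m. lg (2 ^ i) powr (\<beta> - \<gamma>))" for m
  proof -
    have "(\<Sum>j\<le>m. L j * real (2 ^ j) ^ 3 * (2 * (if j = 0 then 2 else 2 * tt (j - 1)))) \<le>
        (\<Sum>j\<le>m. if j = 0 then 4 * c0 else 64 * c0 * 4 powr \<gamma> * lg (2 ^ (j - 1)) powr (\<beta> - \<gamma>))"
      by (intro sum_mono terms)
    also have "\<dots> = 4 * c0 + (\<Sum>i<m. 64 * c0 * 4 powr \<gamma> * lg (2 ^ i) powr (\<beta> - \<gamma>))"
      by (subst sum.atMost_shift) simp
    finally show ?thesis by (simp add: sum_distrib_left)
  qed
  show ?thesis
  proof (intro exI [of _ c] conjI allI impI)
    show "0 \<le> c" using K0 c0 by (simp add: c_def)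
    fix \<alpha> s M m
    assume s: "1 / 2 \<le> s" "s < 1" "s ^ M \<le> 1 - s" "tt m \<le> 1 - s"
    define X0 where "X0 = \<bar>\<alpha>\<bar> + int M + 3 * 2 ^ m + 1"
    show "\<exists>X0. \<forall>X\<ge>X0. (\<Sum>z\<in>strip X. weight \<beta> z * (\<Sum>n<M. s ^ (2 * n) * (p n (\<alpha>, 0) z)\<^sup>2)) \<le>
      c * (1 + (\<Sum>i<m. lg (2 ^ i) powr (\<beta> - \<gamma>)))"
    proof (intro exI [of _ X0] allI impI)
      fix X assume X: "X0 \<le> X"
      have "(\<Sum>z\<in>strip X. weight \<beta> z * (\<Sum>n<M. s ^ (2 * n) * (p n (\<alpha>, 0) z)\<^sup>2)) =
          (\<Sum>(x, l)\<in>strip X. lg x powr (\<beta> - 1) / (1 + real l) * (\<Sum>n<M. s ^ (2 * n) * (p n (\<alpha>, 0) (x, l))\<^sup>2))"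
        by (simp add: weight_def case_prod_beta)
      also have "\<dots> \<le> 9 * (155 * (2 + A) * (19 + 15 * A)) *
          (\<Sum>j\<le>m. L j * real (2 ^ j) ^ 3 * (2 * (if j = 0 then 2 else 2 * tt (j - 1))))"
      proof (rule collision_sum_le [where R = "\<lambda>j. 2 ^ j" and kk = kk and t = tt and L = L
            and A = A and \<epsilon> = "\<lambda>x. lg x powr (\<beta> - 1)", OF refl s(1-3) _ _ _ _ s(4) _ _ _ far near near'])
        show "1 \<le> tt j * (real (2 ^ j))\<^sup>2 * (real (kk j) + 1)" for j
        proof -
          have "0 < real (kk j) + 1" by linarith
          then show ?thesis by (simp add: tt_def four)
        qed
        show "kk j \<le> tooth_height \<gamma> x" if "int (2 ^ j) \<le> \<bar>x\<bar>" for j x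
          using that by (intro tooth_height_mono) simp
        show "real (kk j) + 1 \<le> A * (real (2 ^ j))\<^sup>2" for j using kA(2) [of j] by simp
        show "\<bar>\<alpha>\<bar> + int M + 3 * int (2 ^ j) < X" if "j \<le> m" for j
        proof -
          have "(2::int) ^ j \<le> 2 ^ m" using that by (intro power_increasing) auto
          then show ?thesis using X unfolding X0_def of_nat_power of_nat_numeral by linarith
        qed
        show "0 \<le> L j" for j using c0 by (simp add: L_def)
        show "0 \<le> tt j" for j by (simp add: tt_def)
      qed auto
      also have "\<dots> \<le> K * (4 * c0 + 64 * c0 * 4 powr \<gamma> * (\<Sum>i<m. lg (2 ^ i) powr (\<beta> - \<gamma>)))"
        unfolding K_def [symmetric] by (intro mult_left_mono sum_terms K0)
      also have "\<dots> \<le> c * (1 + (\<Sum>i<m. lg (2 ^ i) powr (\<beta> - \<gamma>)))"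
      proof -
        have S: "0 \<le> (\<Sum>i<m. lg (2 ^ i) powr (\<beta> - \<gamma>))" by (intro sum_nonneg) auto
        have "4 * c0 + 64 * c0 * 4 powr \<gamma> * S \<le> (4 * c0 + 64 * c0 * 4 powr \<gamma>) * (1 + S)" if "0 \<le> S" for S
          using that c0 by (simp add: algebra_simps)
        from mult_left_mono [OF this [OF S] K0] show ?thesis by (simp add: c_def mult.assoc)
      qed
      finally show "(\<Sum>z\<in>strip X. weight \<beta> z * (\<Sum>n<M. s ^ (2 * n) * (p n (\<alpha>, 0) z)\<^sup>2)) \<le>
        c * (1 + (\<Sum>i<m. lg (2 ^ i) powr (\<beta> - \<gamma>)))" .
    qed
  qed
qed

end

section \<open>Convergence and divergence over the dyadic scales\<close>

lemma sum_dyadic_ge: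
  fixes g :: "nat \<Rightarrow> real"
  assumes "\<And>i x. 2 \<le> i \<Longrightarrow> i < J \<Longrightarrow> 2 ^ i \<le> x \<Longrightarrow> x < 2 ^ Suc i \<Longrightarrow> a i / 2 ^ i \<le> g x" "2 \<le> J"
  shows "(\<Sum>i\<in>{2..<J}. a i) \<le> (\<Sum>x\<in>{4..<2 ^ J}. g x)"
  using assms(2,1)
proof (induction J rule: dec_induct)
  case (step J)
  have "(4::nat) \<le> 2 ^ J" using power_increasing [of 2 J "2::nat"] step by simp
  then have "{4..<2 ^ Suc J} = {4..<2 ^ J} \<union> {2 ^ J..<2 ^ Suc J :: nat}" by auto
  then have "(\<Sum>x\<in>{4..<2 ^ Suc J}. g x) = (\<Sum>x\<in>{4..<2 ^ J}. g x) + (\<Sum>x\<in>{2 ^ J..<2 ^ Suc J}. g x)"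
    by (simp only:) (subst sum.union_disjoint; auto)
  moreover have "(\<Sum>i\<in>{2..<J}. a i) \<le> (\<Sum>x\<in>{4..<2 ^ J}. g x)"
    using step by auto
  moreover have "a J = (\<Sum>x\<in>{2 ^ J..<2 ^ Suc J :: nat}. a J / 2 ^ J)" by simp
  moreover have "(\<Sum>x\<in>{2 ^ J..<2 ^ Suc J :: nat}. a J / 2 ^ J) \<le> (\<Sum>x\<in>{2 ^ J..<2 ^ Suc J}. g x)"
    using step by (intro sum_mono) auto
  ultimately show ?case using step by simp
qed simp

context log_comb
begin

lemma weight_nonneg: "0 \<le> weight \<beta> v"
  by (simp add: weight_def split: prod.split)

lemma weight_le:
  assumes "\<beta> \<le> 1"
  shows "weight \<beta> (x, l) \<le> 1 / (1 + real l)"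
proof -
  have "lg x powr (\<beta> - 1) \<le> lg x powr 0" using assms lg_ge_1 by (intro powr_mono) auto
  then show ?thesis by (simp add: weight_def divide_right_mono)
qed

lemma tt_pos: "0 < tt m"
  by (simp add: tt_def add_pos_nonneg add.commute)

lemma tt_le: "tt m \<le> 1 / 4 ^ m"
proof -
  have "(4::real) ^ m * 1 \<le> 4 ^ m * (real (kk m) + 1)" by (intro mult_left_mono) auto
  then show ?thesis unfolding tt_def by (intro divide_left_mono) (auto intro!: mult_pos_pos)
qed

lemma kk_mono:
  assumes "i \<le> j"
  shows "kk i \<le> kk j"
proof (rule tooth_height_mono)
  have "(2::int) ^ i \<le> 2 ^ j" using assms by (intro power_increasing) auto
  then show "\<bar>2 ^ i :: int\<bar> \<le> \<bar>2 ^ j\<bar>" by simp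
qed

lemma Psi_eq_sum_strip:
  assumes "\<bar>\<alpha>\<bar> + int N \<le> X"
  shows "Psi f s N (\<alpha>, 0) (\<alpha>, 0) = (\<Sum>z\<in>strip X. f z * (\<Sum>n<N. s ^ (2 * n) * (p n (\<alpha>, 0) z)\<^sup>2))"
proof -
  have v: "(\<alpha>, 0) \<in> verts" by (simp add: verts_def)
  have "Psi f s N (\<alpha>, 0) (\<alpha>, 0) = (\<Sum>n<N. \<Sum>z\<in>strip X. f z * (s ^ (2 * n) * (p n (\<alpha>, 0) z)\<^sup>2))"
    using assms Psi_eq_sum [OF v v finite_strip box_subset_strip, of N X f s]
    by (simp add: sum_distrib_left power2_eq_square mult_ac)
  then show ?thesis by (subst (asm) sum.swap) (simp add: sum_distrib_left)
qed

lemma incseq_Psi: "(\<And>v. 0 \<le> f v) \<Longrightarrow> incseq (\<lambda>N. Psi f s N v w)"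
  by (intro incseq_SucI Psi_Suc_mono)

text \<open>The auxiliary \<open>M\<close> and \<open>X\<close> disappear: \<open>Psi\<close>
  increases with the number of steps, so that number may be enlarged until
  \<open>s ^ M \<le> 1 - s\<close>, and a strip that is wide enough contains all possible
  collisions.\<close>

lemma Psi_spine_le:
  assumes \<beta>: "-1 \<le> \<beta>" "\<beta> \<le> 1"
  shows "\<exists>c\<ge>0. \<forall>\<alpha> s N m. 1 / 2 \<le> s \<longrightarrow> s < 1 \<longrightarrow> tt m \<le> 1 - s \<longrightarrow>
    Psi (weight \<beta>) s N (\<alpha>, 0) (\<alpha>, 0) \<le> c * (1 + (\<Sum>i<m. lg (2 ^ i) powr (\<beta> - \<gamma>)))"
proof -
  obtain c where c: "0 \<le> c" "\<And>\<alpha> s M m. 1 / 2 \<le> s \<Longrightarrow> s < 1 \<Longrightarrow> s ^ M \<le> 1 - s \<Longrightarrow> tt m \<le> 1 - s \<Longrightarrow>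
    (\<exists>X0. \<forall>X\<ge>X0. (\<Sum>z\<in>strip X. weight \<beta> z * (\<Sum>n<M. s ^ (2 * n) * (p n (\<alpha>, 0) z)\<^sup>2)) \<le>
      c * (1 + (\<Sum>i<m. lg (2 ^ i) powr (\<beta> - \<gamma>))))"
    using spine_collision_bound [OF \<beta>] by blast
  have "Psi (weight \<beta>) s N (\<alpha>, 0) (\<alpha>, 0) \<le> c * (1 + (\<Sum>i<m. lg (2 ^ i) powr (\<beta> - \<gamma>)))"
    if s: "1 / 2 \<le> s" "s < 1" "tt m \<le> 1 - s" for \<alpha> s N m
  proof -
    have "(\<lambda>n. s ^ n) \<longlonglongrightarrow> 0" using s by (intro LIMSEQ_realpow_zero) auto
    then have "\<forall>\<^sub>F n in sequentially. s ^ n < 1 - s" using s by (intro order_tendstoD) auto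
    then obtain n0 where n0: "\<And>n. n0 \<le> n \<Longrightarrow> s ^ n < 1 - s"
      by (auto simp: eventually_sequentially)
    define M where "M = max n0 N"
    have M: "s ^ M \<le> 1 - s" using n0 [of M] by (simp add: M_def)
    obtain X0 where X0: "\<And>X. X0 \<le> X \<Longrightarrow>
        (\<Sum>z\<in>strip X. weight \<beta> z * (\<Sum>n<M. s ^ (2 * n) * (p n (\<alpha>, 0) z)\<^sup>2)) \<le>
        c * (1 + (\<Sum>i<m. lg (2 ^ i) powr (\<beta> - \<gamma>)))"
      using c(2) [OF s(1,2) M s(3), of \<alpha>] by blast
    have "Psi (weight \<beta>) s N (\<alpha>, 0) (\<alpha>, 0) \<le> Psi (weight \<beta>) s M (\<alpha>, 0) (\<alpha>, 0)"
      by (rule incseqD [OF incseq_Psi [OF weight_nonneg]]) (simp add: M_def)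
    also have "\<dots> \<le> c * (1 + (\<Sum>i<m. lg (2 ^ i) powr (\<beta> - \<gamma>)))"
      using X0 [of "max X0 (\<bar>\<alpha>\<bar> + int M)"] Psi_eq_sum_strip [of \<alpha> M "max X0 (\<bar>\<alpha>\<bar> + int M)" "weight \<beta>" s]
      by simp
    finally show ?thesis .
  qed
  then show ?thesis using c(1) by blast
qed

lemma finite_collisions:
  assumes "2 < \<gamma>"
  shows "(\<lambda>N. (avp ^^ N) colinf (0, 0) (0, 0)) \<longlonglongrightarrow> 0"
proof -
  define f :: "int \<times> nat \<Rightarrow> real" where "f = (\<lambda>(x, l). 1 / (1 + real l))"
  have f: "weight 1 = f" by (simp add: weight_def f_def)
  obtain c where c: "0 \<le> c" "\<And>\<alpha> s N m. 1 / 2 \<le> s \<Longrightarrow> s < 1 \<Longrightarrow> tt m \<le> 1 - s \<Longrightarrow>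
    Psi f s N (\<alpha>, 0) (\<alpha>, 0) \<le> c * (1 + (\<Sum>i<m. lg (2 ^ i) powr (1 - \<gamma>)))"
    using Psi_spine_le [of 1] unfolding f by auto
  have summ: "summable (\<lambda>i. lg (2 ^ i) powr (1 - \<gamma>))"
  proof (rule summable_comparison_test')
    have "summable (\<lambda>i. real i powr (1 - \<gamma>))" using assms by (simp add: summable_real_powr_iff)
    then have "summable (\<lambda>i. real (Suc i) powr (1 - \<gamma>))" by (subst summable_Suc_iff)
    then show "summable (\<lambda>i. (1 / 2) powr (1 - \<gamma>) * real (Suc i) powr (1 - \<gamma>))"
      by (rule summable_mult)
    fix i :: nat
    have "lg (2 ^ i) powr (1 - \<gamma>) \<le> ((real i + 1) / 2) powr (1 - \<gamma>)"
      using assms lg_pow2_bounds by (intro powr_mono2') auto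
    also have "\<dots> = (1 / 2) powr (1 - \<gamma>) * real (Suc i) powr (1 - \<gamma>)"
      by (subst powr_mult [symmetric]) (auto simp: add.commute)
    finally show "norm (lg (2 ^ i) powr (1 - \<gamma>)) \<le> (1 / 2) powr (1 - \<gamma>) * real (Suc i) powr (1 - \<gamma>)"
      by simp
  qed
  define S where "S = (\<Sum>i. lg (2 ^ i) powr (1 - \<gamma>))"
  have S: "(\<Sum>i<m. lg (2 ^ i) powr (1 - \<gamma>)) \<le> S" for m
    unfolding S_def by (intro sum_le_suminf summ) auto
  \<comment> \<open>For fixed \<open>N\<close> the sum is a polynomial in \<open>s\<close>, so
    letting \<open>s = 1 - tt m\<close> tend to 1 removes the discount while the summable bound
    stays uniform in \<open>m\<close>.\<close>
  have bd: "Psi f 1 N (0, 0) (0, 0) \<le> c * (1 + S)" for N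
  proof (rule LIMSEQ_le_const2)
    define s where "s m = 1 - tt m" for m
    have "tt \<longlonglongrightarrow> 0"
    proof (rule tendsto_sandwich [OF _ _ tendsto_const])
      show "\<forall>\<^sub>F m in sequentially. 0 \<le> tt m" using tt_pos by (simp add: less_imp_le)
      show "\<forall>\<^sub>F m in sequentially. tt m \<le> (1 / 4) ^ m" using tt_le by (simp add: power_one_over)
      show "(\<lambda>m. (1 / 4 :: real) ^ m) \<longlonglongrightarrow> 0" by (intro LIMSEQ_realpow_zero) auto
    qed
    then have "s \<longlonglongrightarrow> 1 - 0" unfolding s_def by (intro tendsto_intros)
    then have s: "s \<longlonglongrightarrow> 1" by simp
    have "(\<lambda>m. \<Sum>z\<in>strip (int N). f z * (\<Sum>n<N. s m ^ (2 * n) * (p n (0, 0) z)\<^sup>2)) \<longlonglongrightarrow>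
        (\<Sum>z\<in>strip (int N). f z * (\<Sum>n<N. 1 ^ (2 * n) * (p n (0, 0) z)\<^sup>2))"
      by (intro tendsto_intros s)
    then show "(\<lambda>m. Psi f (s m) N (0, 0) (0, 0)) \<longlonglongrightarrow> Psi f 1 N (0, 0) (0, 0)"
      by (simp add: Psi_eq_sum_strip [of 0 N "int N"])
    have "Psi f (s m) N (0, 0) (0, 0) \<le> c * (1 + S)" if m: "1 \<le> m" for m
    proof -
      have "(4::real) ^ 1 \<le> 4 ^ m" using m by (intro power_increasing) auto
      then have "1 / 4 ^ m \<le> (1 / 4 :: real)" by (simp add: divide_simps)
      then have "1 / 2 \<le> s m" using tt_le [of m] unfolding s_def by linarith
      then have "Psi f (s m) N (0, 0) (0, 0) \<le> c * (1 + (\<Sum>i<m. lg (2 ^ i) powr (1 - \<gamma>)))"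
        using tt_pos [of m] by (intro c(2)) (auto simp: s_def)
      also have "\<dots> \<le> c * (1 + S)" using S c(1) by (intro mult_left_mono add_left_mono) auto
      finally show ?thesis .
    qed
    then show "\<exists>m0. \<forall>m\<ge>m0. Psi f (s m) N (0, 0) (0, 0) \<le> c * (1 + S)" by blast
  qed
  show ?thesis
  proof (rule transient_collisions [of f "1 / 72"])
    show "0 \<le> f v" for v using weight_nonneg [of 1 v] by (simp add: f)
    show "\<exists>N. 1 / 72 \<le> Psi f 1 N v v" if "v \<in> verts" for v
      using Psi_local_lower_bound [OF that] by (simp add: f_def)
  qed (use bd in auto)
qed

text \<open>\<open>T\<close> steps suffice for \<open>green_lower_bound\<close> at every height
  \<open>l \<le> x\<close>. Summing the weights over these heights gives
  \<open>lg powr (\<gamma> - 2)\<close> times a harmonic sum of order \<open>lg\<close>; with visits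
  of order \<open>1 / (2 ^ i * lg powr \<gamma>)\<close>, the column contributes
  \<open>1 / (2 ^ i * lg)\<close>. The constant is \<open>16 * 6912 * 128\<close>, from two losses
  of a factor 4, the bound on visits and the bound \<open>kle\<close> on tooth heights.\<close>

lemma weighted_visits_ge:
  assumes \<gamma>2: "\<gamma> \<le> 2" and i: "2 \<le> i" "i + 5 \<le> m" and x: "2 ^ i \<le> x" "x < 2 ^ Suc i"
    and N: "6 * 4 ^ (i + 2) * (kk (i + 2) + 1) \<le> N"
  shows "1 / 14155776 / lg (2 ^ i) / 2 ^ i \<le>
    (\<Sum>l\<le>x. weight (\<gamma> - 1) (int x, l) * (\<Sum>n<N. (1 - tt m) ^ (2 * n) * (p n (0, 0) (int x, l))\<^sup>2))"
    and "x \<le> tooth_height \<gamma> (int x)"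
proof -
  let ?l = "lg (2 ^ i)" and ?k = "real (kk (i + 2)) + 1"
  define T where "T = 6 * 4 ^ (i + 2) * (kk (i + 2) + 1)"
  have k0: "0 < ?k" by linarith
  have x4: "4 \<le> x" using x power_increasing [of 2 i "2::nat"] i by simp
  have xr: "2 ^ i \<le> real x" "real x \<le> 2 ^ Suc i"
    using x by (metis of_nat_le_iff of_nat_power of_nat_numeral, metis less_imp_le of_nat_le_iff of_nat_power of_nat_numeral)
  have l2: "2 / 3 \<le> ln (2::real)" using ln2_ge_two_thirds .
  have il: "1 \<le> real i * ln 2"
    using mult_mono [of 2 "real i" "2 / 3" "ln (2::real)"] i l2 by simp
  have T_real: "real T = 6 * 16 * 4 ^ i * ?k" by (simp add: T_def power_add algebra_simps)
  show h: "x \<le> tooth_height \<gamma> (int x)"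
  proof -
    have "ln (4::real) = 2 * ln 2" using ln_realpow [of 2 2] by simp
    then have "1 \<le> ln (4::real)" using l2 by linarith
    also have "ln (4::real) \<le> ln (real x)" using x4 by (intro ln_mono) auto
    finally have "1 \<le> ln (real x) powr \<gamma>" using gamma_pos by (intro ge_one_powr_ge_zero) auto
    then have "real x \<le> log_profile \<gamma> (int x)"
      using x4 by (simp add: log_profile_def max_absorb1)
    then have "int x \<le> \<lfloor>log_profile \<gamma> (int x)\<rfloor>" by (simp add: le_floor_iff)
    then show ?thesis by (simp add: tooth_height_def)
  qed
  \<comment> \<open>Bernoulli's inequality: \<open>2 * T\<close> is \<open>192 * 4 ^ i * ?k\<close>,
    whereas \<open>i + 5 \<le> m\<close> makes \<open>1 / tt m\<close> at least
    \<open>1024 * 4 ^ i * ?k\<close>. So the discount costs at most a factor 2 up to time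
    \<open>T\<close>.\<close>
  have half: "1 / 2 \<le> (1 - tt m) ^ (2 * T)"
  proof -
    have "tt m \<le> 1" using tt_le [of m] by (rule order.trans) simp
    then have "1 + real (2 * T) * (- tt m) \<le> (1 + - tt m) ^ (2 * T)"
      by (intro Bernoulli_inequality) auto
    moreover have "real (2 * T) * tt m \<le> 1 / 2"
    proof -
      have "kk (i + 2) \<le> kk m" using i by (intro kk_mono) simp
      then have km: "?k \<le> real (kk m) + 1" by simp
      have "(4::real) ^ (i + 5) \<le> 4 ^ m" using i by (intro power_increasing) auto
      then have "1024 * 4 ^ i \<le> (4::real) ^ m" by (simp add: power_add)
      then have "1024 * 4 ^ i * ?k \<le> 4 ^ m * (real (kk m) + 1)"
        using km k0 by (intro mult_mono) auto
      moreover have "0 \<le> (4::real) ^ i * ?k" using k0 by simp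
      moreover have "1024 * a * b \<le> W \<Longrightarrow> 0 \<le> a * b \<Longrightarrow> 384 * (a * b) \<le> W" for a b W :: real
        by simp
      ultimately have "384 * (4 ^ i * ?k) \<le> 4 ^ m * (real (kk m) + 1)" by blast
      moreover have "2 * (real (2 * T)) = 384 * (4 ^ i * ?k)" by (simp add: T_real)
      ultimately have "2 * (real (2 * T)) \<le> 4 ^ m * (real (kk m) + 1)" by simp
      moreover have "0 < 4 ^ m * (real (kk m) + 1)" by (intro mult_pos_pos) auto
      ultimately show ?thesis by (simp add: tt_def field_simps)
    qed
    ultimately show ?thesis by simp
  qed
  have s01: "0 \<le> 1 - tt m" "1 - tt m \<le> 1"
  proof -
    have "tt m \<le> 1" using tt_le [of m] by (rule order.trans) simp
    then show "0 \<le> 1 - tt m" "1 - tt m \<le> 1" using tt_pos [of m] by auto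
  qed
  have visits: "1 / (6912 * ?k) \<le> (\<Sum>n<N. (1 - tt m) ^ (2 * n) * (p n (0, 0) (int x, l))\<^sup>2)"
    if l: "l \<le> x" for l
  proof -
    have "(real x)\<^sup>2 / (36 * real T) \<le> (\<Sum>n<T. (p n (0, 0) (int x, l))\<^sup>2)"
    proof (rule green_lower_bound [where hm = "kk (i + 2)"])
      show "0 < x" using x4 by simp
      show "l \<le> tooth_height \<gamma> (int x)" using l h by simp
      show "tooth_height \<gamma> y \<le> kk (i + 2)" if "\<bar>y\<bar> < 2 * int x" for y
      proof (rule tooth_height_mono)
        have "int x < int (2 ^ Suc i)" using x(2) by (simp only: of_nat_less_iff)
        then show "\<bar>y\<bar> \<le> \<bar>2 ^ (i + 2)\<bar>" using that by simp
      qed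
      have p24: "(2::real) ^ Suc i \<le> 4 ^ Suc i" by (intro power_mono) auto
      have four: "((2::real) ^ Suc i)\<^sup>2 = 4 ^ Suc i"
        by (simp add: power_mult_distrib power2_eq_square)
          (metis mult_numeral_1 numeral_Bit0_eq_double power_mult_distrib)
      have "real l * real (kk (i + 2)) \<le> 4 ^ Suc i * ?k"
        using l xr p24 by (intro mult_mono) auto
      moreover have "(real x)\<^sup>2 * ?k \<le> 4 ^ Suc i * ?k"
        unfolding four [symmetric] using xr by (intro mult_right_mono power_mono) auto
      ultimately have "4 * (2 * (real l * real (kk (i + 2))) + 4 * ((real x)\<^sup>2 * ?k)) \<le>
          4 * (2 * (4 ^ Suc i * ?k) + 4 * (4 ^ Suc i * ?k))"
        by (intro mult_left_mono add_mono) auto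
      also have "\<dots> = real T" by (simp add: T_real)
      finally show "4 * (2 * real l * real (kk (i + 2)) + 4 * (real x)\<^sup>2 * (real (kk (i + 2)) + 1)) \<le> real T"
        by (simp add: mult.assoc)
    qed
    moreover have "1 / (3456 * ?k) \<le> (real x)\<^sup>2 / (36 * real T)"
    proof -
      have "(2 ^ i)\<^sup>2 \<le> (real x)\<^sup>2" using xr by (intro power_mono) auto
      then have "4 ^ i \<le> (real x)\<^sup>2" by (simp add: power_mult [symmetric] mult.commute [of i]) (simp add: power_mult)
      then have "4 ^ i / (36 * real T) \<le> (real x)\<^sup>2 / (36 * real T)" by (intro divide_right_mono) auto
      moreover have "4 ^ i / (36 * real T) = 1 / (3456 * ?k)" unfolding T_real using k0 by simp
      ultimately show ?thesis by simp
    qed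
    ultimately have "1 / 2 * (1 / (3456 * ?k)) \<le> (1 - tt m) ^ (2 * T) * (\<Sum>n<T. (p n (0, 0) (int x, l))\<^sup>2)"
      using half k0 by (intro mult_mono) auto
    also have "\<dots> \<le> (\<Sum>n<T. (1 - tt m) ^ (2 * n) * (p n (0, 0) (int x, l))\<^sup>2)"
      unfolding sum_distrib_left using s01 by (intro sum_mono mult_right_mono power_decreasing) auto
    also have "\<dots> \<le> (\<Sum>n<N. (1 - tt m) ^ (2 * n) * (p n (0, 0) (int x, l))\<^sup>2)"
      using N s01 by (intro sum_mono2) (auto simp: T_def)
    finally show ?thesis by simp
  qed
  have eps: "?l powr (\<gamma> - 2) / 4 \<le> lg (int x) powr (\<gamma> - 1 - 1)"
  proof -
    have "?l powr (\<gamma> - 2) / 4 \<le> 2 powr (\<gamma> - 2) * ?l powr (\<gamma> - 2)"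
    proof -
      have "(2::real) powr (-2) \<le> 2 powr (\<gamma> - 2)" using gamma_pos by (intro powr_mono) auto
      then have "1 / 4 \<le> (2::real) powr (\<gamma> - 2)" by (simp add: powr_minus_divide)
      then show ?thesis using mult_right_mono [of "1 / 4" "2 powr (\<gamma> - 2)" "?l powr (\<gamma> - 2)"] by simp
    qed
    also have "\<dots> = (2 * ?l) powr (\<gamma> - 2)" using less_imp_le [OF lg_pos] by (simp add: powr_mult)
    also have "\<dots> \<le> lg (int x) powr (\<gamma> - 2)"
    proof (rule powr_mono2')
      have "int x \<le> int (2 ^ Suc i)" using x(2) by (simp only: of_nat_le_iff less_imp_le)
      then have "lg (int x) \<le> lg (2 ^ Suc i)" by (intro lg_mono) auto
      then show "lg (int x) \<le> 2 * ?l" using lg_pow2_Suc [of i] by linarith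
    qed (use \<gamma>2 in auto)
    finally show ?thesis by simp
  qed
  have hs: "?l / 4 \<le> hsum x"
  proof -
    have "?l / 4 \<le> real i * ln 2" using il by (simp add: lg_pow2)
    also have "\<dots> = ln (2 ^ i)" by (simp add: ln_realpow)
    also have "\<dots> \<le> ln (real x + 2)"
    proof (rule ln_mono)
      show "2 ^ i \<le> real x + 2" using xr(1) by linarith
    qed auto
    also have "\<dots> \<le> hsum x" by (rule hsum_ge_ln)
    finally show ?thesis .
  qed
  have kle: "?k \<le> 128 * 2 ^ i * ?l powr \<gamma>"
  proof -
    have "lg (2 ^ (i + 2)) \<le> 4 * ?l" using lg_pow2_Suc [of i] lg_pow2_Suc [of "Suc i"] by simp
    then have "lg (2 ^ (i + 2)) powr \<gamma> \<le> (4 * ?l) powr \<gamma>"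
      using gamma_pos less_imp_le [OF lg_pos] by (intro powr_mono2) auto
    also have "\<dots> = 4 powr \<gamma> * ?l powr \<gamma>" using less_imp_le [OF lg_pos] by (simp add: powr_mult)
    also have "\<dots> \<le> 4 powr 2 * ?l powr \<gamma>" using \<gamma>2 by (intro mult_right_mono powr_mono) auto
    finally have *: "lg (2 ^ (i + 2)) powr \<gamma> \<le> 16 * ?l powr \<gamma>" by simp
    have "?k \<le> 2 * 2 ^ (i + 2) * lg (2 ^ (i + 2)) powr \<gamma>" by (rule kk_le)
    also have "\<dots> \<le> 2 * 2 ^ (i + 2) * (16 * ?l powr \<gamma>)" by (intro mult_left_mono *) auto
    finally show ?thesis by (simp add: power_add)
  qed
  have "1 / 14155776 / ?l / 2 ^ i = ?l powr (\<gamma> - 2) / 4 * (?l / 4) * (1 / (6912 * (128 * 2 ^ i * ?l powr \<gamma>)))"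
    using lg_pos [of "2 ^ i"] by (simp add: powr_diff power2_eq_square field_simps del: lg_pos)
  also have "\<dots> \<le> lg (int x) powr (\<gamma> - 1 - 1) * hsum x * (1 / (6912 * ?k))"
    using eps hs kle k0 less_imp_le [OF lg_pos, of "2 ^ i"] by (intro mult_mono divide_left_mono) auto
  also have "\<dots> = (\<Sum>l\<le>x. weight (\<gamma> - 1) (int x, l) * (1 / (6912 * ?k)))"
    by (simp add: weight_def hsum_def sum_distrib_left sum_distrib_right sum_divide_distrib)
  also have "\<dots> \<le> (\<Sum>l\<le>x. weight (\<gamma> - 1) (int x, l) * (\<Sum>n<N. (1 - tt m) ^ (2 * n) * (p n (0, 0) (int x, l))\<^sup>2))"
    using visits by (intro sum_mono mult_left_mono weight_nonneg) auto
  finally show "1 / 14155776 / ?l / 2 ^ i \<le>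
    (\<Sum>l\<le>x. weight (\<gamma> - 1) (int x, l) * (\<Sum>n<N. (1 - tt m) ^ (2 * n) * (p n (0, 0) (int x, l))\<^sup>2))" .
qed

text \<open>Only columns \<open>x \<ge> 4\<close> and heights \<open>l \<le> x\<close> are kept,
  where the tooth is known to be long enough. The highest scales are dropped because the discount is
  under control only for \<open>i + 5 \<le> m\<close>.\<close>

lemma Psi_origin_ge:
  assumes \<gamma>2: "\<gamma> \<le> 2" and m: "7 \<le> m"
  shows "\<exists>n. (\<Sum>i\<in>{2..<m - 4}. 1 / 14155776 / lg (2 ^ i)) \<le> Psi (weight (\<gamma> - 1)) (1 - tt m) (Suc n) (0, 0) (0, 0)"
proof -
  define n where "n = 6 * 4 ^ m * (kk m + 1) + 2 ^ m"
  define N where "N = Suc n"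
  define F where "F z = weight (\<gamma> - 1) z * (\<Sum>k<N. (1 - tt m) ^ (2 * k) * (p k (0, 0) z)\<^sup>2)" for z
  have s01: "0 \<le> 1 - tt m"
    using tt_le [of m] by (simp add: order.trans [of _ "1 / 4 ^ m" 1])
  have F0: "0 \<le> F z" for z
    unfolding F_def using s01 by (intro mult_nonneg_nonneg weight_nonneg sum_nonneg) auto
  have NT: "6 * 4 ^ (i + 2) * (kk (i + 2) + 1) \<le> N" if "i + 5 \<le> m" for i
  proof -
    have "kk (i + 2) \<le> kk m" using that by (intro kk_mono) simp
    moreover have "(4::nat) ^ (i + 2) \<le> 4 ^ m" using that by (intro power_increasing) auto
    ultimately have "6 * 4 ^ (i + 2) * (kk (i + 2) + 1) \<le> 6 * 4 ^ m * (kk m + 1)"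
      by (intro mult_le_mono) auto
    then show ?thesis by (simp add: N_def n_def)
  qed
  have block: "1 / 14155776 / lg (2 ^ i) / 2 ^ i \<le> (\<Sum>l\<le>x. F (int x, l))" "x \<le> tooth_height \<gamma> (int x)"
    if "2 \<le> i" "i < m - 4" "2 ^ i \<le> x" "x < 2 ^ Suc i" for i x
    using weighted_visits_ge [OF \<gamma>2 that(1) _ that(3,4) NT, of m] that unfolding F_def by auto
  define U where "U = (SIGMA x : {4..<2 ^ (m - 4)}. {..x :: nat})"
  have "(\<Sum>i\<in>{2..<m - 4}. 1 / 14155776 / lg (2 ^ i)) \<le> (\<Sum>x\<in>{4..<2 ^ (m - 4)}. \<Sum>l\<le>x. F (int x, l))"
    using m by (intro sum_dyadic_ge block(1)) auto
  also have "\<dots> = (\<Sum>(x, l)\<in>U. F (int x, l))"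
    unfolding U_def by (simp add: sum.Sigma)
  also have "\<dots> = (\<Sum>z\<in>(\<lambda>(x, l). (int x, l)) ` U. F z)"
    by (subst sum.reindex) (auto simp: inj_on_def intro!: sum.cong)
  also have "\<dots> \<le> (\<Sum>z\<in>strip (int N). F z)"
  proof (intro sum_mono2 F0 finite_strip subsetI)
    fix z assume "z \<in> (\<lambda>(x, l). (int x, l)) ` U"
    then obtain x l where z: "z = (int x, l)" "4 \<le> x" "x < 2 ^ (m - 4)" "l \<le> x"
      by (auto simp: U_def)
    obtain i where i: "2 ^ i \<le> x" "x < 2 ^ Suc i"
      using ex_power_ivl1 [of 2 x] z by (auto simp: add.commute)
    have "2 \<le> i"
    proof (rule ccontr)
      assume "\<not> 2 \<le> i"
      then have "(2::nat) ^ Suc i \<le> 2 ^ 2" by (intro power_increasing) auto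
      then show False using i z by simp
    qed
    moreover have "i < m - 4"
    proof (rule ccontr)
      assume "\<not> i < m - 4"
      then have "(2::nat) ^ (m - 4) \<le> 2 ^ i" by (intro power_increasing) auto
      then show False using i z by linarith
    qed
    ultimately have "x \<le> tooth_height \<gamma> (int x)" using block(2) i by blast
    moreover have "x \<le> N"
    proof -
      have "(2::nat) ^ (m - 4) \<le> 2 ^ m" by (intro power_increasing) auto
      then have "x \<le> 2 ^ m" using z by linarith
      then show ?thesis unfolding N_def n_def by (intro le_SucI trans_le_add2)
    qed
    ultimately show "z \<in> strip (int N)" using z by (simp add: strip_def)
  qed
  also have "\<dots> = Psi (weight (\<gamma> - 1)) (1 - tt m) (Suc n) (0, 0) (0, 0)"
    by (subst Psi_eq_sum_strip [of 0 "Suc n" "int N"]) (simp_all add: F_def N_def)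
  finally show ?thesis by blast
qed

text \<open>With \<open>\<beta> = \<gamma> - 1\<close> every scale contributes
  \<open>1 / lg (2 ^ i)\<close>, whatever \<gamma> is. The upper bound over all starting points and
  the lower bound at the origin are then multiples of the same divergent \<open>S m\<close>, which
  is the comparability required by \<open>recurrent_collisions\<close>.\<close>

lemma infinite_collisions:
  assumes \<gamma>2: "\<gamma> \<le> 2"
  shows "(avp ^^ N) colinf (0, 0) (0, 0) = 1"
proof -
  let ?f = "weight (\<gamma> - 1)"
  define S where "S m = (\<Sum>i<m. 1 / lg (2 ^ i))" for m
  define c4 :: real where "c4 = 1 / 14155776"
  have pm: "lg (2 ^ i) powr (\<gamma> - 1 - \<gamma>) = 1 / lg (2 ^ i)" for i
    using lg_pos [of "2 ^ i"] by (simp add: powr_minus_divide del: lg_pos)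
  obtain c where c: "0 \<le> c" "\<And>\<alpha> s N m. 1 / 2 \<le> s \<Longrightarrow> s < 1 \<Longrightarrow> tt m \<le> 1 - s \<Longrightarrow>
    Psi ?f s N (\<alpha>, 0) (\<alpha>, 0) \<le> c * (1 + S m)"
    using Psi_spine_le [of "\<gamma> - 1"] gamma_pos \<gamma>2 unfolding pm S_def by auto
  have S_top: "filterlim S at_top sequentially"
  proof (rule filterlim_at_top_mono)
    show "filterlim (\<lambda>n. harm n :: real) at_top sequentially" by (rule harm_at_top)
    show "\<forall>\<^sub>F m in sequentially. harm m \<le> S m"
    proof (rule always_eventually, rule allI)
      fix m
      have "(harm m :: real) = (\<Sum>i<m. 1 / (real i + 1))"
        unfolding harm_def
        by (rule sum.reindex_bij_witness [of _ Suc "\<lambda>k. k - 1"]) (auto simp: divide_inverse)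
      also have "\<dots> \<le> S m"
        unfolding S_def using lg_pow2_bounds(2) by (intro sum_mono divide_left_mono) auto
      finally show "harm m \<le> S m" .
    qed
  qed
  show ?thesis
  proof (rule recurrent_collisions [of ?f "(28 + 8 * c) / c4"])
    show "0 \<le> ?f v" for v by (rule weight_nonneg)
    show "?f v \<le> 1" for v
    proof -
      have "?f v \<le> 1 / (1 + real (snd v))" using weight_le [of "\<gamma> - 1" "fst v" "snd v"] \<gamma>2 by simp
      also have "\<dots> \<le> 1" by simp
      finally show ?thesis .
    qed
    show "0 < (28 + 8 * c) / c4" using c(1) by (simp add: c4_def)
    fix K :: real
    have ev: "\<forall>\<^sub>F m in sequentially. Z \<le> S m" for Z
      using S_top by (simp add: filterlim_at_top)
    have "\<forall>\<^sub>F m in sequentially. 7 \<le> m \<and> 12 \<le> S m \<and> 2 * K / c4 + 1 \<le> S m"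
      using ev [of 12] ev [of "2 * K / c4 + 1"] eventually_ge_at_top [of 7]
      by eventually_elim auto
    \<comment> \<open>The lower bound at the origin omits two initial and four final scales, each
      contributing at most 1. Once \<open>S m \<ge> 12\<close>, they make up at most half of
      \<open>S m\<close>. The last condition pushes the mean above \<open>K\<close>.\<close>
    then obtain m where m: "7 \<le> m" "12 \<le> S m" "2 * K / c4 + 1 \<le> S m"
      by (auto simp: eventually_sequentially)
    define s where "s = 1 - tt m"
    have "(4::real) ^ 1 \<le> 4 ^ m" using m by (intro power_increasing) auto
    then have "1 / 4 ^ m \<le> (1 / 4 :: real)" by (simp add: divide_simps)
    then have "1 / 2 \<le> s" using tt_le [of m] unfolding s_def by linarith
    then have s: "1 / 2 \<le> s" "s < 1" "tt m \<le> 1 - s"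
      using tt_pos [of m] by (simp_all add: s_def)
    obtain n where "(\<Sum>i\<in>{2..<m - 4}. 1 / 14155776 / lg (2 ^ i)) \<le> Psi ?f (1 - tt m) (Suc n) (0, 0) (0, 0)"
      using Psi_origin_ge [OF \<gamma>2 m(1)] by blast
    then have n: "(\<Sum>i\<in>{2..<m - 4}. c4 / lg (2 ^ i)) \<le> Psi ?f s (Suc n) (0, 0) (0, 0)"
      unfolding c4_def s_def .
    have "S m \<le> (\<Sum>i\<in>{2..<m - 4}. 1 / lg (2 ^ i)) + 6"
    proof -
      have "{..<m} = {2..<m - 4} \<union> ({0, 1} \<union> {m - 4..<m})" using m by auto
      then have "S m = (\<Sum>i\<in>{2..<m - 4}. 1 / lg (2 ^ i)) + (\<Sum>i\<in>{0, 1} \<union> {m - 4..<m}. 1 / lg (2 ^ i))"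
        unfolding S_def using m by (simp only:) (subst sum.union_disjoint; auto)
      also have "(\<Sum>i\<in>{0, 1} \<union> {m - 4..<m}. 1 / lg (2 ^ i)) \<le> (\<Sum>i\<in>{0, 1} \<union> {m - 4..<m}. 1)"
        using lg_ge_1 by (intro sum_mono) (simp add: divide_le_eq)
      also have "\<dots> = real (card ({0, 1} \<union> {m - 4..<m}))" by simp
      also have "card ({0, 1} \<union> {m - 4..<m}) \<le> card {0::nat, 1} + card {m - 4..<m}"
        by (rule card_Un_le)
      also have "\<dots> \<le> 6" using m by simp
      finally show ?thesis by simp
    qed
    then have "S m / 2 \<le> (\<Sum>i\<in>{2..<m - 4}. 1 / lg (2 ^ i))" using m by linarith
    then have "c4 * (S m / 2) \<le> c4 * (\<Sum>i\<in>{2..<m - 4}. 1 / lg (2 ^ i))"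
      by (intro mult_left_mono) (auto simp: c4_def)
    then have P: "c4 * S m \<le> 2 * Psi ?f s (Suc n) (0, 0) (0, 0)"
      using n by (simp add: sum_distrib_left del: Psi.simps)
    have "Psi ?f s N v v \<le> (28 + 8 * c) / c4 * Psi ?f s (Suc n) (0, 0) (0, 0)" if "v \<in> verts" for N v
    proof -
      have "Psi ?f s N v v \<le> 14 + 2 * (c * (1 + S m))"
        using s that \<gamma>2 by (intro Psi_diag_le weight_nonneg weight_le c(2)) auto
      also have "\<dots> \<le> (14 + 4 * c) * S m"
      proof -
        have "c * 1 \<le> c * S m" using m c(1) by (intro mult_left_mono) auto
        then show ?thesis using m by (simp add: algebra_simps)
      qed
      also have "\<dots> = (14 + 4 * c) / c4 * (c4 * S m)" by (simp add: c4_def)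
      also have "\<dots> \<le> (14 + 4 * c) / c4 * (2 * Psi ?f s (Suc n) (0, 0) (0, 0))"
        using c(1) by (intro mult_left_mono P) (auto simp: c4_def)
      also have "\<dots> = (28 + 8 * c) / c4 * Psi ?f s (Suc n) (0, 0) (0, 0)"
        by (simp add: field_simps c4_def del: Psi.simps)
      finally show ?thesis .
    qed
    moreover have "K < Psi ?f s (Suc n) (0, 0) (0, 0)"
    proof -
      have "c4 * (2 * K / c4 + 1) \<le> c4 * S m" using m by (intro mult_left_mono) (auto simp: c4_def)
      moreover have "c4 * (2 * K / c4 + 1) = 2 * K + c4" by (simp add: c4_def)
      moreover have "0 < c4" by (simp add: c4_def)
      ultimately show ?thesis using P by linarith
    qed
    ultimately show "\<exists>s n. 0 \<le> s \<and> s \<le> 1 \<and> K < Psi ?f s (Suc n) (0, 0) (0, 0) \<and>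
        (\<forall>N. \<forall>v\<in>verts. Psi ?f s N v v \<le> (28 + 8 * c) / c4 * Psi ?f s (Suc n) (0, 0) (0, 0))"
      using s by (intro exI [of _ s] exI [of _ n]) auto
  qed
qed

end

subsection \<open>Path measures\<close>

definition pair_step :: "'v pair_pre_digraph \<Rightarrow> 'v \<times> 'v \<Rightarrow> ('v \<times> 'v) pmf" where
  "pair_step G q = pair_pmf (srw_step G (fst q)) (srw_step G (snd q))"

primrec path_pmf :: "('s \<Rightarrow> 's pmf) \<Rightarrow> nat \<Rightarrow> 's \<Rightarrow> 's list pmf" where
  "path_pmf K 0 q = return_pmf [q]"
| "path_pmf K (Suc n) q = bind_pmf (K q) (\<lambda>t. map_pmf ((#) q) (path_pmf K n t))"

text \<open>The same product as in \<open>measure_srw_cylinder\<close>, so discrete path laws and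
  the law on infinite paths can be compared on cylinders.\<close>

lemma pmf_path_pmf:
  "pmf (path_pmf K n q) xs =
    (if length xs = Suc n \<and> xs ! 0 = q then \<Prod>i<n. pmf (K (xs ! i)) (xs ! Suc i) else 0)"
proof (induction n arbitrary: q xs)
  case 0
  then show ?case by (cases xs) (auto simp: indicator_def)
next
  case (Suc n)
  show ?case
  proof (cases xs)
    case Nil
    then show ?thesis by (auto simp: pmf_eq_0_set_pmf)
  next
    case (Cons a ys)
    have map: "pmf (map_pmf ((#) q) (path_pmf K n t)) xs = (if a = q then pmf (path_pmf K n t) ys else 0)" for t
    proof (cases "a = q")
      case True
      then show ?thesis using pmf_map_inj' [of "(#) q" "path_pmf K n t" ys] by (simp add: Cons inj_def)
    next
      case False
      then show ?thesis by (auto simp: pmf_eq_0_set_pmf Cons)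
    qed
    define c where "c = (if a = q \<and> length ys = Suc n then \<Prod>i<n. pmf (K (ys ! i)) (ys ! Suc i) else 0)"
    have "pmf (path_pmf K (Suc n) q) xs = (\<integral>t. c * indicator {ys ! 0} t \<partial>measure_pmf (K q))"
      unfolding path_pmf.simps pmf_bind map
      by (intro Bochner_Integration.integral_cong) (auto simp: Suc c_def indicator_def)
    also have "\<dots> = c * pmf (K q) (ys ! 0)"
      by (simp add: measure_pmf_single)
    also have "\<dots> = (if length xs = Suc (Suc n) \<and> xs ! 0 = q
        then \<Prod>i<Suc n. pmf (K (xs ! i)) (xs ! Suc i) else 0)"
      by (subst prod.lessThan_Suc_shift) (auto simp: c_def Cons)
    finally show ?thesis .
  qed
qed

lemma space_srw_law: "space (srw_law G x) = UNIV"
proof -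
  have "space (srw_law G x) = space (Pi\<^sub>M UNIV (\<lambda>_. count_space UNIV))"
    by (rule sets_eq_imp_space_eq [OF sets_srw_law])
  then show ?thesis by (simp add: space_PiM)
qed

lemma sets_srw_cylinder: "{\<omega>. \<forall>i\<le>n. \<omega> i = p i} \<in> sets (srw_law G x)"
proof -
  have "{\<omega> \<in> space (Pi\<^sub>M UNIV (\<lambda>_. count_space UNIV)). \<forall>i\<in>{..n}. \<omega> i = p i} \<in>
      sets (Pi\<^sub>M (UNIV :: nat set) (\<lambda>_. count_space UNIV))"
  proof (rule sets.sets_Collect_countable_Ball)
    fix i
    have "(\<lambda>\<omega>. \<omega> i) -` {p i} \<inter> space (Pi\<^sub>M UNIV (\<lambda>_. count_space UNIV)) \<in>
        sets (Pi\<^sub>M (UNIV :: nat set) (\<lambda>_. count_space UNIV))"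
      by (rule measurable_sets [OF measurable_component_singleton]) auto
    then show "{\<omega> \<in> space (Pi\<^sub>M UNIV (\<lambda>_. count_space UNIV)). \<omega> i = p i} \<in>
        sets (Pi\<^sub>M (UNIV :: nat set) (\<lambda>_. count_space UNIV))"
      by (simp add: vimage_def Int_def conj_commute)
  qed
  then show ?thesis by (simp add: sets_srw_law space_PiM Ball_def)
qed

definition pair_path :: "nat \<Rightarrow> (nat \<Rightarrow> 'v) \<times> (nat \<Rightarrow> 'v) \<Rightarrow> ('v \<times> 'v) list" where
  "pair_path n \<omega> = map (\<lambda>i. (fst \<omega> i, snd \<omega> i)) [0..<Suc n]"

lemma pair_path_vimage:
  assumes "length xs = Suc n"
  shows "pair_path n -` {xs} =
    {\<omega>. \<forall>i\<le>n. \<omega> i = fst (xs ! i)} \<times> {\<omega>. \<forall>i\<le>n. \<omega> i = snd (xs ! i)}"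
proof -
  have iff: "pair_path n \<omega> = xs \<longleftrightarrow> (\<forall>i\<le>n. (fst \<omega> i, snd \<omega> i) = xs ! i)" for \<omega>
    unfolding pair_path_def using assms
    by (auto simp: list_eq_iff_nth_eq less_Suc_eq_le simp del: upt_Suc)
  show ?thesis by (auto simp: vimage_def iff mem_Times_iff prod_eq_iff)
qed

lemma pair_path_vimage_empty: "length xs \<noteq> Suc n \<Longrightarrow> pair_path n -` {xs} = {}"
  by (auto simp: pair_path_def)

context
  fixes G :: "'v::countable pair_pre_digraph" and x y :: 'v
begin

abbreviation (input) "two_walks \<equiv> srw_law G x \<Otimes>\<^sub>M srw_law G y"

lemma space_two_walks: "space two_walks = UNIV"
  by (simp add: space_pair_measure space_srw_law)

lemma prob_space_two_walks: "prob_space two_walks"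
proof -
  interpret X: prob_space "srw_law G x" by (rule prob_space_srw_law)
  interpret Y: prob_space "srw_law G y" by (rule prob_space_srw_law)
  interpret pair_prob_space "srw_law G x" "srw_law G y" ..
  show ?thesis by (rule P.prob_space_axioms)
qed

lemma measurable_pair_path: "pair_path n \<in> two_walks \<rightarrow>\<^sub>M count_space UNIV"
proof (subst measurable_count_space_eq_countable, simp, intro conjI ballI)
  fix xs :: "('v \<times> 'v) list"
  show "pair_path n -` {xs} \<inter> space two_walks \<in> sets two_walks"
  proof (cases "length xs = Suc n")
    case True
    then show ?thesis
      by (simp add: pair_path_vimage space_two_walks sets_srw_cylinder)
  qed (simp add: pair_path_vimage_empty)
qed auto

text \<open>Lists over a countable type form a countable set, so singletons determine the law. The
  preimage of a singleton is a product of two cylinders, to which independence applies.\<close>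

lemma distr_pair_path:
  "distr two_walks (count_space UNIV) (pair_path n) = measure_pmf (path_pmf (pair_step G) n (x, y))"
proof (rule measure_eqI_countable [of _ UNIV])
  fix xs :: "('v \<times> 'v) list"
  interpret Y: prob_space "srw_law G y" by (rule prob_space_srw_law)
  interpret X: prob_space "srw_law G x" by (rule prob_space_srw_law)
  have 1: "emeasure (distr two_walks (count_space UNIV) (pair_path n)) {xs} =
      emeasure two_walks (pair_path n -` {xs})"
    by (subst emeasure_distr [OF measurable_pair_path]) (auto simp: space_two_walks)
  have pmf_pair: "pmf (pair_step G q) q' = pmf (srw_step G (fst q)) (fst q') * pmf (srw_step G (snd q)) (snd q')" for q q'
    using pmf_pair [of "srw_step G (fst q)" "srw_step G (snd q)" "fst q'" "snd q'"]
    by (simp add: pair_step_def)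
  show "emeasure (distr two_walks (count_space UNIV) (pair_path n)) {xs} =
      emeasure (measure_pmf (path_pmf (pair_step G) n (x, y))) {xs}"
  proof (cases "length xs = Suc n")
    case True
    have "emeasure two_walks (pair_path n -` {xs}) =
        emeasure (srw_law G x) {\<omega>. \<forall>i\<le>n. \<omega> i = fst (xs ! i)} *
        emeasure (srw_law G y) {\<omega>. \<forall>i\<le>n. \<omega> i = snd (xs ! i)}"
      unfolding pair_path_vimage [OF True]
      by (rule Y.emeasure_pair_measure_Times [OF sets_srw_cylinder sets_srw_cylinder])
    also have "\<dots> = ennreal (pmf (path_pmf (pair_step G) n (x, y)) xs)"
      unfolding X.emeasure_eq_measure Y.emeasure_eq_measure measure_srw_cylinder
        pmf_path_pmf pmf_pair prod.distrib using True
      by (subst ennreal_mult [symmetric]) (auto simp: prod_nonneg prod_eq_iff)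
    finally show ?thesis unfolding 1 by (simp add: emeasure_pmf_single)
  next
    case False
    then show ?thesis unfolding 1
      by (simp add: pair_path_vimage_empty emeasure_pmf_single pmf_path_pmf)
  qed
qed auto

lemma emeasure_pair_path:
  "emeasure two_walks {\<omega>. \<phi> (pair_path n \<omega>)} = emeasure (measure_pmf (path_pmf (pair_step G) n (x, y))) {xs. \<phi> xs}"
  unfolding distr_pair_path [symmetric]
  by (subst emeasure_distr [OF measurable_pair_path]) (auto simp: space_two_walks vimage_def)

lemma sets_pair_path: "{\<omega>. \<phi> (pair_path n \<omega>)} \<in> sets two_walks"
  using measurable_sets [OF measurable_pair_path, of "{xs. \<phi> xs}" n]
  by (simp add: space_two_walks vimage_def)


end

section \<open>Collision probabilities under the path measure\<close>

context comb_walk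
begin

lemma emeasure_path_hit:
  assumes step: "\<And>v. v \<in> verts \<Longrightarrow> srw_step G v = pmf_of_set (nb v)"
    and vw: "v \<in> verts" "w \<in> verts"
  shows "emeasure (measure_pmf (path_pmf (pair_step G) n (v, w))) {xs. hit N xs} =
    ennreal ((avp ^^ N) (col (Suc n - N)) v w)"
proof -
  have nn_av: "(\<integral>\<^sup>+v'. ennreal (\<phi> v') \<partial>srw_step G v) = ennreal (av \<phi> v)"
    if "v \<in> verts" "\<And>v. 0 \<le> \<phi> v" for \<phi> v
    using that deg_pos [of v]
    by (simp add: step nn_integral_pmf_of_set sum_ennreal av_def divide_ennreal sum_nonneg
        ennreal_of_nat_eq_real_of_nat del: deg_pos)
  have pexp0: "0 \<le> pexp n F v w" if "\<And>xs. 0 \<le> F xs" for n F v w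
    using pexp_mono [of "\<lambda>_. 0" F n v w] that by simp
  have nn_pexp: "(\<integral>\<^sup>+xs. ennreal (F xs) \<partial>path_pmf (pair_step G) n (v, w)) = ennreal (pexp n F v w)"
    if "v \<in> verts" "w \<in> verts" "\<And>xs. 0 \<le> F xs" for F n v w
    using that
  proof (induction n arbitrary: F v w)
    case (Suc n)
    let ?F = "\<lambda>xs. F ((v, w) # xs)"
    have "(\<integral>\<^sup>+xs. ennreal (F xs) \<partial>path_pmf (pair_step G) (Suc n) (v, w)) =
        (\<integral>\<^sup>+v'. \<integral>\<^sup>+w'. (\<integral>\<^sup>+xs. ennreal (?F xs) \<partial>path_pmf (pair_step G) n (v', w')) \<partial>srw_step G w \<partial>srw_step G v)"
      by (simp add: pair_step_def nn_integral_pair_pmf')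
    also have "\<dots> = (\<integral>\<^sup>+v'. \<integral>\<^sup>+w'. ennreal (pexp n ?F v' w') \<partial>srw_step G w \<partial>srw_step G v)"
    proof (intro nn_integral_cong_AE AE_pmfI)
      fix v' w' assume "v' \<in> set_pmf (srw_step G v)" "w' \<in> set_pmf (srw_step G w)"
      then have "v' \<in> nb v" "w' \<in> nb w"
        using Suc.prems by (auto simp: step)
      then show "(\<integral>\<^sup>+xs. ennreal (?F xs) \<partial>path_pmf (pair_step G) n (v', w')) = ennreal (pexp n ?F v' w')"
        using Suc.prems nb_verts by (intro Suc.IH) blast+
    qed
    also have "\<dots> = (\<integral>\<^sup>+v'. ennreal (av (pexp n ?F v') w) \<partial>srw_step G v)"
      using Suc.prems by (subst nn_av) (auto intro: pexp0)
    also have "\<dots> = ennreal (pexp (Suc n) F v w)"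
      using Suc.prems by (subst nn_av) (auto intro!: av_nonneg pexp0 simp: avp_def)
    finally show ?case .
  qed simp
  have "emeasure (measure_pmf (path_pmf (pair_step G) n (v, w))) {xs. hit N xs} =
      (\<integral>\<^sup>+xs. ennreal (of_bool (hit N xs)) \<partial>path_pmf (pair_step G) n (v, w))"
  proof -
    have "(\<integral>\<^sup>+xs. ennreal (of_bool (hit N xs)) \<partial>path_pmf (pair_step G) n (v, w)) =
        (\<integral>\<^sup>+xs. indicator {xs. hit N xs} xs \<partial>path_pmf (pair_step G) n (v, w))"
      by (intro nn_integral_cong) (simp add: indicator_def)
    then show ?thesis by simp
  qed
  also have "\<dots> = ennreal (pexp n (\<lambda>xs. of_bool (hit N xs)) v w)"
    by (rule nn_pexp [OF vw]) simp
  finally show ?thesis by (simp add: pexp_hit)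
qed

text \<open>The event is the increasing union over \<open>n\<close> of collisions at times between
  \<open>N\<close> and \<open>n\<close>. These are events of finite paths, and their probabilities
  converge because \<open>col\<close> increases to \<open>colinf\<close>.\<close>

lemma late_collision_prob:
  assumes step: "\<And>v. v \<in> verts \<Longrightarrow> srw_step G v = pmf_of_set (nb v)" and v: "v \<in> verts"
  shows "{\<omega>. \<exists>n\<ge>N. fst \<omega> n = snd \<omega> n} \<in> sets (srw_law G v \<Otimes>\<^sub>M srw_law G v)"
    and "emeasure (srw_law G v \<Otimes>\<^sub>M srw_law G v) {\<omega>. \<exists>n\<ge>N. fst \<omega> n = snd \<omega> n} =
      ennreal ((avp ^^ N) colinf v v)"
proof -
  let ?M = "srw_law G v \<Otimes>\<^sub>M srw_law G v"
  define E where "E n = {\<omega> :: (nat \<Rightarrow> int \<times> nat) \<times> (nat \<Rightarrow> int \<times> nat). hit N (pair_path n \<omega>)}" for n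
  have hit_iff: "hit N (pair_path n \<omega>) \<longleftrightarrow> (\<exists>i\<ge>N. i \<le> n \<and> fst \<omega> i = snd \<omega> i)"
    for n and \<omega> :: "(nat \<Rightarrow> int \<times> nat) \<times> (nat \<Rightarrow> int \<times> nat)"
    by (auto simp: hit_def pair_path_def drop_map less_Suc_eq_le simp del: upt_Suc)
  have E: "{\<omega>. \<exists>n\<ge>N. fst \<omega> n = snd \<omega> n} = (\<Union>n. E n)"
    by (auto simp: E_def hit_iff)
  have E_sets: "E n \<in> sets ?M" for n
    unfolding E_def by (rule sets_pair_path)
  show "{\<omega>. \<exists>n\<ge>N. fst \<omega> n = snd \<omega> n} \<in> sets ?M"
    unfolding E using E_sets by auto
  have inc: "incseq E" by (auto simp: incseq_def E_def hit_iff intro: order.trans)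
  have "(\<lambda>n. emeasure ?M (E n)) \<longlonglongrightarrow> emeasure ?M (\<Union>n. E n)"
    using E_sets by (intro Lim_emeasure_incseq inc) auto
  moreover have "emeasure ?M (E n) = ennreal ((avp ^^ N) (col (Suc n - N)) v v)" for n
    unfolding E_def emeasure_pair_path by (rule emeasure_path_hit [OF step v v])
  moreover have "(\<lambda>n. ennreal ((avp ^^ N) (col (Suc n - N)) v v)) \<longlonglongrightarrow> ennreal ((avp ^^ N) colinf v v)"
  proof (intro tendsto_ennrealI avp_pow_tendsto)
    fix v w
    have "filterlim (\<lambda>n. Suc n - N) sequentially sequentially"
      using filterlim_compose [OF filterlim_minus_const_nat_at_top [of N] filterlim_Suc] by simp
    then show "(\<lambda>n. col (Suc n - N) v w) \<longlonglongrightarrow> colinf v w"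
      by (rule filterlim_compose [OF col_tendsto])
  qed
  ultimately show "emeasure ?M {\<omega>. \<exists>n\<ge>N. fst \<omega> n = snd \<omega> n} = ennreal ((avp ^^ N) colinf v v)"
    unfolding E using LIMSEQ_unique by simp
qed

end

lemma infinite_collisions_iff:
  fixes X Y :: "nat \<Rightarrow> 'a"
  shows "infinite {n. X n = Y n} \<longleftrightarrow> (\<forall>N. \<exists>n\<ge>N. X n = Y n)"
  by (simp add: infinite_nat_iff_unbounded_le)

section \<open>Identification with the comb graph and the collision properties\<close>

context log_comb
begin

lemma comb_verts_eq: "comb_verts (log_profile \<gamma>) = verts"
proof -
  have "real l \<le> log_profile \<gamma> x \<longleftrightarrow> l \<le> tooth_height \<gamma> x" for x l
    using log_profile_nonneg [of \<gamma> x] by (simp add: tooth_height_def le_nat_iff le_floor_iff)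
  then show ?thesis by (simp add: comb_verts_def verts_def)
qed

lemma neighbours_eq:
  assumes "v \<in> verts"
  shows "neighbours (comb (log_profile \<gamma>)) v = nb v"
proof -
  obtain x l where v: "v = (x, l)" by force
  have l: "l \<le> tooth_height \<gamma> x" using assms by (simp add: v verts_def)
  show ?thesis
  proof (rule set_eqI)
    fix u :: "int \<times> nat"
    obtain y k where u: "u = (y, k)" by force
    have "u \<in> neighbours (comb (log_profile \<gamma>)) v \<longleftrightarrow> k \<le> tooth_height \<gamma> y \<and>
        (l = 0 \<and> k = 0 \<and> \<bar>x - y\<bar> = 1 \<or> x = y \<and> \<bar>int l - int k\<bar> = 1)"
      using l by (auto simp: neighbours_def comb_def comb_verts_eq verts_def u v)
    also have "\<dots> \<longleftrightarrow> u \<in> nb v"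
      using l by (auto simp: nb_def u v abs_if split: if_splits)
    finally show "u \<in> neighbours (comb (log_profile \<gamma>)) v \<longleftrightarrow> u \<in> nb v" .
  qed
qed

lemma connected: "connected_locally_finite_graph (comb (log_profile \<gamma>))"
  by (rule connected_locally_finite_comb) (rule log_profile_nonneg)

lemma srw_step_eq: "v \<in> verts \<Longrightarrow> srw_step (comb (log_profile \<gamma>)) v = pmf_of_set (nb v)"
  by (simp add: srw_step_def neighbours_eq)

lemma infinite_collision_property_log_comb:
  assumes "\<gamma> \<le> 2"
  shows "infinite_collision_property (comb (log_profile \<gamma>))"
proof -
  let ?G = "comb (log_profile \<gamma>)" and ?o = "(0::int, 0::nat)"
  let ?M = "srw_law ?G ?o \<Otimes>\<^sub>M srw_law ?G ?o"
  have o: "?o \<in> verts" by (simp add: verts_def)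
  interpret P: prob_space ?M by (rule prob_space_two_walks)
  have "AE \<omega> in ?M. \<exists>n\<ge>N. fst \<omega> n = snd \<omega> n" for N
  proof (rule P.AE_I_eq_1)
    show "{\<omega> \<in> space ?M. \<exists>n\<ge>N. fst \<omega> n = snd \<omega> n} \<in> sets ?M"
      using late_collision_prob(1) [OF srw_step_eq o] by (simp add: space_two_walks)
    show "emeasure ?M {\<omega> \<in> space ?M. \<exists>n\<ge>N. fst \<omega> n = snd \<omega> n} = 1"
      using late_collision_prob(2) [OF srw_step_eq o, of N] infinite_collisions [OF assms, of N]
      by (simp add: space_two_walks)
  qed
  then have "AE \<omega> in ?M. \<forall>N. \<exists>n\<ge>N. fst \<omega> n = snd \<omega> n" by (simp add: AE_all_countable)
  then have "AE (X1, X2) in ?M. infinite {n. X1 n = X2 n}"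
    by (simp add: infinite_collisions_iff case_prod_beta)
  moreover have "?o \<in> pverts ?G" using o by (simp add: comb_def comb_verts_eq)
  ultimately show ?thesis
    unfolding infinite_collision_property_def
    using connected by blast
qed

lemma finite_collision_property_log_comb:
  assumes "2 < \<gamma>"
  shows "finite_collision_property (comb (log_profile \<gamma>))"
proof -
  let ?G = "comb (log_profile \<gamma>)" and ?o = "(0::int, 0::nat)"
  let ?M = "srw_law ?G ?o \<Otimes>\<^sub>M srw_law ?G ?o"
  have o: "?o \<in> verts" by (simp add: verts_def)
  interpret P: prob_space ?M by (rule prob_space_two_walks)
  define E where "E N = {\<omega> :: (nat \<Rightarrow> int \<times> nat) \<times> (nat \<Rightarrow> int \<times> nat). \<exists>n\<ge>N. fst \<omega> n = snd \<omega> n}" for N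
  have E_sets: "E N \<in> sets ?M" for N
    unfolding E_def by (rule late_collision_prob(1) [OF srw_step_eq o])
  have "(\<lambda>N. emeasure ?M (E N)) \<longlonglongrightarrow> emeasure ?M (\<Inter>N. E N)"
    using E_sets by (intro Lim_emeasure_decseq) (auto simp: decseq_def E_def intro: order.trans)
  moreover have "(\<lambda>N. emeasure ?M (E N)) \<longlonglongrightarrow> ennreal 0"
  proof -
    have "emeasure ?M (E N) = ennreal ((avp ^^ N) colinf ?o ?o)" for N
      unfolding E_def by (rule late_collision_prob(2) [OF srw_step_eq o])
    then show ?thesis by (simp only:) (intro tendsto_ennrealI finite_collisions assms)
  qed
  ultimately have "emeasure ?M (\<Inter>N. E N) = 0" using LIMSEQ_unique by fastforce
  then have "AE \<omega> in ?M. \<omega> \<notin> (\<Inter>N. E N)"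
    using E_sets by (intro AE_not_in) (auto simp: null_sets_def)
  moreover have "\<omega> \<in> (\<Inter>N. E N) \<longleftrightarrow> infinite {n. fst \<omega> n = snd \<omega> n}" for \<omega>
    unfolding infinite_collisions_iff E_def by simp
  ultimately have "AE \<omega> in ?M. finite {n. fst \<omega> n = snd \<omega> n}" by (simp only: not_not)
  then have "AE (X1, X2) in ?M. finite {n. X1 n = X2 n}" by (simp add: case_prod_beta)
  moreover have "?o \<in> pverts ?G" using o by (simp add: comb_def comb_verts_eq)
  ultimately show ?thesis
    unfolding finite_collision_property_def
    using connected by blast
qed

end

theorem theorem3p1:
  fixes \<gamma> :: real
  assumes "0 < \<gamma>"
  shows "(\<gamma> \<le> 2 \<longrightarrow> infinite_collision_property (comb (log_profile \<gamma>))) \<and>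
         (2 < \<gamma> \<longrightarrow> finite_collision_property (comb (log_profile \<gamma>)))"
proof -
  interpret log_comb \<gamma> by (rule log_comb.intro [OF assms])
  show ?thesis
    using infinite_collision_property_log_comb finite_collision_property_log_comb by blast
qed

end
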